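(* Let $\mathcal{E}=(L|K,v)$ be an Artin-Schreier extension of valued fields of degree $p=[Lv:Kv]=\mathrm{char}\,K$ with $Lv|Kv$ inseparable. Then there exist an Artin-Schreier generator $\vartheta$ of $L|K$ of value $v\vartheta<0$ and $\tilde c\in K$ such that $v(\tilde c\vartheta)=0$, $Lv=Kv((\tilde c\vartheta)v)$, $\mathcal{O}_L=\mathcal{O}_K[\tilde c\vartheta]$, and $$\Omega_{\mathcal{O}_L|\mathcal{O}_K}\cong\mathcal{O}_L/(\tilde c^{\,p-1})\cong I_{\mathcal{E}}/I_{\mathcal{E}}^p$$ as $\mathcal{O}_L$-modules. Consequently, $\Omega_{\mathcal{O}_L|\mathcal{O}_K}\neq0$.
   Context: Valuations are Krull valuations of arbitrary rank. $(L|K,v)$ denotes a field extension $L|K$ with a valuation $v$ on $L$, $K$ being endowed with the restriction of $v$. $\mathcal{O}_K,\mathcal{O}_L$ are the valuation rings, $vK,vL$ the value groups, $Kv,Lv$ the residue fields, $vx$ the value and $xv$ the residue of an element $x$. $\Omega_{B|A}$ is the module of relative Kähler differentials. An Artin-Schreier extension is a Galois extension $L|K$ of degree $p=\mathrm{char}\,K>0$; an Artin-Schreier generator is an element $\vartheta$ with $L=K(\vartheta)$ and $\vartheta^p-\vartheta\in K$. Here $(L|K,v)$ is automatically unibranched (the extension of $v$ from $K$ to $L$ is unique). $I_{\mathcal{E}}$ is the ramification ideal of $\mathcal{E}$: the $\mathcal{O}_L$-ideal generated by all elements $\frac{\sigma b-b}{b}$ with $\sigma\in\mathrm{Gal}(L|K)$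 and $b\in L^\times$. $(a)$ denotes the $\mathcal{O}_L$-ideal generated by $a$. *)

theory Defs
  imports "HOL-Algebra.Algebra" "HOL-Library.Extended"
begin

section \<open>Galois and Artin-Schreier extensions\<close>

text \<open>A field extension \<open>L|K\<close> is given by a field \<open>L\<close> and a set \<open>K\<close> with \<^term>\<open>subfield K L\<close>.
  Its degree is \<open>n\<close> iff \<^term>\<open>ring.dimension L n K (carrier L)\<close>.\<close>

definition ring_char :: "('a, 'b) ring_scheme \<Rightarrow> nat" where
  "ring_char R =
     (if \<exists>n::nat>0. [n] \<cdot>\<^bsub>R\<^esub> \<one>\<^bsub>R\<^esub> = \<zero>\<^bsub>R\<^esub>
      then LEAST n::nat. n > 0 \<and> [n] \<cdot>\<^bsub>R\<^esub> \<one>\<^bsub>R\<^esub> = \<zero>\<^bsub>R\<^esub> else 0)"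

definition Gal :: "('a, 'b) ring_scheme \<Rightarrow> 'a set \<Rightarrow> ('a \<Rightarrow> 'a) set" where
  "Gal L K = {\<sigma> \<in> ring_iso L L \<inter> extensional (carrier L). \<forall>a\<in>K. \<sigma> a = a}"

text \<open>A finite extension is Galois iff \<open>K\<close> is the fixed field of the group of
  \<open>K\<close>-automorphisms.\<close>

definition finite_galois_extension :: "('a, 'b) ring_scheme \<Rightarrow> 'a set \<Rightarrow> bool" where
  "finite_galois_extension L K \<longleftrightarrow>
     field L \<and> subfield K L \<and> ring.finite_dimension L K (carrier L) \<and>
     {x \<in> carrier L. \<forall>\<sigma>\<in>Gal L K. \<sigma> x = x} = K"

definition artin_schreier_extension :: "nat \<Rightarrow> ('a, 'b) ring_scheme \<Rightarrow> 'a set \<Rightarrow> bool" where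
  "artin_schreier_extension p L K \<longleftrightarrow>
     finite_galois_extension L K \<and> ring.dimension L p K (carrier L) \<and>
     p = ring_char (L\<lparr>carrier := K\<rparr>) \<and> p > 0"

definition artin_schreier_generator :: "nat \<Rightarrow> ('a, 'b) ring_scheme \<Rightarrow> 'a set \<Rightarrow> 'a \<Rightarrow> bool" where
  "artin_schreier_generator p L K \<theta> \<longleftrightarrow>
     \<theta> \<in> carrier L \<and> generate_field L (insert \<theta> K) = carrier L \<and>
     \<theta> [^]\<^bsub>L\<^esub> p \<ominus>\<^bsub>L\<^esub> \<theta> \<in> K"


section \<open>Separability\<close>

text \<open>Polynomials of \<^theory>\<open>HOL-Algebra.Polynomials\<close> are coefficient lists, leading coefficient
  first.\<close>

definition poly_deriv :: "('a, 'b) ring_scheme \<Rightarrow> 'a list \<Rightarrow> 'a list" where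
  "poly_deriv R f =
     ring.normalize R (map (\<lambda>i. [i] \<cdot>\<^bsub>R\<^esub> ring.coeff R f i) (rev [1..<length f]))"

definition separable_poly :: "('a, 'b) ring_scheme \<Rightarrow> 'a set \<Rightarrow> 'a list \<Rightarrow> bool" where
  "separable_poly R K f \<longleftrightarrow>
     (\<exists>g\<in>carrier (K[X]\<^bsub>R\<^esub>). \<exists>h\<in>carrier (K[X]\<^bsub>R\<^esub>).
        g \<otimes>\<^bsub>K[X]\<^bsub>R\<^esub>\<^esub> f \<oplus>\<^bsub>K[X]\<^bsub>R\<^esub>\<^esub> h \<otimes>\<^bsub>K[X]\<^bsub>R\<^esub>\<^esub> poly_deriv R f = \<one>\<^bsub>K[X]\<^bsub>R\<^esub>\<^esub>)"

definition separable_extension :: "('a, 'b) ring_scheme \<Rightarrow> 'a set \<Rightarrow> bool" where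
  "separable_extension L K \<longleftrightarrow>
     (\<forall>x\<in>carrier L. \<not> ring.transcendental L K x \<and> separable_poly L K (ring.Irr L K x))"

definition inseparable_extension :: "('a, 'b) ring_scheme \<Rightarrow> 'a set \<Rightarrow> bool" where
  "inseparable_extension L K \<longleftrightarrow>
     (\<forall>x\<in>carrier L. \<not> ring.transcendental L K x) \<and> \<not> separable_extension L K"


section \<open>Krull valuations\<close>

text \<open>Values lie in \<open>\<Gamma> \<union> {\<infinity>}\<close> for an arbitrary ordered abelian group \<open>\<Gamma>\<close>. The type
  \<^typ>\<open>'g extended\<close> has an additional element \<^term>\<open>Minf\<close>, which is never a value.
  The map \<open>v\<close> is irrelevant outside \<^term>\<open>carrier L\<close>.\<close>

locale krull_valuation = field L for L (structure) +
  fixes v :: "'a \<Rightarrow> 'g::linordered_ab_group_add extended"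
  assumes v_not_Minf: "x \<in> carrier L \<Longrightarrow> v x \<noteq> Minf"
    and v_eq_Pinf_iff: "x \<in> carrier L \<Longrightarrow> v x = Pinf \<longleftrightarrow> x = \<zero>"
    and v_mult: "\<lbrakk>x \<in> carrier L; y \<in> carrier L\<rbrakk> \<Longrightarrow> v (x \<otimes> y) = v x + v y"
    and v_add: "\<lbrakk>x \<in> carrier L; y \<in> carrier L\<rbrakk> \<Longrightarrow> min (v x) (v y) \<le> v (x \<oplus> y)"

text \<open>The valuation ring of the restriction of \<open>v\<close> to a subfield \<open>K\<close> of \<open>L\<close>, as a subset of \<open>L\<close>.\<close>

definition val_set :: "('a \<Rightarrow> 'g::linordered_ab_group_add extended) \<Rightarrow> 'a set \<Rightarrow> 'a set" where
  "val_set v K = {x \<in> K. 0 \<le> v x}"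

definition val_ring ::
    "('a, 'b) ring_scheme \<Rightarrow> ('a \<Rightarrow> 'g::linordered_ab_group_add extended) \<Rightarrow> ('a, 'b) ring_scheme" where
  "val_ring L v = L\<lparr>carrier := val_set v (carrier L)\<rparr>"

definition val_ideal ::
    "('a, 'b) ring_scheme \<Rightarrow> ('a \<Rightarrow> 'g::linordered_ab_group_add extended) \<Rightarrow> 'a set" where
  "val_ideal L v = {x \<in> carrier L. 0 < v x}"

definition residue_field ::
    "('a, 'b) ring_scheme \<Rightarrow> ('a \<Rightarrow> 'g::linordered_ab_group_add extended) \<Rightarrow> 'a set ring" where
  "residue_field L v = val_ring L v Quot val_ideal L v"

definition residue ::
    "('a, 'b) ring_scheme \<Rightarrow> ('a \<Rightarrow> 'g::linordered_ab_group_add extended) \<Rightarrow> 'a \<Rightarrow> 'a set" where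
  "residue L v x = val_ideal L v +>\<^bsub>val_ring L v\<^esub> x"

text \<open>\<open>Kv\<close>, identified with its image under the canonical embedding \<open>Kv \<rightarrow> Lv\<close>.\<close>

definition residue_subfield ::
    "('a, 'b) ring_scheme \<Rightarrow> ('a \<Rightarrow> 'g::linordered_ab_group_add extended) \<Rightarrow> 'a set \<Rightarrow> 'a set set" where
  "residue_subfield L v K = residue L v ` val_set v K"

definition ramification_ideal ::
    "('a, 'b) ring_scheme \<Rightarrow> 'a set \<Rightarrow> ('a \<Rightarrow> 'g::linordered_ab_group_add extended) \<Rightarrow> 'a set" where
  "ramification_ideal L K v =
     Idl\<^bsub>val_ring L v\<^esub> {(\<sigma> b \<ominus>\<^bsub>L\<^esub> b) \<otimes>\<^bsub>L\<^esub> inv\<^bsub>L\<^esub> b | \<sigma> b. \<sigma> \<in> Gal L K \<and> b \<in> carrier L - {\<zero>\<^bsub>L\<^esub>}}"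


section \<open>Modules\<close>

text \<open>The record type of modules inherits the fields \<^const>\<open>monoid.mult\<close> and \<^const>\<open>one\<close> from rings; they
  play no role for modules and are left unspecified below.\<close>

definition ring_as_module :: "('a, 'b) ring_scheme \<Rightarrow> ('a, 'a) module" where
  "ring_as_module R =
     \<lparr>carrier = carrier R, monoid.mult = undefined, one = undefined, ring.zero = \<zero>\<^bsub>R\<^esub>,
      add = (\<oplus>\<^bsub>R\<^esub>), smult = (\<otimes>\<^bsub>R\<^esub>)\<rparr>"

definition quotient_module :: "('a, 'm, 'c) module_scheme \<Rightarrow> 'm set \<Rightarrow> ('a, 'm set) module" where
  "quotient_module M N =
     \<lparr>carrier = a_rcosets\<^bsub>M\<^esub> N, monoid.mult = undefined, one = undefined, ring.zero = N,
      add = set_add M, smult = (\<lambda>r C. \<Union>x\<in>C. N +>\<^bsub>M\<^esub> (r \<odot>\<^bsub>M\<^esub> x))\<rparr>"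

definition submodule_span ::
    "('a, 'b) ring_scheme \<Rightarrow> ('a, 'm, 'c) module_scheme \<Rightarrow> 'm set \<Rightarrow> 'm set" where
  "submodule_span R M S = \<Inter>{N. submodule N R M \<and> S \<subseteq> N}"

definition module_iso ::
    "('a, 'b) ring_scheme \<Rightarrow> ('a, 'm, 'c) module_scheme \<Rightarrow> ('a, 'n, 'd) module_scheme
     \<Rightarrow> ('m \<Rightarrow> 'n) set" where
  "module_iso R M N =
     {h. bij_betw h (carrier M) (carrier N) \<and>
         (\<forall>x\<in>carrier M. \<forall>y\<in>carrier M. h (x \<oplus>\<^bsub>M\<^esub> y) = h x \<oplus>\<^bsub>N\<^esub> h y) \<and>
         (\<forall>r\<in>carrier R. \<forall>x\<in>carrier M. h (r \<odot>\<^bsub>M\<^esub> x) = r \<odot>\<^bsub>N\<^esub> h x)}"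

definition module_isomorphic ::
    "('a, 'b) ring_scheme \<Rightarrow> ('a, 'm, 'c) module_scheme \<Rightarrow> ('a, 'n, 'd) module_scheme \<Rightarrow> bool" where
  "module_isomorphic R M N \<longleftrightarrow> module_iso R M N \<noteq> {}"

definition free_module :: "('a, 'b) ring_scheme \<Rightarrow> 's set \<Rightarrow> ('a, 's \<Rightarrow> 'a) module" where
  "free_module R S =
     \<lparr>carrier = {f. (\<forall>s. f s \<in> carrier R) \<and> finite {s. f s \<noteq> \<zero>\<^bsub>R\<^esub>} \<and> {s. f s \<noteq> \<zero>\<^bsub>R\<^esub>} \<subseteq> S},
      monoid.mult = undefined, one = undefined, ring.zero = (\<lambda>s. \<zero>\<^bsub>R\<^esub>),
      add = (\<lambda>f g s. f s \<oplus>\<^bsub>R\<^esub> g s), smult = (\<lambda>r f s. r \<otimes>\<^bsub>R\<^esub> f s)\<rparr>"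

definition free_gen :: "('a, 'b) ring_scheme \<Rightarrow> 's \<Rightarrow> 's \<Rightarrow> 'a" where
  "free_gen R s = (\<lambda>t. if t = s then \<one>\<^bsub>R\<^esub> else \<zero>\<^bsub>R\<^esub>)"


section \<open>Kaehler differentials\<close>

text \<open>For a subring \<open>A\<close> of a commutative ring \<open>B\<close>, \<open>\<Omega>\<^bsub>B|A\<^esub>\<close> is the \<open>B\<close>-module with one generator
  \<open>db\<close> for every \<open>b\<close> in \<open>B\<close> (here \<^term>\<open>free_gen B b\<close>), subject to additivity, the Leibniz rule
  and the vanishing of \<open>d\<close> on \<open>A\<close>.\<close>

definition kaehler_relations :: "('a, 'b) ring_scheme \<Rightarrow> 'a set \<Rightarrow> ('a \<Rightarrow> 'a) set" where
  "kaehler_relations B A =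
     (let F = free_module B (carrier B); d = free_gen B in
        {d (x \<oplus>\<^bsub>B\<^esub> y) \<ominus>\<^bsub>F\<^esub> (d x \<oplus>\<^bsub>F\<^esub> d y) | x y. x \<in> carrier B \<and> y \<in> carrier B} \<union>
        {d (x \<otimes>\<^bsub>B\<^esub> y) \<ominus>\<^bsub>F\<^esub> (x \<odot>\<^bsub>F\<^esub> d y \<oplus>\<^bsub>F\<^esub> y \<odot>\<^bsub>F\<^esub> d x) | x y. x \<in> carrier B \<and> y \<in> carrier B} \<union>
        {d a | a. a \<in> A})"

definition kaehler_differentials ::
    "('a, 'b) ring_scheme \<Rightarrow> 'a set \<Rightarrow> ('a, ('a \<Rightarrow> 'a) set) module" where
  "kaehler_differentials B A =
     (let F = free_module B (carrier B)
      in quotient_module F (submodule_span B F (kaehler_relations B A)))"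

end

theory Submission
  imports Defs
begin

text \<open>
  Since \<open>Lv|Kv\<close> has degree \<open>p\<close>, the powers \<open>1, x, \<dots>, x\<^sup>p\<^sup>-\<^sup>1\<close> of any integral \<open>x\<close> with
  \<open>xv \<notin> Kv\<close> form a valuation basis of \<open>L|K\<close>; hence \<open>vL = vK\<close> and \<open>\<O>\<^sub>L = \<O>\<^sub>K[x]\<close>. As \<open>Lv|Kv\<close>
  is purely inseparable, every automorphism \<open>\<sigma>\<close> preserves \<open>\<O>\<^sub>L\<close> and acts trivially on \<open>Lv\<close>.
  If \<open>\<sigma> \<noteq> id\<close>, additive Hilbert 90 gives \<open>\<theta>\<close> with \<open>\<sigma> \<theta> = \<theta> + 1\<close>. Subtracting from \<open>\<theta>\<close> its
  coefficient at \<open>1\<close> in the basis yields \<open>v \<theta> < 0\<close> and \<open>c \<in> K\<close> such that \<open>\<eta> = c \<theta>\<close> is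
  integral with \<open>\<eta>v \<notin> Kv\<close>, so \<open>\<O>\<^sub>L = \<O>\<^sub>K[\<eta>]\<close>. The minimal polynomial
  \<open>X\<^sup>p - c\<^sup>p\<^sup>-\<^sup>1 X - c\<^sup>p (\<theta>\<^sup>p - \<theta>)\<close> of \<open>\<eta>\<close> has derivative \<open>-c\<^sup>p\<^sup>-\<^sup>1\<close>, which gives the
  differentials, while \<open>(\<sigma> \<theta> - \<theta>)/\<theta> = 1/\<theta>\<close> has the value of \<open>c\<close> and generates the
  ramification ideal.
\<close>

section \<open>Sums and powers in rings\<close>

text \<open>Trivial action on residues is used twice. It excludes an integral \<theta>, since the
  difference 1 of \<sigma> \<theta> and \<theta> would lie in the maximal ideal. It also supplies
  the divisibility behind Hilbert 90: the element 1 has trace 0 only if p divides the order m of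
  \<sigma>, and instead of counting automorphisms the proof derives p | m from that action. A
  nonzero trace comes from the power sums of the conjugates of x. Dropping the coefficient at 1
  subtracts an element of K, so \<sigma> \<theta> = \<theta> + 1 survives; it forces a coefficient
  of least value to sit at some x^j with j > 0. Scaling that coefficient to 1 by c puts the residue
  of c \<theta> outside Kv. The exponent p - 1 bounds the relations from both sides: the equation of
  \<eta> kills c^(p-1) d\<eta>, and the formal derivative in the basis of powers of \<eta> obeys the
  Leibniz rule modulo c^(p-1), so nothing smaller is killed. Multiplication by c then identifies
  O_L/(c^(p-1)) with (c)/(c^p). The quotient is nonzero because v(c) = -v(\<theta>) > 0.\<close>

lemma (in ring) add_pow_one_mult:
  "[(m * n :: nat)] \<cdot> \<one> = [m] \<cdot> \<one> \<otimes> [n] \<cdot> \<one>"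
proof -
  have "[m] \<cdot> \<one> \<otimes> [n] \<cdot> \<one> = [m] \<cdot> (\<one> \<otimes> [n] \<cdot> \<one>)"
    by (rule add_pow_ldistr) auto
  also have "\<dots> = [(n * m)] \<cdot> \<one>"
    using add.nat_pow_pow[of \<one> m n] by (simp add: mult.commute)
  finally show ?thesis by (simp add: mult.commute)
qed

lemma (in ring) add_pow_eq_zero_of_dvd:
  assumes "[(p::nat)] \<cdot> \<one> = \<zero>" "p dvd n" "x \<in> carrier R"
  shows "[n] \<cdot> x = \<zero>"
proof -
  obtain k where "n = k * p" using assms(2) by (metis dvdE mult.commute)
  then have "[n] \<cdot> \<one> = \<zero>" using add_pow_one_mult[of k p] assms(1) by simp
  then show ?thesis using add_pow_ldistr[of \<one> x n] assms(3) by simp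
qed

lemma (in domain) ring_char_prime:
  assumes "p = ring_char R" "p > 0"
  shows "Factorial_Ring.prime p" and "[p] \<cdot> \<one> = \<zero>"
proof -
  have ex: "\<exists>n::nat>0. [n] \<cdot> \<one> = \<zero>"
    using assms by (auto simp: ring_char_def split: if_splits)
  have p: "p = (LEAST n::nat. n > 0 \<and> [n] \<cdot> \<one> = \<zero>)"
    using assms(1) ex by (simp add: ring_char_def)
  show p0: "[p] \<cdot> \<one> = \<zero>"
    using LeastI_ex[OF ex] p by blast
  have least: "[n] \<cdot> \<one> \<noteq> \<zero>" if "n > 0" "n < p" for n :: nat
    using not_less_Least[of n] that p by blast
  have "p \<noteq> 1" using p0 by auto
  then have p1: "1 < p" using assms(2) by linarith
  show "Factorial_Ring.prime p"
  proof (rule ccontr)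
    assume "\<not> Factorial_Ring.prime p"
    then obtain m where m: "m dvd p" "m \<noteq> 1" "m \<noteq> p"
      using p1 by (auto simp: prime_nat_iff)
    obtain n where n: "p = m * n" using m(1) by blast
    have "0 < m" "0 < n" using n assms(2) by (auto intro: gr0I)
    moreover have "m < p" using m p1 by (simp add: dvd_imp_le le_neq_trans)
    moreover have "n < p" using n \<open>0 < m\<close> m(2) \<open>0 < n\<close> by (cases m) auto
    ultimately have "[m] \<cdot> \<one> \<noteq> \<zero>" "[n] \<cdot> \<one> \<noteq> \<zero>" using least by auto
    moreover have "[m] \<cdot> \<one> \<otimes> [n] \<cdot> \<one> = \<zero>"
      using p0 n add_pow_one_mult by simp
    ultimately show False using integral by auto
  qed
qed

lemma (in ring) ring_char_subring:
  assumes "subring K R"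
  shows "ring_char (R\<lparr>carrier := K\<rparr>) = ring_char R"
proof -
  have "[(n::nat)] \<cdot>\<^bsub>R\<lparr>carrier := K\<rparr>\<^esub> \<one> = [n] \<cdot> \<one>" for n
    by (simp add: add_pow_def nat_pow_def)
  moreover have "\<one>\<^bsub>R\<lparr>carrier := K\<rparr>\<^esub> = \<one>" "\<zero>\<^bsub>R\<lparr>carrier := K\<rparr>\<^esub> = \<zero>" by simp_all
  ultimately show ?thesis unfolding ring_char_def by presburger
qed

lemma (in cring) binomial:
  assumes [simp]: "x \<in> carrier R" "y \<in> carrier R"
  shows "(x \<oplus> y) [^] (n::nat) = (\<Oplus>k\<in>{..n}. [(n choose k)] \<cdot> (x [^] k \<otimes> y [^] (n - k)))"
proof (induction n)
  case (Suc n)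
  let ?f = "\<lambda>n k. [(n choose k)] \<cdot> (x [^] k \<otimes> y [^] (n - k))"
  let ?g = "\<lambda>m k. [m] \<cdot> (x [^] Suc k \<otimes> y [^] (n - k))"
  have "(x \<oplus> y) [^] Suc n = (\<Oplus>k\<in>{..n}. ?f n k) \<otimes> x \<oplus> (\<Oplus>k\<in>{..n}. ?f n k) \<otimes> y"
    using Suc by (simp add: r_distr)
  also have "(\<Oplus>k\<in>{..n}. ?f n k) \<otimes> x = (\<Oplus>k\<in>{..n}. ?g (n choose k) k)"
  proof (subst finsum_ldistr)
    have "?f n k \<otimes> x = ?g (n choose k) k" for k
    proof -
      have "?f n k \<otimes> x = [(n choose k)] \<cdot> ((x [^] k \<otimes> y [^] (n - k)) \<otimes> x)"
        by (rule add_pow_ldistr) auto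
      also have "(x [^] k \<otimes> y [^] (n - k)) \<otimes> x = x [^] Suc k \<otimes> y [^] (n - k)"
        by (simp add: m_ac)
      finally show ?thesis .
    qed
    then show "(\<Oplus>k\<in>{..n}. ?f n k \<otimes> x) = (\<Oplus>k\<in>{..n}. ?g (n choose k) k)" by simp
  qed auto
  also have "(\<Oplus>k\<in>{..n}. ?f n k) \<otimes> y = (\<Oplus>k\<in>{..n}. ?g (n choose Suc k) k) \<oplus> y [^] Suc n"
  proof -
    have *: "?f n k \<otimes> y = [(n choose k)] \<cdot> (x [^] k \<otimes> y [^] (Suc n - k))" if "k \<le> n" for k
    proof -
      have "?f n k \<otimes> y = [(n choose k)] \<cdot> ((x [^] k \<otimes> y [^] (n - k)) \<otimes> y)"
        by (rule add_pow_ldistr) auto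
      also have "(x [^] k \<otimes> y [^] (n - k)) \<otimes> y = x [^] k \<otimes> y [^] (Suc n - k)"
        using that by (simp add: m_ac Suc_diff_le)
      finally show ?thesis .
    qed
    have "(\<Oplus>k\<in>{..n}. ?f n k) \<otimes> y = (\<Oplus>k\<in>{..n}. ?f n k \<otimes> y)"
      by (rule finsum_ldistr) auto
    also have "\<dots> = (\<Oplus>k\<in>{..n}. [(n choose k)] \<cdot> (x [^] k \<otimes> y [^] (Suc n - k)))"
      by (rule finsum_cong') (auto simp: *)
    \<comment> \<open>The added term vanishes because \<open>n choose Suc n\<close> is 0; it makes
      the index shift below produce the range \<open>{..n}\<close>.\<close>
    also have "\<dots> = (\<Oplus>k\<in>{..Suc n}. [(n choose k)] \<cdot> (x [^] k \<otimes> y [^] (Suc n - k)))"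
      by (subst finsum_Suc) (auto simp: binomial_eq_0)
    also have "\<dots> = (\<Oplus>k\<in>{..n}. ?g (n choose Suc k) k) \<oplus> y [^] Suc n"
      by (subst finsum_Suc2) auto
    finally show ?thesis .
  qed
  also have "(\<Oplus>k\<in>{..n}. ?g (n choose k) k) \<oplus>
      ((\<Oplus>k\<in>{..n}. ?g (n choose Suc k) k) \<oplus> y [^] Suc n) =
      (\<Oplus>k\<in>{..n}. ?g (n choose k) k \<oplus> ?g (n choose Suc k) k) \<oplus> y [^] Suc n"
    by (subst finsum_addf) (auto simp: a_assoc)
  also have "\<dots> = (\<Oplus>k\<in>{..n}. ?g (Suc n choose Suc k) k) \<oplus> y [^] Suc n"
    by (subst add.nat_pow_mult) auto
  also have "\<dots> = (\<Oplus>k\<in>{..Suc n}. ?f (Suc n) k)"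
    by (subst finsum_Suc2) auto
  finally show ?case .
qed auto

lemma (in cring) frobenius_add:
  fixes p :: nat
  assumes p: "Factorial_Ring.prime p" "[p] \<cdot> \<one> = \<zero>"
    and [simp]: "x \<in> carrier R" "y \<in> carrier R"
  shows "(x \<oplus> y) [^] p = x [^] p \<oplus> y [^] p"
proof -
  obtain q where q: "p = Suc q" using prime_gt_0_nat[OF p(1)] by (metis Suc_pred')
  let ?f = "\<lambda>k. [(p choose k)] \<cdot> (x [^] k \<otimes> y [^] (p - k))"
  have z: "?f k = \<zero>" if "k \<in> {Suc 0..q}" for k
  proof -
    have "p dvd (p choose k)"
      using that q p(1) by (intro dvd_choose_prime) auto
    then show ?thesis by (intro add_pow_eq_zero_of_dvd[OF p(2)]) auto
  qed
  have "(x \<oplus> y) [^] p = (\<Oplus>k\<in>{..p}. ?f k)" by (simp add: binomial)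
  also have "\<dots> = ?f p \<oplus> (\<Oplus>k\<in>{..q}. ?f k)"
    unfolding q by (subst finsum_Suc) auto
  also have "(\<Oplus>k\<in>{..q}. ?f k) = ?f 0 \<oplus> (\<Oplus>k\<in>{Suc 0..q}. ?f k)"
    by (subst add.finprod_0') auto
  also have "(\<Oplus>k\<in>{Suc 0..q}. ?f k) = (\<Oplus>k\<in>{Suc 0..q}. \<zero>)"
    by (rule finsum_cong') (use z in auto)
  finally show ?thesis by simp
qed

text \<open>Applying additivity to \<open>(x \<ominus> y) \<oplus> y\<close> avoids the sign (-1)^p,
  which would call for a separate look at p = 2.\<close>

lemma (in cring) frobenius_diff:
  fixes p :: nat
  assumes p: "Factorial_Ring.prime p" "[p] \<cdot> \<one> = \<zero>"
    and [simp]: "x \<in> carrier R" "y \<in> carrier R"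
  shows "(x \<ominus> y) [^] p = x [^] p \<ominus> y [^] p"
proof -
  have "x = x \<ominus> y \<oplus> y"
    using assms(3,4) by algebra
  then have "x [^] p = (x \<ominus> y \<oplus> y) [^] p" by simp
  also have "\<dots> = (x \<ominus> y) [^] p \<oplus> y [^] p"
    by (intro frobenius_add p) auto
  finally have "x [^] p \<ominus> y [^] p = (x \<ominus> y) [^] p \<oplus> y [^] p \<ominus> y [^] p" by simp
  also have "\<dots> = (x \<ominus> y) [^] p"
  proof -
    have "a \<oplus> b \<ominus> b = a" if "a \<in> carrier R" "b \<in> carrier R" for a b
      using that by algebra
    then show ?thesis by simp
  qed
  finally show ?thesis by simp
qed

lemma (in ring) add_pow_one_eq_zero_imp_dvd:
  fixes p n :: nat
  assumes "Factorial_Ring.prime p" "[p] \<cdot> \<one> = \<zero>" "\<one> \<noteq> \<zero>" "[n] \<cdot> \<one> = \<zero>"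
  shows "p dvd n"
proof (rule ccontr)
  assume "\<not> p dvd n"
  then have "gcd n p = 1" using assms(1) using prime_imp_coprime[of p n] by (simp add: coprime_iff_gcd_eq_1 gcd.commute)
  moreover have "n \<noteq> 0" using \<open>\<not> p dvd n\<close> by (auto intro: gr0I)
  ultimately obtain a b where "n * a = p * b + 1" using bezout_nat[of n p] by metis
  then have "[(n * a)] \<cdot> \<one> = [(p * b)] \<cdot> \<one> \<oplus> [(1::nat)] \<cdot> \<one>"
    by (simp add: add.nat_pow_mult)
  then have "\<zero> = \<one>" using add_pow_one_mult[of n a] add_pow_one_mult[of p b] assms by simp
  then show False using assms(3) by simp
qed

text \<open>If all power sums vanished, so would the sum of f(y_i) over i for every polynomial f.
  The product of X - y_s over s > 0 keeps only the term i = 0, which is nonzero in a domain. Applied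
  to the conjugates of x, this provides an element of nonzero trace.\<close>

lemma (in domain) exists_power_sum_ne_zero:
  fixes y :: "nat \<Rightarrow> 'a"
  assumes y [simp]: "\<And>i. y i \<in> carrier R" and inj: "inj_on y {..<m}" and m: "0 < m"
  shows "\<exists>k::nat. (\<Oplus>i\<in>{..<m}. y i [^] k) \<noteq> \<zero>"
proof (rule ccontr)
  assume "\<not> ?thesis"
  then have z: "(\<Oplus>i\<in>{..<m}. y i [^] k) = \<zero>" for k :: nat by blast
  \<comment> \<open>\<open>q n i\<close> is the value at \<open>y i\<close> of the polynomial (X -
    y_1) ... (X - y_n).\<close>
  define q where "q n i = (\<Otimes>s\<in>{..<n}. y i \<ominus> y (Suc s))" for n i
  have q [simp]: "q n i \<in> carrier R" for n i unfolding q_def by (rule finprod_closed) auto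
  have q_Suc: "q (Suc n) i = (y i \<ominus> y (Suc n)) \<otimes> q n i" for n i
    unfolding q_def lessThan_Suc by (subst finprod_insert) auto
  \<comment> \<open>The exponent stays arbitrary because the factor \<open>y i\<close> of the
    induction step raises it by one.\<close>
  have vanish: "(\<Oplus>i\<in>{..<m}. y i [^] k \<otimes> q n i) = \<zero>" for n and k :: nat
  proof (induction n arbitrary: k)
    case 0
    then show ?case using z[of k] by (simp add: q_def)
  next
    case (Suc n)
    have "y i [^] k \<otimes> q (Suc n) i =
        y i [^] Suc k \<otimes> q n i \<oplus> \<ominus> y (Suc n) \<otimes> (y i [^] k \<otimes> q n i)" for i
    proof -
      have "a \<otimes> ((b \<ominus> c) \<otimes> d) = (a \<otimes> b) \<otimes> d \<oplus> \<ominus> c \<otimes> (a \<otimes> d)"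
        if "a \<in> carrier R" "b \<in> carrier R" "c \<in> carrier R" "d \<in> carrier R" for a b c d
        using that by algebra
      then show ?thesis by (simp add: q_Suc)
    qed
    then have "(\<Oplus>i\<in>{..<m}. y i [^] k \<otimes> q (Suc n) i) =
        (\<Oplus>i\<in>{..<m}. y i [^] Suc k \<otimes> q n i \<oplus> \<ominus> y (Suc n) \<otimes> (y i [^] k \<otimes> q n i))"
      by presburger
    also have "\<dots> = (\<Oplus>i\<in>{..<m}. y i [^] Suc k \<otimes> q n i) \<oplus>
        (\<Oplus>i\<in>{..<m}. \<ominus> y (Suc n) \<otimes> (y i [^] k \<otimes> q n i))"
      by (rule finsum_addf) auto
    also have "(\<Oplus>i\<in>{..<m}. \<ominus> y (Suc n) \<otimes> (y i [^] k \<otimes> q n i)) =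
        \<ominus> y (Suc n) \<otimes> (\<Oplus>i\<in>{..<m}. y i [^] k \<otimes> q n i)"
      by (rule finsum_rdistr[symmetric]) auto
    finally show ?case using Suc[of "Suc k"] Suc[of k] by simp
  qed
  obtain m' where m': "m = Suc m'" using m by (cases m) auto
  have "q m' i = \<zero>" if i: "i \<in> {Suc 0..m'}" for i
  proof -
    have "(\<Otimes>s\<in>{..<n}. y i \<ominus> y (Suc s)) = \<zero>" if "i \<le> n" for n
      using that
    proof (induction n)
      case (Suc n)
      have e: "(\<Otimes>s\<in>{..<Suc n}. y i \<ominus> y (Suc s)) = (y i \<ominus> y (Suc n)) \<otimes> (\<Otimes>s\<in>{..<n}. y i \<ominus> y (Suc s))"
        unfolding lessThan_Suc by (subst finprod_insert) auto
      have c: "(\<Otimes>s\<in>{..<n}. y i \<ominus> y (Suc s)) \<in> carrier R" by (rule finprod_closed) auto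
      show ?case
      proof (cases "i = Suc n")
        case True
        then have z: "y i \<ominus> y (Suc n) = \<zero>" by (simp add: a_minus_def r_neg)
        show ?thesis unfolding e z by (rule l_null[OF c])
      next
        case False
        then show ?thesis using e Suc by simp
      qed
    qed (use i in auto)
    then show ?thesis unfolding q_def using i by simp
  qed
  then have "(\<Oplus>i\<in>{Suc 0..m'}. q m' i) = (\<Oplus>i\<in>{Suc 0..m'}. \<zero>)"
    by (intro finsum_cong') auto
  then have rest: "(\<Oplus>i\<in>{Suc 0..m'}. q m' i) = \<zero>" by simp
  have "(\<Oplus>i\<in>{..m'}. q m' i) = q m' 0 \<oplus> (\<Oplus>i\<in>{Suc 0..m'}. q m' i)"
    by (rule add.finprod_0'[symmetric]) auto
  also have "\<dots> = q m' 0" unfolding rest by simp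
  finally have "q m' 0 = \<zero>"
    using vanish[of 0 m'] unfolding m' lessThan_Suc_atMost by simp
  moreover have "q n 0 \<noteq> \<zero>" if "n \<le> m'" for n
    using that
  proof (induction n)
    case (Suc n)
    have "y 0 \<noteq> y (Suc n)" using inj_onD[OF inj, of 0 "Suc n"] Suc(2) m' by auto
    then have "y 0 \<ominus> y (Suc n) \<noteq> \<zero>" by simp
    then show ?case using Suc integral[of "y 0 \<ominus> y (Suc n)" "q n 0"] by (auto simp: q_Suc)
  qed (simp add: q_def)
  ultimately show False by blast
qed

text \<open>Adding the common end value \<open>f 0 = f m\<close> turns both sides into the sum over
  \<open>{..m}\<close>. For the iterates of an automorphism of order m it says that the trace is
  fixed.\<close>

lemma (in abelian_monoid) finsum_cyclic_shift:
  fixes m :: nat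
  assumes f [simp]: "\<And>i. f i \<in> carrier G" and "f m = f 0" and cancel: "abelian_group G"
  shows "(\<Oplus>i\<in>{..<m}. f (Suc i)) = (\<Oplus>i\<in>{..<m}. f i)"
proof (cases m)
  case (Suc n)
  interpret abelian_group G by (rule cancel)
  have "(\<Oplus>i\<in>{..<m}. f (Suc i)) \<oplus> f 0 = (\<Oplus>i\<in>{..Suc n}. f i)"
    unfolding Suc lessThan_Suc_atMost by (subst finsum_Suc2) auto
  also have "\<dots> = f 0 \<oplus> (\<Oplus>i\<in>{..<m}. f i)"
    using assms(2) unfolding Suc lessThan_Suc_atMost by (subst finsum_Suc) auto
  also have "\<dots> = (\<Oplus>i\<in>{..<m}. f i) \<oplus> f 0" by (intro a_comm) auto
  finally show ?thesis by (subst (asm) add.r_cancel) auto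
qed simp

text \<open>Summation by parts: both sides are the sum of (i+1) f(i+1) over i < n. It computes the
  image of the Hilbert 90 sum under the automorphism.\<close>

lemma (in abelian_group) finsum_weighted_shift:
  assumes f [simp]: "\<And>i. f i \<in> carrier G"
  shows "(\<Oplus>i\<in>{..<n::nat}. [i] \<cdot> f (Suc i)) \<oplus> (\<Oplus>i\<in>{..<n}. f (Suc i)) =
    (\<Oplus>i\<in>{..<n}. [i] \<cdot> f i) \<oplus> [n] \<cdot> f n"
proof (induction n)
  case (Suc n)
  let ?A = "\<Oplus>i\<in>{..<n}. [i] \<cdot> f (Suc i)" and ?B = "\<Oplus>i\<in>{..<n}. f (Suc i)"
    and ?C = "\<Oplus>i\<in>{..<n}. [i] \<cdot> f i"
  have c: "?A \<in> carrier G" "?B \<in> carrier G" "?C \<in> carrier G"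
    by (auto intro!: finsum_closed)
  have s: "(\<Oplus>i\<in>{..<Suc n}. [i] \<cdot> f (Suc i)) = [n] \<cdot> f (Suc n) \<oplus> ?A"
    "(\<Oplus>i\<in>{..<Suc n}. f (Suc i)) = f (Suc n) \<oplus> ?B"
    "(\<Oplus>i\<in>{..<Suc n}. [i] \<cdot> f i) = [n] \<cdot> f n \<oplus> ?C"
    unfolding lessThan_Suc by (subst finsum_insert; auto)+
  have "([n] \<cdot> f (Suc n) \<oplus> ?A) \<oplus> (f (Suc n) \<oplus> ?B) =
      (?A \<oplus> ?B) \<oplus> ([n] \<cdot> f (Suc n) \<oplus> f (Suc n))"
    using c by (simp add: a_ac)
  also have "\<dots> = (?C \<oplus> [n] \<cdot> f n) \<oplus> [Suc n] \<cdot> f (Suc n)" using Suc by simp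
  also have "\<dots> = ([n] \<cdot> f n \<oplus> ?C) \<oplus> [Suc n] \<cdot> f (Suc n)" using c by (simp add: a_ac)
  finally show ?case unfolding s .
qed simp

section \<open>Extensions of prime degree\<close>

text \<open>\<open>exp_base\<close> lists the powers in descending order, hence the
  \<open>rev\<close>. Later arguments use the indexed sum instead of coefficient lists.\<close>

lemma (in ring) combine_exp_base:
  assumes "x \<in> carrier R" "\<And>i. i < n \<Longrightarrow> a i \<in> carrier R"
  shows "combine (map a (rev [0..<n])) (exp_base x n) = (\<Oplus>i\<in>{..<n}. a i \<otimes> x [^] i)"
  using assms(2)
proof (induction n)
  case (Suc n)
  then have "combine (map a (rev [0..<n])) (exp_base x n) = (\<Oplus>i\<in>{..<n}. a i \<otimes> x [^] i)"
    by auto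
  then show ?case
    using Suc.prems assms(1)
    by (simp add: exp_base_def lessThan_Suc Pi_def)
qed (simp add: exp_base_def)

lemma (in field) finite_dimension_over_larger:
  assumes "subfield K R" "subfield F R" "K \<subseteq> F" "finite_dimension K (carrier R)"
  shows "finite_dimension F (carrier R)"
proof -
  obtain n where "dimension n K (carrier R)" using assms(4) by auto
  then obtain Vs where Vs: "set Vs \<subseteq> carrier R" "Span K Vs = carrier R"
    using exists_base[OF assms(1)] by blast
  have "Span K Vs \<subseteq> Span F Vs"
    using Span_eq_combine_set[OF assms(1) Vs(1)] Span_eq_combine_set[OF assms(2) Vs(1)] assms(3)
    by blast
  moreover have "Span F Vs \<subseteq> carrier R"
    using Span_in_carrier subfieldE(3)[OF assms(2)] Vs(1) by blast
  ultimately have "Span F Vs = carrier R" using Vs(2) by blast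
  then show ?thesis using Span_finite_dimension[OF assms(2) Vs(1)] by simp
qed

lemma (in ring) normalize_eq_Nil:
  assumes "normalize l = []"
  shows "set l \<subseteq> {\<zero>}"
  using coeff_img_restrict[of l] normalize_coeff[of l] assms by auto

text \<open>Instantiated twice, for L|K and for the residue extension Lv|Kv, which have the same
  prime degree.\<close>

locale prime_degree_extension = field +
  fixes K and p :: nat
  assumes K: "subfield K R" and dim: "dimension p K (carrier R)" and prime_p: "Factorial_Ring.prime p"
begin

lemma K_subset: "K \<subseteq> carrier R"
  using subfieldE(3)[OF K] .

lemma K_subring: "subring K R"
  using subfieldE(1)[OF K] .

lemmas K_closed [simp] = subsetD[OF K_subset]
lemmas K_simps [simp] = subringE(2,3)[OF K_subring]
lemmas K_intros [simp] = subringE(5-7)[OF K_subring]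

lemma K_inv: "a \<in> K \<Longrightarrow> a \<noteq> \<zero> \<Longrightarrow> inv a \<in> K"
  using subfield_m_inv(1)[OF K] by blast

lemma K_diff [simp]: "a \<in> K \<Longrightarrow> b \<in> K \<Longrightarrow> a \<ominus> b \<in> K"
  by (simp add: a_minus_def)

lemma K_pow: "a \<in> K \<Longrightarrow> a [^] (n::nat) \<in> K"
  by (induction n) auto

lemma K_add_pow: "a \<in> K \<Longrightarrow> [(n::nat)] \<cdot> a \<in> K"
  by (induction n) auto

lemma algebraic: "x \<in> carrier R \<Longrightarrow> \<not> transcendental K x"
  using finite_dimension_imp_algebraic[OF K carrier_is_subring finite_dimensionI[OF dim]]
  by (simp add: over_def)

lemma mem_of_dimension_one:
  assumes "x \<in> carrier R" "dimension 1 K (simple_extension K x)"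
  shows "x \<in> K"
proof -
  have ind: "independent K [\<one>]"
    by (rule independent.intros) auto
  have Span: "Span K [\<one>] = K"
    by (auto simp: line_extension_mem_iff)
  have "K \<subseteq> simple_extension K x"
    using simple_extension_incl[OF K_subset assms(1)] .
  then have "set [\<one>] \<subseteq> simple_extension K x" using subringE(3)[OF K_subring] by force
  from independent_length_eq_dimension[OF K assms(2) ind this]
  have "simple_extension K x = K" unfolding Span by simp
  then show ?thesis using simple_extension_mem[OF K_subring assms(1)] by simp
qed

text \<open>The tower law makes the degree a divisor of the prime p, and degree 1 would put x into
  K.\<close>

lemma degree_Irr:
  assumes "x \<in> carrier R" "x \<notin> K"
  shows "degree (Irr K x) = p"
proof -
  have alg: "(algebraic over K) x" using algebraic[OF assms(1)] by (simp add: over_def)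
  let ?F = "simple_extension K x"
  have F: "subfield ?F R" using simple_extension_is_subfield[OF K assms(1)] alg by simp
  have KF: "K \<subseteq> ?F" using simple_extension_incl[OF K_subset assms(1)] .
  have d: "dimension (degree (Irr K x)) K ?F"
    using dimension_simple_extension[OF K assms(1) alg] .
  obtain m where m: "dimension m ?F (carrier R)"
    using finite_dimension_over_larger[OF K F KF finite_dimensionI[OF dim]] by auto
  have "p = degree (Irr K x) * m"
    using dimension_is_inj[OF K dim telescopic_base[OF K F d m]] .
  then have "degree (Irr K x) = 1 \<or> degree (Irr K x) = p"
    using prime_p unfolding prime_nat_iff by (metis dvd_triv_left)
  moreover have "degree (Irr K x) \<noteq> 1"
  proof
    assume "degree (Irr K x) = 1"
    then have "dimension 1 K ?F" using d by simp
    then show False using mem_of_dimension_one[OF assms(1)] assms(2) by blast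
  qed
  ultimately show ?thesis by blast
qed

lemma exp_base:
  assumes "x \<in> carrier R" "x \<notin> K"
  shows "independent K (exp_base x p)" and "Span K (exp_base x p) = carrier R"
proof -
  show 1: "independent K (exp_base x p)"
    using exp_base_independent[OF K assms(1)] algebraic[OF assms(1)] degree_Irr[OF assms]
    by (simp add: over_def)
  show "Span K (exp_base x p) = carrier R"
    using independent_length_eq_dimension[OF K dim 1] exp_base_closed[OF assms(1)]
    by (simp add: exp_base_def)
qed

lemma power_basis_ex:
  assumes "x \<in> carrier R" "x \<notin> K" "b \<in> carrier R"
  shows "\<exists>a. (\<forall>i. a i \<in> K) \<and> b = (\<Oplus>i\<in>{..<p}. a i \<otimes> x [^] i)"
proof -
  have "b \<in> Span K (exp_base x p)" using exp_base(2)[OF assms(1,2)] assms(3) by simp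
  then obtain Ks where Ks: "set Ks \<subseteq> K" "length Ks = length (exp_base x p)"
      "b = combine Ks (exp_base x p)"
    unfolding Span_mem_iff_length_version[OF K exp_base_closed[OF assms(1), of p]] by blast
  then have len: "length Ks = p" by (simp add: exp_base_def)
  have c: "coeff Ks i \<in> K" for i
  proof -
    have "coeff Ks i \<in> set Ks \<union> {\<zero>}" using coeff_img(3)[of Ks] by (metis rangeI)
    then show ?thesis using Ks(1) subringE(2)[OF K_subring] by auto
  qed
  have "b = combine (map (coeff Ks) (rev [0..<p])) (exp_base x p)"
    unfolding len[symmetric] coeff_list by (simp add: Ks(3) len)
  also have "\<dots> = (\<Oplus>i\<in>{..<p}. coeff Ks i \<otimes> x [^] i)"
    by (rule combine_exp_base[OF assms(1)]) (use c in auto)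
  finally show ?thesis using c by blast
qed

lemma power_basis_unique:
  assumes "x \<in> carrier R" "x \<notin> K" "\<And>i. i < p \<Longrightarrow> a i \<in> K"
    "(\<Oplus>i\<in>{..<p}. a i \<otimes> x [^] i) = \<zero>" "i < p"
  shows "a i = \<zero>"
proof -
  let ?Ks = "map a (rev [0..<p])"
  have "set (take (length (exp_base x p)) ?Ks) \<subseteq> {\<zero>}"
    using assms combine_exp_base[of x p a]
    by (intro independent_imp_trivial_combine[OF K exp_base(1)]) auto
  then have "a ` {0..<p} \<subseteq> {\<zero>}" by (simp add: exp_base_def)
  then show ?thesis using assms(5) by force
qed

text \<open>Any element of F outside K has powers that span the whole field over K, and these powers
  lie in F.\<close>

lemma no_intermediate_field:
  assumes "subfield F R" "K \<subseteq> F" "F \<noteq> K"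
  shows "F = carrier R"
proof -
  obtain x where x: "x \<in> F" "x \<notin> K" using assms by blast
  have F: "F \<subseteq> carrier R" using subfieldE(3)[OF assms(1)] .
  note FR = subringE[OF subfieldE(1)[OF assms(1)]]
  have pow: "x [^] (i::nat) \<in> F" for i
    by (induction i) (simp_all add: FR(3) FR(6)[OF _ x(1)])
  have "b \<in> F" if b: "b \<in> carrier R" for b
  proof -
    obtain a where a: "\<forall>i. a i \<in> K" "b = (\<Oplus>i\<in>{..<p}. a i \<otimes> x [^] i)"
      using power_basis_ex[OF subsetD[OF F x(1)] x(2) b] by blast
    have "(\<Oplus>i\<in>{..<n}. a i \<otimes> x [^] i) \<in> F" for n
    proof (induction n)
      case (Suc n)
      have 1: "a i \<otimes> x [^] i \<in> F" for i
        using FR(6)[OF _ pow] a(1) assms(2) by blast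
      then have "a i \<otimes> x [^] i \<in> carrier R" for i using F by blast
      then have "(\<Oplus>i\<in>{..<Suc n}. a i \<otimes> x [^] i) = a n \<otimes> x [^] n \<oplus> (\<Oplus>i\<in>{..<n}. a i \<otimes> x [^] i)"
        unfolding lessThan_Suc by (subst finsum_insert) auto
      then show ?case using FR(7)[OF 1 Suc] by simp
    qed (simp add: FR(2))
    then show ?thesis using a by simp
  qed
  then show ?thesis using F by blast
qed

text \<open>This is how the formal derivative will be obtained: by prescribing its values on a power
  basis. Coordinates with index p or larger are arbitrary choices, so all comparisons below are
  restricted to i < p.\<close>

lemma linear_map_ex:
  assumes x: "x \<in> carrier R" "x \<notin> K" and w: "\<And>i. w i \<in> carrier R"
  shows "\<exists>D. (\<forall>b\<in>carrier R. D b \<in> carrier R) \<and>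
    (\<forall>b\<in>carrier R. \<forall>c\<in>carrier R. D (b \<oplus> c) = D b \<oplus> D c) \<and>
    (\<forall>a\<in>K. \<forall>b\<in>carrier R. D (a \<otimes> b) = a \<otimes> D b) \<and> (\<forall>i<p. D (x [^] i) = w i)"
proof -
  define coord where
    "coord b = (SOME a. (\<forall>i. a i \<in> K) \<and> b = (\<Oplus>i\<in>{..<p}. a i \<otimes> x [^] i))" for b
  have coord: "\<forall>i. coord b i \<in> K" "b = (\<Oplus>i\<in>{..<p}. coord b i \<otimes> x [^] i)"
    if "b \<in> carrier R" for b
    using someI_ex[OF power_basis_ex[OF x that]] unfolding coord_def by blast+
  have unique: "coord b i = a i"
    if b: "b \<in> carrier R" and a: "\<And>i. i < p \<Longrightarrow> a i \<in> K" "b = (\<Oplus>i\<in>{..<p}. a i \<otimes> x [^] i)"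
      and i: "i < p" for b a i
  proof -
    have cK: "coord b i \<in> K" for i using coord(1)[OF b] by blast
    \<comment> \<open>The sum with the difference coefficients, added to b, gives b again;
      cancelling b leaves a relation between the powers of x.\<close>
    have "(\<Oplus>i\<in>{..<p}. (coord b i \<ominus> a i) \<otimes> x [^] i) \<oplus> (\<Oplus>i\<in>{..<p}. a i \<otimes> x [^] i) =
        (\<Oplus>i\<in>{..<p}. (coord b i \<ominus> a i) \<otimes> x [^] i \<oplus> a i \<otimes> x [^] i)"
      using cK a(1) x(1) by (intro finsum_addf[symmetric]) auto
    also have "\<dots> = (\<Oplus>i\<in>{..<p}. coord b i \<otimes> x [^] i)"
    proof (rule finsum_cong')
      fix i assume "i \<in> {..<p}"
      then have c: "coord b i \<in> carrier R" "a i \<in> carrier R" "x [^] i \<in> carrier R"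
        using cK a(1) x(1) by simp_all
      then show "(coord b i \<ominus> a i) \<otimes> x [^] i \<oplus> a i \<otimes> x [^] i = coord b i \<otimes> x [^] i"
        by algebra
    qed (use cK x(1) in auto)
    also have "\<dots> = b" using coord(2)[OF b] by simp
    finally have eq: "(\<Oplus>i\<in>{..<p}. (coord b i \<ominus> a i) \<otimes> x [^] i) \<oplus> b = b"
      unfolding a(2)[symmetric] .
    have "(\<Oplus>i\<in>{..<p}. (coord b i \<ominus> a i) \<otimes> x [^] i) \<in> carrier R"
      using cK a(1) x(1) by (intro finsum_closed) auto
    then have "(\<Oplus>i\<in>{..<p}. (coord b i \<ominus> a i) \<otimes> x [^] i) = \<zero>"
      using eq b by simp
    then have "coord b i \<ominus> a i = \<zero>"
      using cK a(1) i by (intro power_basis_unique[OF x, where a = "\<lambda>i. coord b i \<ominus> a i"]) auto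
    then show ?thesis using cK a(1)[OF i] by simp
  qed
  define D where "D b = (\<Oplus>i\<in>{..<p}. coord b i \<otimes> w i)" for b
  have cK: "coord b i \<in> K" if "b \<in> carrier R" for b i using coord(1)[OF that] by blast
  have D_eq: "D b = (\<Oplus>i\<in>{..<p}. a i \<otimes> w i)"
    if b: "b \<in> carrier R" and a: "\<And>i. i < p \<Longrightarrow> a i \<in> K" "b = (\<Oplus>i\<in>{..<p}. a i \<otimes> x [^] i)" for b a
    unfolding D_def using unique[OF b a] a(1) w by (intro finsum_cong') auto
  have "D b \<in> carrier R" if "b \<in> carrier R" for b
    unfolding D_def using cK[OF that] w by (intro finsum_closed) auto
  moreover have "D (b \<oplus> c) = D b \<oplus> D c" if b: "b \<in> carrier R" and c: "c \<in> carrier R" for b c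
  proof -
    have "b \<oplus> c = (\<Oplus>i\<in>{..<p}. coord b i \<otimes> x [^] i) \<oplus> (\<Oplus>i\<in>{..<p}. coord c i \<otimes> x [^] i)"
      using coord(2)[OF b] coord(2)[OF c] by simp
    also have "\<dots> = (\<Oplus>i\<in>{..<p}. coord b i \<otimes> x [^] i \<oplus> coord c i \<otimes> x [^] i)"
      using cK[OF b] cK[OF c] x(1) by (intro finsum_addf[symmetric]) auto
    also have "\<dots> = (\<Oplus>i\<in>{..<p}. (coord b i \<oplus> coord c i) \<otimes> x [^] i)"
      using cK[OF b] cK[OF c] x(1) by (intro finsum_cong') (auto simp: l_distr)
    finally have "b \<oplus> c = (\<Oplus>i\<in>{..<p}. (coord b i \<oplus> coord c i) \<otimes> x [^] i)" .
    from D_eq[OF a_closed[OF b c] _ this]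
    have "D (b \<oplus> c) = (\<Oplus>i\<in>{..<p}. (coord b i \<oplus> coord c i) \<otimes> w i)"
      using cK[OF b] cK[OF c] by simp
    also have "\<dots> = (\<Oplus>i\<in>{..<p}. coord b i \<otimes> w i \<oplus> coord c i \<otimes> w i)"
      using cK[OF b] cK[OF c] w by (intro finsum_cong') (auto simp: l_distr)
    also have "\<dots> = D b \<oplus> D c"
      unfolding D_def using cK[OF b] cK[OF c] w by (intro finsum_addf) auto
    finally show ?thesis .
  qed
  moreover have "D (a \<otimes> b) = a \<otimes> D b" if a: "a \<in> K" and b: "b \<in> carrier R" for a b
  proof -
    have aR: "a \<in> carrier R" using a by simp
    have "a \<otimes> b = a \<otimes> (\<Oplus>i\<in>{..<p}. coord b i \<otimes> x [^] i)" using coord(2)[OF b] by simp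
    also have "\<dots> = (\<Oplus>i\<in>{..<p}. a \<otimes> (coord b i \<otimes> x [^] i))"
      using aR cK[OF b] x(1) by (intro finsum_rdistr) auto
    also have "\<dots> = (\<Oplus>i\<in>{..<p}. (a \<otimes> coord b i) \<otimes> x [^] i)"
      using aR cK[OF b] x(1) by (intro finsum_cong') (auto simp: m_assoc)
    finally have "a \<otimes> b = (\<Oplus>i\<in>{..<p}. (a \<otimes> coord b i) \<otimes> x [^] i)" .
    from D_eq[OF m_closed[OF aR b] _ this]
    have "D (a \<otimes> b) = (\<Oplus>i\<in>{..<p}. (a \<otimes> coord b i) \<otimes> w i)"
      using a cK[OF b] by simp
    also have "\<dots> = (\<Oplus>i\<in>{..<p}. a \<otimes> (coord b i \<otimes> w i))"
      using aR cK[OF b] w by (intro finsum_cong') (auto simp: m_assoc)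
    also have "\<dots> = a \<otimes> D b"
      unfolding D_def using aR cK[OF b] w by (intro finsum_rdistr[symmetric]) auto
    finally show ?thesis .
  qed
  moreover have "D (x [^] i) = w i" if i: "i < p" for i
  proof -
    let ?a = "\<lambda>j. if i = j then \<one> else \<zero>"
    have single: "(\<Oplus>j\<in>{..<p}. ?a j \<otimes> f j) = f i" if f: "\<And>j. f j \<in> carrier R" for f
    proof -
      have "(\<Oplus>j\<in>{..<p}. ?a j \<otimes> f j) = (\<Oplus>j\<in>{..<p}. if i = j then f j else \<zero>)"
        using f by (intro finsum_cong') auto
      also have "\<dots> = f i" by (rule finsum_singleton) (use i f in auto)
      finally show ?thesis .
    qed
    have "D (x [^] i) = (\<Oplus>j\<in>{..<p}. ?a j \<otimes> w j)"
      using x(1) single[of "\<lambda>j. x [^] j"] by (intro D_eq) auto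
    then show ?thesis using single[OF w] by simp
  qed
  ultimately show ?thesis by blast
qed

section \<open>Polynomial derivatives and inseparability\<close>

lemma coeff_closed:
  assumes "f \<in> carrier (K[X])"
  shows "coeff f i \<in> K"
proof -
  have "set f \<subseteq> K" using assms polynomial_incl unfolding univ_poly_carrier[symmetric] by blast
  moreover have "coeff f i \<in> set f \<union> {\<zero>}" using coeff_img(3)[of f] by (metis rangeI)
  ultimately show ?thesis using subringE(2)[OF K_subring] by auto
qed

lemma poly_deriv_closed:
  assumes "f \<in> carrier (K[X])"
  shows "poly_deriv R f \<in> carrier (K[X])"
proof -
  have "set (map (\<lambda>i. [i] \<cdot> coeff f i) (rev [1..<length f])) \<subseteq> K"
    using K_add_pow[OF coeff_closed[OF assms]] by auto
  then show ?thesis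
    unfolding poly_deriv_def univ_poly_carrier[symmetric] by (rule normalize_gives_polynomial)
qed

text \<open>The ideal (f) is maximal, so (f, f') is either (f) or everything. In the second case a
  Bezout relation makes f separable; in the first f divides f', which is impossible by degree unless
  f' = 0.\<close>

lemma not_separable_deriv:
  assumes f: "f \<in> carrier (K[X])" "pirreducible K f" and "\<not> separable_poly R K f"
  shows "poly_deriv R f = []"
proof (rule ccontr)
  let ?g = "poly_deriv R f"
  assume g0: "?g \<noteq> []"
  interpret UP: principal_domain "K[X]" using univ_poly_is_principal[OF K] .
  have g: "?g \<in> carrier (K[X])" using poly_deriv_closed[OF f(1)] .
  have f0: "f \<noteq> []" using pirreducibleE(1)[OF K_subring f] .
  have "length ?g \<le> length f - 1"
    unfolding poly_deriv_def by (rule order_trans[OF normalize_length_le]) simp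
  moreover have "0 < length ?g" using g0 by simp
  ultimately have deg: "degree ?g < degree f" by linarith
  let ?I = "PIdl\<^bsub>K[X]\<^esub> f" and ?J = "PIdl\<^bsub>K[X]\<^esub> ?g"
  have idI: "ideal ?I (K[X])" and idJ: "ideal ?J (K[X])"
    using UP.cgenideal_ideal f(1) g by auto
  have idS: "ideal (?I <+>\<^bsub>K[X]\<^esub> ?J) (K[X])" using UP.add_ideals[OF idI idJ] .
  have sub: "?I \<subseteq> ?I <+>\<^bsub>K[X]\<^esub> ?J"
  proof
    fix a assume a: "a \<in> ?I"
    have "a \<oplus>\<^bsub>K[X]\<^esub> \<zero>\<^bsub>K[X]\<^esub> \<in> ?I <+>\<^bsub>K[X]\<^esub> ?J"
      using a additive_subgroup.zero_closed[OF ideal.axioms(1)[OF idJ]] unfolding set_add_def' by blast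
    then show "a \<in> ?I <+>\<^bsub>K[X]\<^esub> ?J" using ideal.Icarr[OF idI a] by simp
  qed
  have gS: "?g \<in> ?I <+>\<^bsub>K[X]\<^esub> ?J"
  proof -
    have "\<zero>\<^bsub>K[X]\<^esub> \<oplus>\<^bsub>K[X]\<^esub> ?g \<in> ?I <+>\<^bsub>K[X]\<^esub> ?J"
      using UP.cgenideal_self[OF g] additive_subgroup.zero_closed[OF ideal.axioms(1)[OF idI]]
      unfolding set_add_def' by blast
    then show ?thesis using g by simp
  qed
  have "maximalideal ?I (K[X])"
    using UP.irreducible_imp_maximalideal[OF f] .
  then consider "?I <+>\<^bsub>K[X]\<^esub> ?J = ?I" | "?I <+>\<^bsub>K[X]\<^esub> ?J = carrier (K[X])"
    using maximalideal.I_maximal[OF _ idS sub] additive_subgroup.a_subset[OF ideal.axioms(1)[OF idS]]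
    by blast
  then show False
  proof cases
    case 1
    then have "?g \<in> ?I" using gS by simp
    then obtain q where q: "q \<in> carrier (K[X])" "?g = q \<otimes>\<^bsub>K[X]\<^esub> f"
      unfolding cgenideal_def by blast
    have "?g = f \<otimes>\<^bsub>K[X]\<^esub> q" unfolding q(2) by (rule UP.m_comm[OF q(1) f(1)])
    then have "f divides\<^bsub>K[X]\<^esub> ?g"
      by (rule dividesI[OF q(1)])
    then have "f pdivides ?g" using pdivides_iff_shell[OF K f(1) g] by simp
    then have "degree f \<le> degree ?g"
      using pdivides_imp_degree_le[OF K_subring f(1) g g0] by simp
    then show False using deg by simp
  next
    case 2
    then have "\<one>\<^bsub>K[X]\<^esub> \<in> ?I <+>\<^bsub>K[X]\<^esub> ?J" by simp
    then obtain a b where "a \<in> ?I" "b \<in> ?J" "\<one>\<^bsub>K[X]\<^esub> = a \<oplus>\<^bsub>K[X]\<^esub> b"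
      unfolding set_add_def' by blast
    moreover from this obtain a' b' where "a' \<in> carrier (K[X])" "a = a' \<otimes>\<^bsub>K[X]\<^esub> f"
        "b' \<in> carrier (K[X])" "b = b' \<otimes>\<^bsub>K[X]\<^esub> ?g"
      unfolding cgenideal_def by blast
    ultimately have "separable_poly R K f"
      unfolding separable_poly_def by metis
    then show False using assms(3) by simp
  qed
qed

text \<open>A zero derivative kills every coefficient whose exponent is prime to the characteristic
  p. The degree is positive, divisible by p and at most p, so the minimal polynomial has the form
  X^p + a_0.\<close>

lemma inseparable_ex:
  assumes insep: "inseparable_extension R K" and p0: "[p] \<cdot> \<one> = \<zero>"
  shows "\<exists>\<xi>\<in>carrier R - K. \<xi> [^] p \<in> K"
proof -
  obtain x where x: "x \<in> carrier R" "\<not> separable_poly R K (Irr K x)"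
    using insep algebraic unfolding inseparable_extension_def separable_extension_def by blast
  let ?f = "Irr K x"
  have alg: "(algebraic over K) x" using algebraic[OF x(1)] by (simp add: over_def)
  note f = IrrE[OF K x(1) alg]
  have f0: "?f \<noteq> []" using pirreducibleE(1)[OF K_subring f(1,2)] .
  define n where "n = degree ?f"
  have len: "length ?f = Suc n" using f0 unfolding n_def by (cases ?f) auto
  have n1: "n \<ge> 1" unfolding n_def using pirreducible_degree[OF K f(1,2)] .
  note cK = coeff_closed[OF f(1)]
  have "normalize (map (\<lambda>i. [i] \<cdot> coeff ?f i) (rev [1..<length ?f])) = []"
    using not_separable_deriv[OF f(1,2) x(2)] unfolding poly_deriv_def .
  from normalize_eq_Nil[OF this]
  have z: "[i] \<cdot> coeff ?f i = \<zero>" if "1 \<le> i" "i \<le> n" for i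
    using that len by (auto simp: image_subset_iff)
  have lc: "coeff ?f n = \<one>" using f(3) lead_coeff_simp[OF f0] unfolding n_def by simp
  have "p dvd n"
    using z[of n] n1 lc by (intro add_pow_one_eq_zero_imp_dvd[OF prime_p p0]) auto
  then have "p \<le> n" using n1 by (simp add: dvd_imp_le)
  \<comment> \<open>\<open>degree_Irr\<close> cannot be used here: that x lies outside K is only
    read off from the degree at the end.\<close>
  moreover have "n \<le> p"
    using independent_length_le_dimension[OF K dim exp_base_independent[OF K x(1) alg]]
      exp_base_closed[OF x(1)] unfolding n_def by (simp add: exp_base_def)
  ultimately have np: "n = p" by simp
  have c0: "coeff ?f i = \<zero>" if i: "0 < i" "i < p" for i
  proof -
    have "[i] \<cdot> \<one> \<otimes> coeff ?f i = [i] \<cdot> (\<one> \<otimes> coeff ?f i)"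
      by (rule add_pow_ldistr) (use cK in auto)
    also have "\<dots> = \<zero>" using z[of i] i np cK by simp
    finally have "[i] \<cdot> \<one> = \<zero> \<or> coeff ?f i = \<zero>"
      using integral[of "[i] \<cdot> \<one>" "coeff ?f i"] cK by simp
    moreover have "[i] \<cdot> \<one> \<noteq> \<zero>"
      using add_pow_one_eq_zero_imp_dvd[OF prime_p p0, of i] nat_dvd_not_less[OF i] by auto
    ultimately show ?thesis by simp
  qed
  have p2: "p \<ge> 2" using prime_p by (rule prime_ge_2_nat)
  obtain q where q: "p = Suc q" using p2 by (metis Suc_le_D numeral_2_eq_2)
  let ?t = "\<lambda>i. coeff ?f i \<otimes> x [^] i"
  have tc: "?t i \<in> carrier R" for i using cK x(1) by simp
  have "\<zero> = combine ?f (exp_base x (length ?f))" using f(4) by (simp add: combine_eq_eval)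
  also have "\<dots> = combine (map (coeff ?f) (rev [0..<Suc p])) (exp_base x (Suc p))"
    using coeff_list[of ?f] len np by simp
  also have "\<dots> = (\<Oplus>i\<in>{..<Suc p}. ?t i)"
    by (rule combine_exp_base[OF x(1)]) (use cK in auto)
  also have "\<dots> = ?t p \<oplus> (\<Oplus>i\<in>{..<p}. ?t i)"
    unfolding lessThan_Suc by (subst finsum_insert) (use tc in auto)
  also have "(\<Oplus>i\<in>{..<p}. ?t i) = (\<Oplus>i\<in>{..q}. ?t i)"
    unfolding q lessThan_Suc_atMost ..
  also have "\<dots> = ?t 0 \<oplus> (\<Oplus>i\<in>{Suc 0..q}. ?t i)"
    by (subst add.finprod_0') (use tc in auto)
  also have "(\<Oplus>i\<in>{Suc 0..q}. ?t i) = (\<Oplus>i\<in>{Suc 0..q}. \<zero>)"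
    by (rule finsum_cong') (use c0 q x(1) in auto)
  finally have "\<zero> = x [^] p \<oplus> coeff ?f 0" using lc np cK x(1) by simp
  then have "x [^] p = \<ominus> coeff ?f 0"
    using minus_equality[of "x [^] p" "coeff ?f 0"] cK x(1) by (metis K_closed minus_minus nat_pow_closed)
  then have "x [^] p \<in> K" using cK K_intros(1) by simp
  moreover have "x \<notin> K"
  proof
    assume xK: "x \<in> K"
    have 1: "[\<one>, \<ominus> x] \<in> carrier (K[X])"
      unfolding univ_poly_carrier[symmetric] polynomial_def using xK K_intros(1) by simp
    have "eval [\<one>, \<ominus> x] x = \<zero>" using x(1) by (simp add: r_neg)
    then have "?f pdivides [\<one>, \<ominus> x]" using Irr_minimal[OF K x(1) alg 1] by simp
    then have "degree ?f \<le> degree [\<one>, \<ominus> x]"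
      by (rule pdivides_imp_degree_le[OF K_subring f(1) 1, rotated]) simp
    then show False using np n_def p2 by simp
  qed
  ultimately show ?thesis using x(1) by blast
qed

end

section \<open>Quotient modules and free modules\<close>

lemma (in abelian_subgroup) coset_eq_iff:
  assumes "x \<in> carrier G" "y \<in> carrier G"
  shows "H +> x = H +> y \<longleftrightarrow> x \<ominus> y \<in> H"
proof
  assume "H +> x = H +> y"
  then have "x \<in> H +> y" using a_rcos_self[OF assms(1)] by simp
  then show "x \<ominus> y \<in> H" using a_rcos_module[OF assms(2,1)] by (simp add: a_minus_def)
next
  assume "x \<ominus> y \<in> H"
  then have "x \<in> H +> y" using a_rcos_module[OF assms(2,1)] by (simp add: a_minus_def)
  then show "H +> x = H +> y" using a_repr_independence'[OF _ assms(2)] by simp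
qed

context module
begin

lemma submodule_abelian_subgroup: "submodule N R M \<Longrightarrow> abelian_subgroup N M"
  by (rule abelian_subgroupI3[OF additive_subgroupI[OF submodule.axioms(1)] M.abelian_group_axioms])

lemma smult_diff:
  assumes "r \<in> carrier R" "x \<in> carrier M" "y \<in> carrier M"
  shows "r \<odot>\<^bsub>M\<^esub> (x \<ominus>\<^bsub>M\<^esub> y) = r \<odot>\<^bsub>M\<^esub> x \<ominus>\<^bsub>M\<^esub> r \<odot>\<^bsub>M\<^esub> y"
  using assms by (simp add: a_minus_def smult_r_distr smult_r_minus)

text \<open>The scalar action is defined as a union over a coset; the union collapses because all
  members of the coset lead to the same coset after scaling.\<close>

lemma quotient_smult:
  assumes N: "submodule N R M" and r: "r \<in> carrier R" and x: "x \<in> carrier M"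
  shows "r \<odot>\<^bsub>quotient_module M N\<^esub> (N +>\<^bsub>M\<^esub> x) = N +>\<^bsub>M\<^esub> (r \<odot>\<^bsub>M\<^esub> x)"
proof -
  interpret N: abelian_subgroup N M by (rule submodule_abelian_subgroup[OF N])
  have "N +>\<^bsub>M\<^esub> (r \<odot>\<^bsub>M\<^esub> y) = N +>\<^bsub>M\<^esub> (r \<odot>\<^bsub>M\<^esub> x)" if y: "y \<in> N +>\<^bsub>M\<^esub> x" for y
  proof -
    have yM: "y \<in> carrier M" using N.a_elemrcos_carrier[OF x y] .
    have "y \<ominus>\<^bsub>M\<^esub> x \<in> N" using N.a_rcos_module_imp[OF x y] by (simp add: a_minus_def)
    then have "r \<odot>\<^bsub>M\<^esub> y \<ominus>\<^bsub>M\<^esub> r \<odot>\<^bsub>M\<^esub> x \<in> N"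
      using submodule.smult_closed[OF N r] smult_diff[OF r yM x] by metis
    then show ?thesis using N.coset_eq_iff[of "r \<odot>\<^bsub>M\<^esub> y" "r \<odot>\<^bsub>M\<^esub> x"] r x yM by simp
  qed
  moreover have "x \<in> N +>\<^bsub>M\<^esub> x" by (rule N.a_rcos_self[OF x])
  ultimately have "(\<Union>y\<in>N +>\<^bsub>M\<^esub> x. N +>\<^bsub>M\<^esub> (r \<odot>\<^bsub>M\<^esub> y)) = N +>\<^bsub>M\<^esub> (r \<odot>\<^bsub>M\<^esub> x)" by blast
  then show ?thesis by (simp add: quotient_module_def)
qed

lemma quotient_carrier: "carrier (quotient_module M N) = (\<lambda>x. N +>\<^bsub>M\<^esub> x) ` carrier M"
  by (auto simp: quotient_module_def A_RCOSETS_def')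

lemma quotient_add:
  assumes N: "submodule N R M" and x: "x \<in> carrier M" and y: "y \<in> carrier M"
  shows "(N +>\<^bsub>M\<^esub> x) \<oplus>\<^bsub>quotient_module M N\<^esub> (N +>\<^bsub>M\<^esub> y) = N +>\<^bsub>M\<^esub> (x \<oplus>\<^bsub>M\<^esub> y)"
  using abelian_subgroup.a_rcos_sum[OF submodule_abelian_subgroup[OF N] x y]
  by (simp add: quotient_module_def)

end

text \<open>The induced map is a union over the coset, so no representative is chosen;
  \<open>ker\<close> makes it both well defined and injective. Surjectivity is required only modulo
  N', which suits a map that inverts another one merely modulo an ideal.\<close>

theorem quotient_module_isomorphicI:
  assumes M: "module R M" "submodule N R M" and M': "module R M'" "submodule N' R M'"
    and closed: "\<And>x. x \<in> carrier M \<Longrightarrow> \<phi> x \<in> carrier M'"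
    and add: "\<And>x y. x \<in> carrier M \<Longrightarrow> y \<in> carrier M \<Longrightarrow> \<phi> (x \<oplus>\<^bsub>M\<^esub> y) = \<phi> x \<oplus>\<^bsub>M'\<^esub> \<phi> y"
    and smult: "\<And>r x. r \<in> carrier R \<Longrightarrow> x \<in> carrier M \<Longrightarrow> \<phi> (r \<odot>\<^bsub>M\<^esub> x) = r \<odot>\<^bsub>M'\<^esub> \<phi> x"
    and ker: "\<And>x. x \<in> carrier M \<Longrightarrow> \<phi> x \<in> N' \<longleftrightarrow> x \<in> N"
    and surj: "\<And>y. y \<in> carrier M' \<Longrightarrow> \<exists>x\<in>carrier M. y \<ominus>\<^bsub>M'\<^esub> \<phi> x \<in> N'"
  shows "module_isomorphic R (quotient_module M N) (quotient_module M' N')"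
proof -
  interpret M: module R M by (rule M(1))
  interpret M': module R M' by (rule M'(1))
  interpret N: abelian_subgroup N M by (rule M.submodule_abelian_subgroup[OF M(2)])
  interpret N': abelian_subgroup N' M' by (rule M'.submodule_abelian_subgroup[OF M'(2)])
  let ?h = "\<lambda>C. \<Union>x\<in>C. N' +>\<^bsub>M'\<^esub> \<phi> x"
  have diff: "\<phi> x \<ominus>\<^bsub>M'\<^esub> \<phi> y = \<phi> (x \<ominus>\<^bsub>M\<^esub> y)" if x: "x \<in> carrier M" and y: "y \<in> carrier M" for x y
  proof -
    have d: "x \<ominus>\<^bsub>M\<^esub> y \<in> carrier M" using x y by simp
    have "x = (x \<ominus>\<^bsub>M\<^esub> y) \<oplus>\<^bsub>M\<^esub> y" using x y by (simp add: a_minus_def M.M.a_assoc M.M.l_neg)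
    then have "\<phi> x = \<phi> (x \<ominus>\<^bsub>M\<^esub> y) \<oplus>\<^bsub>M'\<^esub> \<phi> y" using add[OF d y] by simp
    then show ?thesis
      using closed[OF d] closed[OF y] by (simp add: a_minus_def M'.M.a_assoc M'.M.r_neg)
  qed
  have eq: "N' +>\<^bsub>M'\<^esub> \<phi> x = N' +>\<^bsub>M'\<^esub> \<phi> y \<longleftrightarrow> N +>\<^bsub>M\<^esub> x = N +>\<^bsub>M\<^esub> y"
    if x: "x \<in> carrier M" and y: "y \<in> carrier M" for x y
    unfolding N.coset_eq_iff[OF x y] N'.coset_eq_iff[OF closed[OF x] closed[OF y]] diff[OF x y]
    using x y by (intro ker) simp
  have h: "?h (N +>\<^bsub>M\<^esub> x) = N' +>\<^bsub>M'\<^esub> \<phi> x" if x: "x \<in> carrier M" for x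
  proof -
    have "N' +>\<^bsub>M'\<^esub> \<phi> y = N' +>\<^bsub>M'\<^esub> \<phi> x" if y: "y \<in> N +>\<^bsub>M\<^esub> x" for y
    proof -
      have yM: "y \<in> carrier M" using N.a_elemrcos_carrier[OF x y] .
      have "y \<ominus>\<^bsub>M\<^esub> x \<in> N" using N.a_rcos_module_imp[OF x y] by (simp add: a_minus_def)
      then show ?thesis using eq[OF yM x] N.coset_eq_iff[OF yM x] by simp
    qed
    moreover have "x \<in> N +>\<^bsub>M\<^esub> x" by (rule N.a_rcos_self[OF x])
    ultimately show ?thesis by blast
  qed
  have "?h \<in> module_iso R (quotient_module M N) (quotient_module M' N')"
    unfolding module_iso_def mem_Collect_eq
  proof (intro conjI ballI)
    show "bij_betw ?h (carrier (quotient_module M N)) (carrier (quotient_module M' N'))"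
      unfolding M.quotient_carrier M'.quotient_carrier
    proof (rule bij_betw_imageI)
      show "inj_on ?h ((\<lambda>x. N +>\<^bsub>M\<^esub> x) ` carrier M)"
      proof (rule inj_onI, elim imageE)
        fix C C' x y assume C: "?h C = ?h C'" "C = N +>\<^bsub>M\<^esub> x" "C' = N +>\<^bsub>M\<^esub> y"
          and x: "x \<in> carrier M" and y: "y \<in> carrier M"
        have "N' +>\<^bsub>M'\<^esub> \<phi> x = N' +>\<^bsub>M'\<^esub> \<phi> y" using C(1) unfolding C(2,3) h[OF x] h[OF y] .
        then show "C = C'" using eq[OF x y] unfolding C(2,3) by simp
      qed
      have "N' +>\<^bsub>M'\<^esub> y \<in> ?h ` ((\<lambda>x. N +>\<^bsub>M\<^esub> x) ` carrier M)" if y: "y \<in> carrier M'" for y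
      proof -
        obtain x where x: "x \<in> carrier M" "y \<ominus>\<^bsub>M'\<^esub> \<phi> x \<in> N'" using surj[OF y] by blast
        then have "N' +>\<^bsub>M'\<^esub> y = ?h (N +>\<^bsub>M\<^esub> x)"
          using N'.coset_eq_iff[OF y closed[OF x(1)]] h[OF x(1)] by simp
        then show ?thesis using x(1) by blast
      qed
      moreover have "?h (N +>\<^bsub>M\<^esub> x) \<in> (\<lambda>y. N' +>\<^bsub>M'\<^esub> y) ` carrier M'" if "x \<in> carrier M" for x
        unfolding h[OF that] using closed[OF that] by blast
      ultimately show "?h ` ((\<lambda>x. N +>\<^bsub>M\<^esub> x) ` carrier M) = (\<lambda>y. N' +>\<^bsub>M'\<^esub> y) ` carrier M'"
        by blast
    qed
  next
    fix C C' assume "C \<in> carrier (quotient_module M N)" "C' \<in> carrier (quotient_module M N)"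
    then obtain x y where x: "x \<in> carrier M" "C = N +>\<^bsub>M\<^esub> x" and y: "y \<in> carrier M" "C' = N +>\<^bsub>M\<^esub> y"
      unfolding M.quotient_carrier by blast
    have xy: "x \<oplus>\<^bsub>M\<^esub> y \<in> carrier M" using x y by simp
    show "?h (C \<oplus>\<^bsub>quotient_module M N\<^esub> C') = ?h C \<oplus>\<^bsub>quotient_module M' N'\<^esub> ?h C'"
      unfolding x(2) y(2) M.quotient_add[OF M(2) x(1) y(1)] h[OF xy] h[OF x(1)] h[OF y(1)]
        M'.quotient_add[OF M'(2) closed[OF x(1)] closed[OF y(1)]] add[OF x(1) y(1)] ..
  next
    fix r C assume r: "r \<in> carrier R" and "C \<in> carrier (quotient_module M N)"
    then obtain x where x: "x \<in> carrier M" "C = N +>\<^bsub>M\<^esub> x"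
      unfolding M.quotient_carrier by blast
    have rx: "r \<odot>\<^bsub>M\<^esub> x \<in> carrier M" using r x by simp
    show "?h (r \<odot>\<^bsub>quotient_module M N\<^esub> C) = r \<odot>\<^bsub>quotient_module M' N'\<^esub> ?h C"
      unfolding x(2) M.quotient_smult[OF M(2) r x(1)] h[OF rx] h[OF x(1)]
        M'.quotient_smult[OF M'(2) r closed[OF x(1)]] smult[OF r x(1)] ..
  qed
  then show ?thesis unfolding module_isomorphic_def by blast
qed

section \<open>Rings as modules, and free modules with their universal property\<close>

lemma ring_as_module_simps [simp]:
  "carrier (ring_as_module R) = carrier R" "ring.zero (ring_as_module R) = \<zero>\<^bsub>R\<^esub>"
  "ring.add (ring_as_module R) = ring.add R" "smult (ring_as_module R) = monoid.mult R"
  by (simp_all add: ring_as_module_def)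

lemma ring_as_module_minus [simp]:
  "x \<ominus>\<^bsub>ring_as_module R\<^esub> y = x \<ominus>\<^bsub>R\<^esub> y"
  by (simp add: a_minus_def a_inv_def m_inv_def)

lemma (in cring) ring_as_module_module: "module R (ring_as_module R)"
proof (rule moduleI)
  show "abelian_group (ring_as_module R)"
    by (rule abelian_groupI) (auto simp: a_ac intro: l_neg bexI[of _ "\<ominus> _"])
qed (auto simp: is_cring l_distr r_distr m_assoc)

lemma (in cring) ideal_submodule:
  assumes "ideal I R"
  shows "submodule I R (ring_as_module R)"
proof -
  interpret ideal I R by (rule assms)
  have "\<ominus>\<^bsub>ring_as_module R\<^esub> x = \<ominus> x" for x by (simp add: a_inv_def m_inv_def)
  then show ?thesis
    by (intro module.submoduleI[OF ring_as_module_module]) (auto intro: I_l_closed)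
qed

lemma free_module_simps:
  "ring.zero (free_module R S) = (\<lambda>s. \<zero>\<^bsub>R\<^esub>)"
  "f \<oplus>\<^bsub>free_module R S\<^esub> g = (\<lambda>s. f s \<oplus>\<^bsub>R\<^esub> g s)"
  "r \<odot>\<^bsub>free_module R S\<^esub> f = (\<lambda>s. r \<otimes>\<^bsub>R\<^esub> f s)"
  by (simp_all add: free_module_def)

context cring
begin

text \<open>A finite set containing the support is easier to exhibit than the support itself: for a
  sum, where terms may cancel, the union of two such sets serves.\<close>

lemma free_module_carrier:
  "f \<in> carrier (free_module R S) \<longleftrightarrow>
    (\<forall>s. f s \<in> carrier R) \<and> (\<exists>A. finite A \<and> A \<subseteq> S \<and> (\<forall>s. s \<notin> A \<longrightarrow> f s = \<zero>))"
proof
  assume "f \<in> carrier (free_module R S)"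
  then show "(\<forall>s. f s \<in> carrier R) \<and> (\<exists>A. finite A \<and> A \<subseteq> S \<and> (\<forall>s. s \<notin> A \<longrightarrow> f s = \<zero>))"
    by (intro conjI exI[of _ "{s. f s \<noteq> \<zero>}"]) (auto simp: free_module_def)
next
  assume *: "(\<forall>s. f s \<in> carrier R) \<and> (\<exists>A. finite A \<and> A \<subseteq> S \<and> (\<forall>s. s \<notin> A \<longrightarrow> f s = \<zero>))"
  then obtain A where A: "finite A" "A \<subseteq> S" "\<forall>s. s \<notin> A \<longrightarrow> f s = \<zero>" by blast
  then have "{s. f s \<noteq> \<zero>} \<subseteq> A" by blast
  then have "finite {s. f s \<noteq> \<zero>}" "{s. f s \<noteq> \<zero>} \<subseteq> S"
    using A(1,2) by (auto intro: finite_subset)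
  then show "f \<in> carrier (free_module R S)" using * by (simp add: free_module_def)
qed

lemma free_module_support:
  assumes "f \<in> carrier (free_module R S)"
  shows "\<exists>A. finite A \<and> A \<subseteq> S \<and> (\<forall>s. s \<notin> A \<longrightarrow> f s = \<zero>)"
  using assms unfolding free_module_carrier by blast

lemma free_module_closed: "f \<in> carrier (free_module R S) \<Longrightarrow> f s \<in> carrier R"
  unfolding free_module_carrier by blast

lemma free_module_add_closed:
  assumes f: "f \<in> carrier (free_module R S)" and g: "g \<in> carrier (free_module R S)"
  shows "(\<lambda>s. f s \<oplus> g s) \<in> carrier (free_module R S)"
proof -
  obtain A where A: "finite A" "A \<subseteq> S" "\<forall>s. s \<notin> A \<longrightarrow> f s = \<zero>"
    using free_module_support[OF f] by blast
  obtain B where B: "finite B" "B \<subseteq> S" "\<forall>s. s \<notin> B \<longrightarrow> g s = \<zero>"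
    using free_module_support[OF g] by blast
  show ?thesis unfolding free_module_carrier
    using A B free_module_closed[OF f] free_module_closed[OF g]
    by (intro conjI exI[of _ "A \<union> B"]) auto
qed

lemma free_module_smult_closed:
  assumes f: "f \<in> carrier (free_module R S)" and r: "r \<in> carrier R"
  shows "(\<lambda>s. r \<otimes> f s) \<in> carrier (free_module R S)"
proof -
  obtain A where A: "finite A" "A \<subseteq> S" "\<forall>s. s \<notin> A \<longrightarrow> f s = \<zero>"
    using free_module_support[OF f] by blast
  show ?thesis unfolding free_module_carrier
    using A free_module_closed[OF f] r by (intro conjI exI[of _ A]) auto
qed

lemma free_module_module: "module R (free_module R S)"
proof (rule moduleI)
  show "abelian_group (free_module R S)"
  proof (rule abelian_groupI)
    fix f assume f: "f \<in> carrier (free_module R S)"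
    have "(\<lambda>s. \<ominus> \<one> \<otimes> f s) \<in> carrier (free_module R S)"
      by (rule free_module_smult_closed[OF f]) simp
    moreover have "(\<lambda>s. \<ominus> \<one> \<otimes> f s) \<oplus>\<^bsub>free_module R S\<^esub> f = \<zero>\<^bsub>free_module R S\<^esub>"
      using free_module_closed[OF f] by (simp add: free_module_simps l_minus l_neg)
    ultimately show "\<exists>g\<in>carrier (free_module R S). g \<oplus>\<^bsub>free_module R S\<^esub> f = \<zero>\<^bsub>free_module R S\<^esub>"
      by blast
  next
    show "\<zero>\<^bsub>free_module R S\<^esub> \<in> carrier (free_module R S)"
      unfolding free_module_carrier free_module_simps by (auto intro: exI[of _ "{}"])
  qed (auto simp: free_module_simps free_module_add_closed free_module_closed a_ac)
qed (auto simp: free_module_simps is_cring free_module_smult_closed free_module_closed l_distr r_distr m_assoc)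

lemma free_gen_closed: "s \<in> S \<Longrightarrow> free_gen R s \<in> carrier (free_module R S)"
  unfolding free_module_carrier free_gen_def by (intro conjI exI[of _ "{s}"]) auto

text \<open>Removing a point from a finite set that contains the support splits off a multiple of
  one generator.\<close>

lemma free_module_induct [consumes 1, case_names zero gen add]:
  assumes "f \<in> carrier (free_module R S)"
    and zero: "P \<zero>\<^bsub>free_module R S\<^esub>"
    and gen: "\<And>r s. r \<in> carrier R \<Longrightarrow> s \<in> S \<Longrightarrow> P (r \<odot>\<^bsub>free_module R S\<^esub> free_gen R s)"
    and add: "\<And>f g. f \<in> carrier (free_module R S) \<Longrightarrow> g \<in> carrier (free_module R S) \<Longrightarrow>
      P f \<Longrightarrow> P g \<Longrightarrow> P (f \<oplus>\<^bsub>free_module R S\<^esub> g)"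
  shows "P f"
proof -
  obtain A where A: "finite A" "A \<subseteq> S" "\<forall>s. s \<notin> A \<longrightarrow> f s = \<zero>"
    using free_module_support[OF assms(1)] by blast
  have "P f" if "finite A" "A \<subseteq> S" "\<And>s. f s \<in> carrier R" "\<And>s. s \<notin> A \<Longrightarrow> f s = \<zero>" for A f
    using that
  proof (induction A arbitrary: f rule: finite_induct)
    case empty
    then have "f = (\<lambda>s. \<zero>)" by auto
    then show ?case using zero by (simp add: free_module_simps)
  next
    case (insert a A)
    let ?g = "\<lambda>t. f a \<otimes> free_gen R a t" and ?f = "\<lambda>t. if t = a then \<zero> else f t"
    have fa: "f a \<in> carrier R" and aS: "a \<in> S" using insert by auto
    have "?f \<in> carrier (free_module R S)"
      unfolding free_module_carrier using insert by (intro conjI exI[of _ A]) auto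
    moreover have "?g \<in> carrier (free_module R S)"
      using free_module_smult_closed[OF free_gen_closed[OF aS] fa] .
    moreover have "P ?f" using insert by (intro insert.IH) auto
    moreover have "P ?g" using gen[OF fa aS] by (simp add: free_module_simps)
    ultimately have "P (\<lambda>s. ?g s \<oplus> ?f s)" using add[of ?g ?f] by (simp add: free_module_simps)
    moreover have "(\<lambda>s. ?g s \<oplus> ?f s) = f" using insert(5) by (auto simp: free_gen_def)
    ultimately show ?case by simp
  qed
  then show ?thesis using A free_module_closed[OF assms(1)] by blast
qed

text \<open>The linear extension of D from the generators to the free module. For a derivation
  modulo J it will induce a map from \<Omega> to B/J.\<close>

definition free_eval :: "('s \<Rightarrow> 'a) \<Rightarrow> ('s \<Rightarrow> 'a) \<Rightarrow> 'a" where
  "free_eval D f = (\<Oplus>s\<in>{s. f s \<noteq> \<zero>}. f s \<otimes> D s)"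

context
  fixes S :: "'s set" and D :: "'s \<Rightarrow> 'a"
  assumes D: "\<And>s. s \<in> S \<Longrightarrow> D s \<in> carrier R"
begin

text \<open>The support varies with f, so values at different f can only be compared through sums
  over a common finite set.\<close>

lemma free_eval_eq:
  assumes "finite A" "A \<subseteq> S" "\<And>s. f s \<in> carrier R" "\<And>s. s \<notin> A \<Longrightarrow> f s = \<zero>"
  shows "free_eval D f = (\<Oplus>s\<in>A. f s \<otimes> D s)"
  unfolding free_eval_def
  using assms D by (intro add.finprod_mono_neutral_cong_left) auto

lemma free_eval_closed:
  assumes f: "f \<in> carrier (free_module R S)"
  shows "free_eval D f \<in> carrier R"
proof -
  obtain A where A: "finite A" "A \<subseteq> S" "\<forall>s. s \<notin> A \<longrightarrow> f s = \<zero>"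
    using free_module_support[OF f] by blast
  have "free_eval D f = (\<Oplus>s\<in>A. f s \<otimes> D s)"
    using A free_module_closed[OF f] by (intro free_eval_eq) auto
  also have "\<dots> \<in> carrier R"
    using A(2) D free_module_closed[OF f] by (intro finsum_closed) auto
  finally show ?thesis .
qed

lemma free_eval_add:
  assumes f: "f \<in> carrier (free_module R S)" and g: "g \<in> carrier (free_module R S)"
  shows "free_eval D (f \<oplus>\<^bsub>free_module R S\<^esub> g) = free_eval D f \<oplus> free_eval D g"
proof -
  note c [simp] = free_module_closed[OF f] free_module_closed[OF g]
  obtain A where A: "finite A" "A \<subseteq> S" "\<forall>s. s \<notin> A \<longrightarrow> f s = \<zero>"
    using free_module_support[OF f] by blast
  obtain B where B: "finite B" "B \<subseteq> S" "\<forall>s. s \<notin> B \<longrightarrow> g s = \<zero>"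
    using free_module_support[OF g] by blast
  have DA: "D s \<in> carrier R" if "s \<in> A \<union> B" for s using that A(2) B(2) D by blast
  have "free_eval D (\<lambda>s. f s \<oplus> g s) = (\<Oplus>s\<in>A \<union> B. (f s \<oplus> g s) \<otimes> D s)"
    using A B by (intro free_eval_eq) auto
  also have "\<dots> = (\<Oplus>s\<in>A \<union> B. f s \<otimes> D s \<oplus> g s \<otimes> D s)"
    using DA by (intro finsum_cong') (auto simp: l_distr)
  also have "\<dots> = (\<Oplus>s\<in>A \<union> B. f s \<otimes> D s) \<oplus> (\<Oplus>s\<in>A \<union> B. g s \<otimes> D s)"
    using DA by (intro finsum_addf) auto
  also have "(\<Oplus>s\<in>A \<union> B. f s \<otimes> D s) = free_eval D f"
    using A B by (intro free_eval_eq[symmetric]) auto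
  also have "(\<Oplus>s\<in>A \<union> B. g s \<otimes> D s) = free_eval D g"
    using A B by (intro free_eval_eq[symmetric]) auto
  finally show ?thesis unfolding free_module_simps .
qed

lemma free_eval_smult:
  assumes f: "f \<in> carrier (free_module R S)" and r: "r \<in> carrier R"
  shows "free_eval D (r \<odot>\<^bsub>free_module R S\<^esub> f) = r \<otimes> free_eval D f"
proof -
  note c [simp] = free_module_closed[OF f]
  obtain A where A: "finite A" "A \<subseteq> S" "\<forall>s. s \<notin> A \<longrightarrow> f s = \<zero>"
    using free_module_support[OF f] by blast
  have DA: "D s \<in> carrier R" if "s \<in> A" for s using that A(2) D by blast
  have "free_eval D (\<lambda>s. r \<otimes> f s) = (\<Oplus>s\<in>A. (r \<otimes> f s) \<otimes> D s)"
    using A r by (intro free_eval_eq) auto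
  also have "\<dots> = (\<Oplus>s\<in>A. r \<otimes> (f s \<otimes> D s))"
    using DA r by (intro finsum_cong') (auto simp: m_assoc)
  also have "\<dots> = r \<otimes> (\<Oplus>s\<in>A. f s \<otimes> D s)"
    using DA r A(1) by (intro finsum_rdistr[symmetric]) auto
  also have "(\<Oplus>s\<in>A. f s \<otimes> D s) = free_eval D f"
    using A by (intro free_eval_eq[symmetric]) auto
  finally show ?thesis unfolding free_module_simps .
qed

lemma free_eval_gen:
  assumes s: "s \<in> S"
  shows "free_eval D (free_gen R s) = D s"
proof -
  have "free_eval D (free_gen R s) = (\<Oplus>t\<in>{s}. free_gen R s t \<otimes> D t)"
    using s by (intro free_eval_eq) (auto simp: free_gen_def)
  also have "\<dots> = D s" using D[OF s] by (simp add: free_gen_def)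
  finally show ?thesis .
qed

end

end

section \<open>Kaehler differentials of a monogenic extension\<close>

context module
begin

lemma submodule_span_incl: "S \<subseteq> submodule_span R M S"
  unfolding submodule_span_def by blast

lemma submodule_span_minimal: "submodule N R M \<Longrightarrow> S \<subseteq> N \<Longrightarrow> submodule_span R M S \<subseteq> N"
  unfolding submodule_span_def by blast

lemma submodule_span_submodule:
  assumes "S \<subseteq> carrier M"
  shows "submodule (submodule_span R M S) R M"
proof (rule submoduleI)
  note E = submoduleE
  show "submodule_span R M S \<subseteq> carrier M"
    by (rule submodule_span_minimal[OF carrier_is_submodule assms])
  show "\<zero>\<^bsub>M\<^esub> \<in> submodule_span R M S"
    unfolding submodule_span_def
    using subgroup.one_closed[OF submodule.axioms(1)] by auto
  show "\<ominus>\<^bsub>M\<^esub> a \<in> submodule_span R M S" if "a \<in> submodule_span R M S" for a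
    using that E(3) unfolding submodule_span_def by blast
  show "a \<oplus>\<^bsub>M\<^esub> b \<in> submodule_span R M S"
    if "a \<in> submodule_span R M S" "b \<in> submodule_span R M S" for a b
    using that E(5) unfolding submodule_span_def by blast
  show "r \<odot>\<^bsub>M\<^esub> x \<in> submodule_span R M S"
    if "r \<in> carrier R" "x \<in> submodule_span R M S" for r x
    using that E(4) unfolding submodule_span_def by blast
qed

text \<open>Equality in the quotient module, expressed on representatives: computations in \<Omega>
  take place in the free module, without forming cosets.\<close>

definition cong :: "'c set \<Rightarrow> 'c \<Rightarrow> 'c \<Rightarrow> bool" where
  "cong N x y \<longleftrightarrow> x \<in> carrier M \<and> y \<in> carrier M \<and> x \<ominus>\<^bsub>M\<^esub> y \<in> N"

context
  fixes N assumes N: "submodule N R M"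
begin

lemma sub_zero: "\<zero>\<^bsub>M\<^esub> \<in> N"
  using subgroup.one_closed[OF submodule.axioms(1)[OF N]] by simp

lemma cong_refl: "x \<in> carrier M \<Longrightarrow> cong N x x"
  using sub_zero by (simp add: cong_def a_minus_def M.r_neg)

lemma cong_sym: "cong N x y \<Longrightarrow> cong N y x"
  unfolding cong_def
  using submoduleE(3)[OF N, of "x \<ominus>\<^bsub>M\<^esub> y"]
  by (auto simp: a_minus_def M.minus_add M.a_comm)

lemma cong_trans: "cong N x y \<Longrightarrow> cong N y z \<Longrightarrow> cong N x z"
proof -
  assume *: "cong N x y" "cong N y z"
  then have c: "x \<in> carrier M" "y \<in> carrier M" "z \<in> carrier M" by (auto simp: cong_def)
  have "(x \<ominus>\<^bsub>M\<^esub> y) \<oplus>\<^bsub>M\<^esub> (y \<ominus>\<^bsub>M\<^esub> z) \<in> N"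
    using * submoduleE(5)[OF N] by (simp add: cong_def)
  moreover have "(x \<ominus>\<^bsub>M\<^esub> y) \<oplus>\<^bsub>M\<^esub> (y \<ominus>\<^bsub>M\<^esub> z) = x \<ominus>\<^bsub>M\<^esub> z"
    using c by (simp add: a_minus_def M.a_assoc M.r_neg1)
  ultimately show ?thesis using c by (simp add: cong_def)
qed

lemma cong_add: "cong N x y \<Longrightarrow> cong N x' y' \<Longrightarrow> cong N (x \<oplus>\<^bsub>M\<^esub> x') (y \<oplus>\<^bsub>M\<^esub> y')"
proof -
  assume *: "cong N x y" "cong N x' y'"
  then have c: "x \<in> carrier M" "y \<in> carrier M" "x' \<in> carrier M" "y' \<in> carrier M"
    by (auto simp: cong_def)
  have "(x \<ominus>\<^bsub>M\<^esub> y) \<oplus>\<^bsub>M\<^esub> (x' \<ominus>\<^bsub>M\<^esub> y') \<in> N"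
    using * submoduleE(5)[OF N] by (simp add: cong_def)
  moreover have "(x \<ominus>\<^bsub>M\<^esub> y) \<oplus>\<^bsub>M\<^esub> (x' \<ominus>\<^bsub>M\<^esub> y') = (x \<oplus>\<^bsub>M\<^esub> x') \<ominus>\<^bsub>M\<^esub> (y \<oplus>\<^bsub>M\<^esub> y')"
    using c by (simp add: a_minus_def M.minus_add M.a_ac)
  ultimately show ?thesis using c by (simp add: cong_def)
qed

lemma cong_smult: "r \<in> carrier R \<Longrightarrow> cong N x y \<Longrightarrow> cong N (r \<odot>\<^bsub>M\<^esub> x) (r \<odot>\<^bsub>M\<^esub> y)"
  using submoduleE(4)[OF N, of r "x \<ominus>\<^bsub>M\<^esub> y"] smult_diff[of r x y]
  by (auto simp: cong_def)

lemma cong_mem: "cong N x y \<Longrightarrow> y \<in> N \<Longrightarrow> x \<in> N"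
proof -
  assume *: "cong N x y" "y \<in> N"
  then have "(x \<ominus>\<^bsub>M\<^esub> y) \<oplus>\<^bsub>M\<^esub> y \<in> N" using submoduleE(5)[OF N] by (simp add: cong_def)
  moreover have "(x \<ominus>\<^bsub>M\<^esub> y) \<oplus>\<^bsub>M\<^esub> y = x"
    using * by (simp add: cong_def a_minus_def M.a_assoc M.l_neg)
  ultimately show ?thesis by simp
qed

end

end

section \<open>The module of differentials of B over a subring A\<close>

locale kaehler = cring B for B (structure) +
  fixes A assumes A: "subring A B"
begin

abbreviation F where "F \<equiv> free_module B (carrier B)"
abbreviation d where "d \<equiv> free_gen B"
abbreviation plusF (infixl "\<boxplus>" 65) where "f \<boxplus> g \<equiv> f \<oplus>\<^bsub>F\<^esub> g"
abbreviation smultF (infixr "\<bullet>" 70) where "r \<bullet> f \<equiv> r \<odot>\<^bsub>F\<^esub> f"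

definition N where "N = submodule_span B F (kaehler_relations B A)"

lemma F_module: "module B F"
  by (rule free_module_module)

lemmas F_smult = module.smult_closed[OF F_module]
lemmas F_add = abelian_monoid.a_closed[OF abelian_group.axioms(1)[OF module.axioms(2)[OF F_module]]]
lemmas F_minus = abelian_group.minus_closed[OF module.axioms(2)[OF F_module]]

lemma d_closed: "x \<in> carrier B \<Longrightarrow> d x \<in> carrier F"
  by (rule free_gen_closed)

lemma A_closed: "a \<in> A \<Longrightarrow> a \<in> carrier B"
  using subringE(1)[OF A] by blast

lemma relations_closed: "kaehler_relations B A \<subseteq> carrier F"
  unfolding kaehler_relations_def Let_def
  by (auto intro!: F_minus F_add F_smult d_closed simp: A_closed)

lemma N_submodule: "submodule N B F"
  unfolding N_def by (rule module.submodule_span_submodule[OF F_module relations_closed])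

lemma N_relations: "kaehler_relations B A \<subseteq> N"
  unfolding N_def by (rule module.submodule_span_incl[OF F_module])

abbreviation eqv (infix "\<approx>" 50) where "x \<approx> y \<equiv> module.cong F N x y"

lemmas eqv_def = module.cong_def[OF F_module]
lemmas eqv_refl = module.cong_refl[OF F_module N_submodule]
lemmas eqv_sym = module.cong_sym[OF F_module N_submodule]
lemmas eqv_trans [trans] = module.cong_trans[OF F_module N_submodule]
lemmas eqv_add = module.cong_add[OF F_module N_submodule]
lemmas eqv_smult = module.cong_smult[OF F_module N_submodule]
lemmas eqv_mem = module.cong_mem[OF F_module N_submodule]

lemma d_add:
  assumes "x \<in> carrier B" "y \<in> carrier B"
  shows "d (x \<oplus> y) \<approx> d x \<boxplus> d y"
proof -
  have "d (x \<oplus> y) \<ominus>\<^bsub>F\<^esub> (d x \<boxplus> d y) \<in> kaehler_relations B A"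
    using assms unfolding kaehler_relations_def Let_def by blast
  then show ?thesis
    unfolding eqv_def using N_relations assms by (blast intro: d_closed F_add a_closed)
qed

lemma d_mult:
  assumes "x \<in> carrier B" "y \<in> carrier B"
  shows "d (x \<otimes> y) \<approx> x \<bullet> d y \<boxplus> y \<bullet> d x"
proof -
  have "d (x \<otimes> y) \<ominus>\<^bsub>F\<^esub> (x \<bullet> d y \<boxplus> y \<bullet> d x) \<in> kaehler_relations B A"
    using assms unfolding kaehler_relations_def Let_def by blast
  then show ?thesis
    unfolding eqv_def using N_relations assms by (blast intro: d_closed F_add F_smult m_closed)
qed

lemma d_A: "a \<in> A \<Longrightarrow> d a \<in> N"
  using N_relations unfolding kaehler_relations_def Let_def by blast

lemma N_closed: "f \<in> N \<Longrightarrow> f \<in> carrier F"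
  using module.submoduleE(1)[OF F_module N_submodule] by blast

lemma F_zero: "\<zero>\<^bsub>F\<^esub> \<in> carrier F"
  by (rule abelian_monoid.zero_closed[OF abelian_group.axioms(1)[OF module.axioms(2)[OF F_module]]])

lemma N_eqv_zero: "f \<in> N \<Longrightarrow> f \<approx> \<zero>\<^bsub>F\<^esub>"
proof -
  interpret F: abelian_group F by (rule module.axioms(2)[OF F_module])
  assume f: "f \<in> N"
  have "\<ominus>\<^bsub>F\<^esub> \<zero>\<^bsub>F\<^esub> = \<zero>\<^bsub>F\<^esub>" by (rule F.minus_equality) simp_all
  then have "f \<ominus>\<^bsub>F\<^esub> \<zero>\<^bsub>F\<^esub> = f" using N_closed[OF f] by (simp add: a_minus_def)
  then show ?thesis using f N_closed[OF f] by (simp add: eqv_def)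
qed

text \<open>Written with \<open>Suc n\<close> on the left so that the lowered exponent involves no
  truncated subtraction.\<close>

lemma d_power:
  assumes x: "x \<in> carrier B"
  shows "d (x [^] Suc n) \<approx> ([Suc n] \<cdot> (x [^] n)) \<bullet> d x"
proof (induction n)
  case 0
  have "\<one> \<bullet> d x = d x" by (rule module.smult_one[OF F_module d_closed[OF x]])
  then show ?case using x eqv_refl[OF d_closed[OF x]] by simp
next
  case (Suc n)
  let ?c = "[Suc n] \<cdot> (x [^] n)"
  have c: "?c \<in> carrier B" "x [^] Suc n \<in> carrier B" using x by simp_all
  have "d (x [^] Suc n \<otimes> x) \<approx> x [^] Suc n \<bullet> d x \<boxplus> x \<bullet> d (x [^] Suc n)"
    by (rule d_mult[OF c(2) x])
  also have "\<dots> \<approx> x [^] Suc n \<bullet> d x \<boxplus> x \<bullet> (?c \<bullet> d x)"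
    by (rule eqv_add[OF eqv_refl[OF F_smult[OF c(2) d_closed[OF x]]] eqv_smult[OF x Suc]])
  also have "x \<bullet> (?c \<bullet> d x) = (x \<otimes> ?c) \<bullet> d x"
    by (rule module.smult_assoc1[OF F_module x c(1) d_closed[OF x], symmetric])
  also have "x [^] Suc n \<bullet> d x \<boxplus> (x \<otimes> ?c) \<bullet> d x = (x [^] Suc n \<oplus> x \<otimes> ?c) \<bullet> d x"
    by (rule module.smult_l_distr[OF F_module c(2) m_closed[OF x c(1)] d_closed[OF x], symmetric])
  also have "x [^] Suc n \<oplus> x \<otimes> ?c = [Suc (Suc n)] \<cdot> (x [^] Suc n)"
  proof -
    have "x \<otimes> ?c = [Suc n] \<cdot> (x \<otimes> x [^] n)" by (rule add_pow_rdistr[OF x]) (use x in simp)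
    also have "x \<otimes> x [^] n = x [^] Suc n" using x by (simp add: m_comm)
    finally show ?thesis using c(2) by (simp add: a_comm)
  qed
  finally show ?case by simp
qed

text \<open>Apply d to the equation. The left side gives p \<eta>^(p-1) d\<eta> = 0 because p = 0 in
  B, the right side gives e d\<eta> because de = du = 0.\<close>

lemma min_poly_derivative_in_N:
  fixes p :: nat
  assumes p: "[p] \<cdot> \<one> = \<zero>" "0 < p" and \<eta>: "\<eta> \<in> carrier B"
    and e: "e \<in> A" and u: "u \<in> A" and eq: "\<eta> [^] p = e \<otimes> \<eta> \<oplus> u"
  shows "e \<bullet> d \<eta> \<in> N"
proof -
  obtain q where q: "p = Suc q" using p(2) by (cases p) auto
  note eB = A_closed[OF e] and uB = A_closed[OF u]
  have "[p] \<cdot> (\<eta> [^] q) = [p] \<cdot> \<one> \<otimes> \<eta> [^] q"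
    using add_pow_ldistr[of \<one> "\<eta> [^] q" p] \<eta> by simp
  also have "\<dots> = \<zero>" unfolding p(1) using \<eta> by simp
  finally have "d (\<eta> [^] p) \<approx> \<zero> \<bullet> d \<eta>" using d_power[OF \<eta>, of q] q by simp
  then have 1: "d (e \<otimes> \<eta> \<oplus> u) \<approx> \<zero>\<^bsub>F\<^esub>"
    unfolding eq module.smult_l_null[OF F_module d_closed[OF \<eta>]] .
  interpret F: abelian_group F by (rule module.axioms(2)[OF F_module])
  have "d (e \<otimes> \<eta> \<oplus> u) \<approx> d (e \<otimes> \<eta>) \<boxplus> d u"
    by (rule d_add[OF m_closed[OF eB \<eta>] uB])
  also have "\<dots> \<approx> (e \<bullet> d \<eta> \<boxplus> \<eta> \<bullet> d e) \<boxplus> \<zero>\<^bsub>F\<^esub>"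
    by (rule eqv_add[OF d_mult[OF eB \<eta>] N_eqv_zero[OF d_A[OF u]]])
  also have "\<dots> \<approx> (e \<bullet> d \<eta> \<boxplus> \<eta> \<bullet> \<zero>\<^bsub>F\<^esub>) \<boxplus> \<zero>\<^bsub>F\<^esub>"
    by (intro eqv_add eqv_smult \<eta> N_eqv_zero[OF d_A[OF e]] eqv_refl F_smult eB d_closed F_zero)
  also have "\<dots> = e \<bullet> d \<eta>"
    using module.smult_r_null[OF F_module \<eta>] F_smult[OF eB d_closed[OF \<eta>]] by simp
  finally have "e \<bullet> d \<eta> \<approx> \<zero>\<^bsub>F\<^esub>" using 1 eqv_sym eqv_trans by blast
  then show ?thesis
    using eqv_mem module.sub_zero[OF F_module N_submodule] by blast
qed

text \<open>By the Leibniz rule the elements x with dx in B d\<eta> form a subring, and it contains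
  A and \<eta>. The hypothesis \<open>gen\<close> encodes B = A[\<eta>] by minimality among
  subrings, so no polynomial expressions in \<eta> are handled.\<close>

lemma differential_multiple:
  assumes \<eta>: "\<eta> \<in> carrier B"
    and gen: "\<And>S. subring S B \<Longrightarrow> A \<subseteq> S \<Longrightarrow> \<eta> \<in> S \<Longrightarrow> carrier B \<subseteq> S"
    and x: "x \<in> carrier B"
  shows "\<exists>b\<in>carrier B. d x \<approx> b \<bullet> d \<eta>"
proof -
  let ?S = "{x \<in> carrier B. \<exists>b\<in>carrier B. d x \<approx> b \<bullet> d \<eta>}"
  have AS: "A \<subseteq> ?S"
  proof
    fix a assume a: "a \<in> A"
    have "d a \<approx> \<zero> \<bullet> d \<eta>"
      unfolding module.smult_l_null[OF F_module d_closed[OF \<eta>]] by (rule N_eqv_zero[OF d_A[OF a]])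
    then show "a \<in> ?S" using A_closed[OF a] by blast
  qed
  have S_mult: "x \<otimes> y \<in> ?S" if x: "x \<in> ?S" and y: "y \<in> ?S" for x y
  proof -
    obtain b where b: "b \<in> carrier B" "d x \<approx> b \<bullet> d \<eta>" using x by blast
    obtain c where c: "c \<in> carrier B" "d y \<approx> c \<bullet> d \<eta>" using y by blast
    have xB: "x \<in> carrier B" and yB: "y \<in> carrier B" using x y by auto
    have "d (x \<otimes> y) \<approx> x \<bullet> d y \<boxplus> y \<bullet> d x" by (rule d_mult[OF xB yB])
    also have "\<dots> \<approx> x \<bullet> (c \<bullet> d \<eta>) \<boxplus> y \<bullet> (b \<bullet> d \<eta>)"
      by (rule eqv_add[OF eqv_smult[OF xB c(2)] eqv_smult[OF yB b(2)]])
    also have "\<dots> = (x \<otimes> c \<oplus> y \<otimes> b) \<bullet> d \<eta>"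
      unfolding module.smult_l_distr[OF F_module m_closed[OF xB c(1)] m_closed[OF yB b(1)] d_closed[OF \<eta>]]
        module.smult_assoc1[OF F_module xB c(1) d_closed[OF \<eta>]]
        module.smult_assoc1[OF F_module yB b(1) d_closed[OF \<eta>]] ..
    finally show ?thesis using xB yB b(1) c(1) by blast
  qed
  have "subring ?S B"
  proof (rule subringI)
    show "\<one> \<in> ?S" using AS subringE(3)[OF A] by blast
    fix x assume x: "x \<in> ?S"
    have "\<ominus> \<one> \<in> ?S" using AS subringE(3,5)[OF A] by blast
    then have "\<ominus> \<one> \<otimes> x \<in> ?S" using S_mult x by blast
    moreover have "\<ominus> \<one> \<otimes> x = \<ominus> x" using x by (simp add: l_minus)
    ultimately show "\<ominus> x \<in> ?S" by simp
    fix y assume y: "y \<in> ?S"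
    show "x \<otimes> y \<in> ?S" by (rule S_mult[OF x y])
    obtain b where b: "b \<in> carrier B" "d x \<approx> b \<bullet> d \<eta>" using x by blast
    obtain c where c: "c \<in> carrier B" "d y \<approx> c \<bullet> d \<eta>" using y by blast
    have xB: "x \<in> carrier B" and yB: "y \<in> carrier B" using x y by auto
    have "d (x \<oplus> y) \<approx> d x \<boxplus> d y" by (rule d_add[OF xB yB])
    also have "\<dots> \<approx> b \<bullet> d \<eta> \<boxplus> c \<bullet> d \<eta>" by (rule eqv_add[OF b(2) c(2)])
    also have "\<dots> = (b \<oplus> c) \<bullet> d \<eta>"
      by (rule module.smult_l_distr[OF F_module b(1) c(1) d_closed[OF \<eta>], symmetric])
    finally show "x \<oplus> y \<in> ?S" using xB yB b(1) c(1) by blast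
  qed blast
  moreover have "\<eta> \<in> ?S"
  proof -
    have "d \<eta> \<approx> \<one> \<bullet> d \<eta>"
      unfolding module.smult_one[OF F_module d_closed[OF \<eta>]] by (rule eqv_refl[OF d_closed[OF \<eta>]])
    then show ?thesis using \<eta> by blast
  qed
  ultimately have "carrier B \<subseteq> ?S" using gen AS by blast
  then show ?thesis using x by blast
qed

lemma form_multiple:
  assumes \<eta>: "\<eta> \<in> carrier B"
    and gen: "\<And>S. subring S B \<Longrightarrow> A \<subseteq> S \<Longrightarrow> \<eta> \<in> S \<Longrightarrow> carrier B \<subseteq> S"
    and f: "f \<in> carrier F"
  shows "\<exists>b\<in>carrier B. f \<approx> b \<bullet> d \<eta>"
  using f
proof (induction rule: free_module_induct)
  case zero
  have "\<zero>\<^bsub>F\<^esub> \<approx> \<zero> \<bullet> d \<eta>"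
    unfolding module.smult_l_null[OF F_module d_closed[OF \<eta>]] by (rule eqv_refl[OF F_zero])
  then show ?case by blast
next
  case (gen r s)
  obtain b where b: "b \<in> carrier B" "d s \<approx> b \<bullet> d \<eta>"
    using differential_multiple[OF \<eta> assms(2) gen(2)] by blast
  have "r \<bullet> d s \<approx> r \<bullet> (b \<bullet> d \<eta>)" by (rule eqv_smult[OF gen(1) b(2)])
  then have "r \<bullet> d s \<approx> (r \<otimes> b) \<bullet> d \<eta>"
    unfolding module.smult_assoc1[OF F_module gen(1) b(1) d_closed[OF \<eta>]] .
  then show ?case using gen(1) b(1) by blast
next
  case (add f g)
  obtain b where b: "b \<in> carrier B" "f \<approx> b \<bullet> d \<eta>" using add by blast
  obtain c where c: "c \<in> carrier B" "g \<approx> c \<bullet> d \<eta>" using add by blast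
  have "f \<boxplus> g \<approx> b \<bullet> d \<eta> \<boxplus> c \<bullet> d \<eta>" by (rule eqv_add[OF b(2) c(2)])
  then have "f \<boxplus> g \<approx> (b \<oplus> c) \<bullet> d \<eta>"
    unfolding module.smult_l_distr[OF F_module b(1) c(1) d_closed[OF \<eta>]] .
  then show ?case using b(1) c(1) by blast
qed

text \<open>A map \<open>D\<close> that is a derivation modulo \<open>J\<close> with \<open>D \<eta> = 1\<close> inverts
  \<open>b \<mapsto> b d\<eta>\<close> modulo \<open>J\<close>.\<close>

theorem monogenic:
  assumes \<eta>: "\<eta> \<in> carrier B"
    and gen: "\<And>S. subring S B \<Longrightarrow> A \<subseteq> S \<Longrightarrow> \<eta> \<in> S \<Longrightarrow> carrier B \<subseteq> S"
    and J: "ideal J B" and JN: "\<And>j. j \<in> J \<Longrightarrow> j \<bullet> d \<eta> \<in> N"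
    and D: "\<And>x. x \<in> carrier B \<Longrightarrow> D x \<in> carrier B"
    and D_add: "\<And>x y. x \<in> carrier B \<Longrightarrow> y \<in> carrier B \<Longrightarrow> D (x \<oplus> y) \<ominus> (D x \<oplus> D y) \<in> J"
    and D_mult: "\<And>x y. x \<in> carrier B \<Longrightarrow> y \<in> carrier B \<Longrightarrow>
      D (x \<otimes> y) \<ominus> (x \<otimes> D y \<oplus> y \<otimes> D x) \<in> J"
    and D_A: "\<And>a. a \<in> A \<Longrightarrow> D a \<in> J" and D_\<eta>: "D \<eta> \<ominus> \<one> \<in> J"
  shows "module_isomorphic B (kaehler_differentials B A) (quotient_module (ring_as_module B) J)"
    and "\<one> \<notin> J \<Longrightarrow> carrier (kaehler_differentials B A) \<noteq> {\<zero>\<^bsub>kaehler_differentials B A\<^esub>}"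
proof -
  interpret J: ideal J B by (rule J)
  interpret F: abelian_group F by (rule module.axioms(2)[OF F_module])
  let ?\<phi> = "free_eval D"
  have \<phi>_closed: "?\<phi> f \<in> carrier B" if "f \<in> carrier F" for f
    by (rule free_eval_closed[OF D that])
  have \<phi>_add: "?\<phi> (f \<boxplus> g) = ?\<phi> f \<oplus> ?\<phi> g" if "f \<in> carrier F" "g \<in> carrier F" for f g
    by (rule free_eval_add[OF D that])
  have \<phi>_smult: "?\<phi> (r \<bullet> f) = r \<otimes> ?\<phi> f" if "f \<in> carrier F" "r \<in> carrier B" for r f
    by (rule free_eval_smult[OF D that])
  have \<phi>_gen: "?\<phi> (d s) = D s" if "s \<in> carrier B" for s
    by (rule free_eval_gen[OF D that])
  have \<phi>_neg: "?\<phi> (\<ominus>\<^bsub>F\<^esub> f) = \<ominus> ?\<phi> f" if f: "f \<in> carrier F" for f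
  proof -
    have "?\<phi> (\<ominus>\<^bsub>F\<^esub> f) = ?\<phi> (\<ominus> \<one> \<bullet> f)"
      using module.smult_l_minus[OF F_module one_closed f] module.smult_one[OF F_module f] by simp
    also have "\<dots> = \<ominus> \<one> \<otimes> ?\<phi> f" by (rule \<phi>_smult[OF f]) simp
    finally show ?thesis using \<phi>_closed[OF f] by (simp add: l_minus)
  qed
  have \<phi>_diff: "?\<phi> (f \<ominus>\<^bsub>F\<^esub> g) = ?\<phi> f \<ominus> ?\<phi> g" if f: "f \<in> carrier F" and g: "g \<in> carrier F" for f g
    using \<phi>_add[OF f F.a_inv_closed[OF g]] \<phi>_neg[OF g] by (simp add: a_minus_def)
  \<comment> \<open>The preimage of J is a submodule that contains the relations, hence it contains
    N; this makes \<open>?\<phi>\<close> descend to a map from \<Omega> to B/J.\<close>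
  let ?P = "{f \<in> carrier F. ?\<phi> f \<in> J}"
  have "submodule ?P B F"
  proof (rule module.submoduleI[OF F_module])
    have "?\<phi> \<zero>\<^bsub>F\<^esub> = \<zero>" by (simp add: free_eval_def free_module_simps)
    then show "\<zero>\<^bsub>F\<^esub> \<in> ?P" using F_zero by simp
    show "\<ominus>\<^bsub>F\<^esub> f \<in> ?P" if "f \<in> ?P" for f using that \<phi>_neg by simp
    show "f \<boxplus> g \<in> ?P" if "f \<in> ?P" "g \<in> ?P" for f g using that \<phi>_add by simp
    show "r \<bullet> f \<in> ?P" if "r \<in> carrier B" "f \<in> ?P" for r f
      using that \<phi>_smult F_smult J.I_l_closed by simp
  qed blast
  moreover have "kaehler_relations B A \<subseteq> ?P"
  proof -
    have "d (x \<oplus> y) \<ominus>\<^bsub>F\<^esub> (d x \<boxplus> d y) \<in> ?P" if x: "x \<in> carrier B" and y: "y \<in> carrier B" for x y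
      using x y D_add[OF x y] \<phi>_diff \<phi>_add \<phi>_gen d_closed F_add by simp
    moreover have "d (x \<otimes> y) \<ominus>\<^bsub>F\<^esub> (x \<bullet> d y \<boxplus> y \<bullet> d x) \<in> ?P"
      if x: "x \<in> carrier B" and y: "y \<in> carrier B" for x y
      using x y D_mult[OF x y] \<phi>_diff \<phi>_add \<phi>_smult \<phi>_gen d_closed F_add F_smult by simp
    moreover have "d a \<in> ?P" if a: "a \<in> A" for a
      using D_A[OF a] A_closed[OF a] \<phi>_gen d_closed by simp
    ultimately show ?thesis unfolding kaehler_relations_def Let_def by blast
  qed
  ultimately have NP: "N \<subseteq> ?P"
    unfolding N_def by (rule module.submodule_span_minimal[OF F_module])
  have \<phi>_mult: "?\<phi> (b \<bullet> d \<eta>) = b \<otimes> D \<eta>" if b: "b \<in> carrier B" for b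
    using \<phi>_smult[OF d_closed[OF \<eta>] b] \<phi>_gen[OF \<eta>] by simp
  have D\<eta>: "D \<eta> \<in> carrier B" using D[OF \<eta>] .
  have b_diff: "b \<otimes> D \<eta> \<ominus> b \<in> J" if b: "b \<in> carrier B" for b
  proof -
    have "b \<otimes> D \<eta> \<ominus> b = b \<otimes> (D \<eta> \<ominus> \<one>)" using b D\<eta> by algebra
    then show ?thesis using J.I_l_closed[OF D_\<eta> b] by simp
  qed
  have ker: "?\<phi> f \<in> J \<longleftrightarrow> f \<in> N" if f: "f \<in> carrier F" for f
  proof
    assume \<phi>f: "?\<phi> f \<in> J"
    obtain b where b: "b \<in> carrier B" "f \<approx> b \<bullet> d \<eta>" using form_multiple[OF \<eta> gen f] by blast
    have bd: "b \<bullet> d \<eta> \<in> carrier F" using F_smult[OF b(1) d_closed[OF \<eta>]] .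
    have "f \<ominus>\<^bsub>F\<^esub> b \<bullet> d \<eta> \<in> ?P" using b(2) NP unfolding eqv_def by blast
    then have 1: "?\<phi> f \<ominus> b \<otimes> D \<eta> \<in> J" using \<phi>_diff[OF f bd] \<phi>_mult[OF b(1)] by simp
    have \<phi>fB: "?\<phi> f \<in> carrier B" using \<phi>_closed[OF f] .
    \<comment> \<open>Telescoping: modulo J, \<open>?\<phi> f\<close> is congruent to
      \<open>b \<otimes> D \<eta>\<close> and this to b.\<close>
    have "?\<phi> f \<oplus> \<ominus> ((?\<phi> f \<ominus> b \<otimes> D \<eta>) \<oplus> (b \<otimes> D \<eta> \<ominus> b)) \<in> J"
      using \<phi>f 1 b_diff[OF b(1)] by simp
    moreover have "?\<phi> f \<oplus> \<ominus> ((?\<phi> f \<ominus> b \<otimes> D \<eta>) \<oplus> (b \<otimes> D \<eta> \<ominus> b)) = b"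
      using \<phi>fB b(1) D\<eta> by algebra
    ultimately have "b \<in> J" by simp
    then show "f \<in> N" using eqv_mem[OF b(2)] JN by blast
  qed (use NP in blast)
  have surj: "\<exists>f\<in>carrier F. y \<ominus>\<^bsub>ring_as_module B\<^esub> ?\<phi> f \<in> J" if y: "y \<in> carrier (ring_as_module B)" for y
  proof
    have yB: "y \<in> carrier B" using y by simp
    show "y \<bullet> d \<eta> \<in> carrier F" using F_smult[OF yB d_closed[OF \<eta>]] .
    have "y \<ominus> y \<otimes> D \<eta> = \<ominus> (y \<otimes> D \<eta> \<ominus> y)" using yB D\<eta> by algebra
    then show "y \<ominus>\<^bsub>ring_as_module B\<^esub> ?\<phi> (y \<bullet> d \<eta>) \<in> J"
      using b_diff[OF yB] \<phi>_mult[OF yB] by simp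
  qed
  have \<Omega>: "kaehler_differentials B A = quotient_module F N"
    by (simp add: kaehler_differentials_def N_def Let_def)
  show "module_isomorphic B (kaehler_differentials B A) (quotient_module (ring_as_module B) J)"
    unfolding \<Omega>
    by (rule quotient_module_isomorphicI[OF F_module N_submodule ring_as_module_module
          ideal_submodule[OF J], where \<phi> = ?\<phi>])
      (use \<phi>_closed \<phi>_add \<phi>_smult ker surj in simp_all)
  assume J1: "\<one> \<notin> J"
  interpret N: abelian_subgroup N F
    by (rule module.submodule_abelian_subgroup[OF F_module N_submodule])
  \<comment> \<open>\<open>?\<phi>\<close> sends \<open>d \<eta>\<close> to \<open>D \<eta>\<close>,
    which is congruent to 1 modulo J, so \<open>d \<eta>\<close> survives in \<Omega> when J is
    proper.\<close>
  have "d \<eta> \<notin> N"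
  proof
    assume "d \<eta> \<in> N"
    then have "D \<eta> \<in> J" using NP \<phi>_gen[OF \<eta>] by auto
    then have "D \<eta> \<oplus> \<ominus> (D \<eta> \<ominus> \<one>) \<in> J" using D_\<eta> by simp
    moreover have "D \<eta> \<oplus> \<ominus> (D \<eta> \<ominus> \<one>) = \<one>" using D\<eta> by algebra
    ultimately show False using J1 by simp
  qed
  moreover have "d \<eta> \<in> N +>\<^bsub>F\<^esub> d \<eta>" by (rule N.a_rcos_self[OF d_closed[OF \<eta>]])
  ultimately have "N +>\<^bsub>F\<^esub> d \<eta> \<noteq> N" by blast
  moreover have "N +>\<^bsub>F\<^esub> d \<eta> \<in> carrier (quotient_module F N)"
    unfolding module.quotient_carrier[OF F_module] using d_closed[OF \<eta>] by blast
  moreover have "\<zero>\<^bsub>quotient_module F N\<^esub> = N" by (simp add: quotient_module_def)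
  ultimately show "carrier (kaehler_differentials B A) \<noteq> {\<zero>\<^bsub>kaehler_differentials B A\<^esub>}"
    unfolding \<Omega> by (metis singletonD)
qed

end

section \<open>Powers of principal ideals and quotients between them\<close>

lemma (in cring) cgenideal_power:
  assumes a [simp]: "a \<in> carrier R"
  shows "(PIdl a) [^]\<^bsub>ideals_set R\<^esub> (n::nat) = PIdl (a [^] n)"
proof (induction n)
  case 0
  have "x \<in> PIdl \<one>" if "x \<in> carrier R" for x
    using that unfolding cgenideal_def by (intro CollectI exI[of _ x]) simp
  then have "PIdl \<one> = carrier R" by (auto simp: cgenideal_def)
  then show ?case by (simp add: nat_pow_def ideals_set_def)
next
  case (Suc n)
  have id: "ideal (PIdl (a [^] n \<otimes> a)) R" by (rule cgenideal_ideal) simp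
  have "(PIdl a) [^]\<^bsub>ideals_set R\<^esub> Suc n = ideal_prod R (PIdl (a [^] n)) (PIdl a)"
    using Suc by (simp add: nat_pow_def ideals_set_def)
  also have "\<dots> = Idl (PIdl (a [^] n) <#> PIdl a)"
    by (rule ideal_prod_eq_genideal) (simp_all add: cgenideal_ideal)
  also have "PIdl (a [^] n) <#> PIdl a = PIdl (a [^] n \<otimes> a)" by (rule cgenideal_prod) simp_all
  also have "Idl \<dots> = \<dots>"
    using genideal_minimal[OF id subset_refl]
      genideal_self[OF additive_subgroup.a_subset[OF ideal.axioms(1)[OF id]]] by blast
  finally show ?case by simp
qed

text \<open>Multiplication by c is injective on a domain and carries (e) onto (ec). With e = c^(p-1)
  and I = (c) this yields the isomorphism of O_L/(c^(p-1)) with I/I^p.\<close>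

lemma (in domain) cgenideal_quotient_isomorphic:
  assumes e: "e \<in> carrier R" and c: "c \<in> carrier R" "c \<noteq> \<zero>"
  shows "module_isomorphic R (quotient_module (ring_as_module R) (PIdl e))
    (quotient_module ((ring_as_module R)\<lparr>carrier := PIdl c\<rparr>) (PIdl (e \<otimes> c)))"
proof -
  let ?M = "ring_as_module R"
  let ?M' = "?M\<lparr>carrier := PIdl c\<rparr>"
  note M = ring_as_module_module
  have sub: "submodule (PIdl x) R ?M" if "x \<in> carrier R" for x
    by (rule ideal_submodule[OF cgenideal_ideal[OF that]])
  have M': "module R ?M'" by (rule submodule.submodule_is_module[OF sub[OF c(1)] M])
  have "r \<otimes> (e \<otimes> c) \<in> PIdl c" if "r \<in> carrier R" for r
    unfolding cgenideal_def using that e c(1)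
    by (intro CollectI exI[of _ "r \<otimes> e"]) (simp add: m_assoc)
  then have "PIdl (e \<otimes> c) \<subseteq> carrier ?M'" unfolding cgenideal_def[of R "e \<otimes> c"] by auto
  moreover have "module R (?M'\<lparr>carrier := PIdl (e \<otimes> c)\<rparr>)"
    using submodule.submodule_is_module[OF sub M, of "e \<otimes> c"] e c(1) by simp
  ultimately have N': "submodule (PIdl (e \<otimes> c)) R ?M'"
    by (rule module.module_incl_imp_submodule[OF M'])
  show ?thesis
  proof (rule quotient_module_isomorphicI[OF M sub[OF e] M' N', where \<phi> = "\<lambda>r. r \<otimes> c"])
    fix x assume "x \<in> carrier ?M"
    then have x: "x \<in> carrier R" by simp
    then show "x \<otimes> c \<in> carrier ?M'" by (auto simp: cgenideal_def)
    have "x \<otimes> c = r \<otimes> (e \<otimes> c) \<longleftrightarrow> x = r \<otimes> e" if r: "r \<in> carrier R" for r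
      using m_rcancel[OF c(2,1), of x "r \<otimes> e"] r x e c(1) by (simp add: m_assoc)
    then show "x \<otimes> c \<in> PIdl (e \<otimes> c) \<longleftrightarrow> x \<in> PIdl e" unfolding cgenideal_def by blast
    show "r \<odot>\<^bsub>?M\<^esub> x \<otimes> c = r \<odot>\<^bsub>?M'\<^esub> (x \<otimes> c)" if "r \<in> carrier R" for r
      using that x c(1) by (simp add: m_assoc)
    fix y assume "y \<in> carrier ?M"
    then show "(x \<oplus>\<^bsub>?M\<^esub> y) \<otimes> c = x \<otimes> c \<oplus>\<^bsub>?M'\<^esub> y \<otimes> c"
      using x c(1) by (simp add: l_distr)
  next
    fix y assume y: "y \<in> carrier ?M'"
    then have "y \<in> PIdl c" by simp
    then obtain r where r: "r \<in> carrier R" "y = r \<otimes> c" unfolding cgenideal_def by blast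
    have "y \<ominus>\<^bsub>?M'\<^esub> r \<otimes> c = \<zero>\<^bsub>?M'\<^esub>"
      unfolding r(2)[symmetric] a_minus_def
      by (rule abelian_group.r_neg[OF module.axioms(2)[OF M'] y])
    moreover have "\<zero>\<^bsub>?M'\<^esub> \<in> PIdl (e \<otimes> c)" by (rule module.sub_zero[OF M' N'])
    ultimately show "\<exists>x\<in>carrier ?M. y \<ominus>\<^bsub>?M'\<^esub> x \<otimes> c \<in> PIdl (e \<otimes> c)"
      using r(1) by (intro bexI[of _ r]) simp_all
  qed
qed

section \<open>Valuation rings\<close>

lemma val_ring_simps [simp]:
  "carrier (val_ring L v) = val_set v (carrier L)"
  "monoid.mult (val_ring L v) = monoid.mult L" "ring.add (val_ring L v) = ring.add L"
  "monoid.one (val_ring L v) = monoid.one L" "ring.zero (val_ring L v) = ring.zero L"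
  by (simp_all add: val_ring_def)

context krull_valuation
begin

abbreviation Ov where "Ov \<equiv> val_set v (carrier L)"
abbreviation Mv where "Mv \<equiv> val_ideal L v"

lemma Ov_iff: "x \<in> Ov \<longleftrightarrow> x \<in> carrier L \<and> 0 \<le> v x"
  by (auto simp: val_set_def)

lemma Mv_iff: "x \<in> Mv \<longleftrightarrow> x \<in> carrier L \<and> 0 < v x"
  by (auto simp: val_ideal_def)

lemma Ov_closed [simp]: "x \<in> Ov \<Longrightarrow> x \<in> carrier L"
  by (simp add: Ov_iff)

lemma Mv_Ov: "x \<in> Mv \<Longrightarrow> x \<in> Ov"
  by (simp add: Ov_iff Mv_iff less_imp_le)

lemma v_zero [simp]: "v \<zero> = Pinf"
  using v_eq_Pinf_iff by simp

lemma v_finite: "x \<in> carrier L \<Longrightarrow> x \<noteq> \<zero> \<Longrightarrow> \<exists>a. v x = Fin a"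
  using v_not_Minf[of x] v_eq_Pinf_iff[of x] by (cases "v x") auto

lemma v_one [simp]: "v \<one> = 0"
proof -
  obtain a where a: "v \<one> = Fin a" using v_finite[of \<one>] by auto
  then show ?thesis using v_mult[of \<one> \<one>] by (simp add: zero_extended_def)
qed

lemma v_minus [simp]:
  assumes "x \<in> carrier L"
  shows "v (\<ominus> x) = v x"
proof -
  obtain a where a: "v (\<ominus> \<one>) = Fin a" using v_finite[of "\<ominus> \<one>"] by (metis a_inv_closed minus_minus minus_zero one_closed one_not_zero)
  have "v (\<ominus> \<one> \<otimes> \<ominus> \<one>) = Fin (a + a)" using v_mult[of "\<ominus> \<one>" "\<ominus> \<one>"] a by simp
  moreover have "\<ominus> \<one> \<otimes> \<ominus> \<one> = \<one>" by (simp add: l_minus)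
  \<comment> \<open>The value satisfies a + a = 0, and a linearly ordered group has no
    2-torsion.\<close>
  ultimately have "a = 0" by (simp add: zero_extended_def)
  then have "v (\<ominus> \<one> \<otimes> x) = v x"
    using v_mult[of "\<ominus> \<one>" x] a assms by (simp flip: zero_extended_def)
  then show ?thesis using assms by (simp add: l_minus)
qed

lemma v_inv:
  assumes "x \<in> carrier L" "x \<noteq> \<zero>" "v x = Fin a"
  shows "v (inv x) = Fin (- a)"
proof -
  have i: "inv x \<in> carrier L" "x \<otimes> inv x = \<one>" using assms by (auto simp: field_Units)
  then have "inv x \<noteq> \<zero>" using assms(1) by auto
  then obtain b where b: "v (inv x) = Fin b" using v_finite i(1) by blast
  have "v (x \<otimes> inv x) = Fin (a + b)" using v_mult[OF assms(1) i(1)] assms(3) b by simp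
  then have "a + b = 0" using i(2) by (simp add: zero_extended_def)
  then show ?thesis using b by (simp add: add_eq_0_iff)
qed

lemma inv_facts:
  assumes "x \<in> carrier L" "x \<noteq> \<zero>"
  shows "inv x \<in> carrier L" "inv x \<noteq> \<zero>" "x \<otimes> inv x = \<one>" "inv x \<otimes> x = \<one>"
proof -
  show i: "inv x \<in> carrier L" "x \<otimes> inv x = \<one>" "inv x \<otimes> x = \<one>" using assms by (auto simp: field_Units)
  then show "inv x \<noteq> \<zero>" using assms(1) by auto
qed

text \<open>Together with the two equivalences that follow, this lets later arguments speak of
  membership in \<open>Ov\<close> and \<open>Mv\<close> and stay clear of arithmetic in the extended
  value group.\<close>

lemma v_le_iff:
  assumes "a \<in> carrier L" "a \<noteq> \<zero>" "b \<in> carrier L"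
  shows "v a \<le> v b \<longleftrightarrow> b \<otimes> inv a \<in> Ov"
proof -
  obtain \<alpha> where \<alpha>: "v a = Fin \<alpha>" using v_finite assms by blast
  have "v (b \<otimes> inv a) = v b + Fin (- \<alpha>)"
    using v_mult[of b "inv a"] v_inv[OF assms(1,2) \<alpha>] inv_facts[OF assms(1,2)] assms(3) by simp
  then show ?thesis
    using v_not_Minf[OF assms(3)] \<alpha> assms inv_facts[OF assms(1,2)]
    by (cases "v b") (auto simp: Ov_iff zero_extended_def)
qed

lemma v_eq_0_iff: "x \<in> carrier L \<Longrightarrow> v x = 0 \<longleftrightarrow> x \<in> Ov \<and> x \<notin> Mv"
  by (auto simp: Ov_iff Mv_iff)

lemma v_neg_iff: "x \<in> carrier L \<Longrightarrow> v x < 0 \<longleftrightarrow> x \<notin> Ov"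
  by (auto simp: Ov_iff)

lemma Ov_subring: "subring Ov L"
proof (rule subringI)
  fix x y assume x: "x \<in> Ov" and y: "y \<in> Ov"
  show "\<ominus> x \<in> Ov" using x by (simp add: Ov_iff)
  show "x \<otimes> y \<in> Ov" using x y v_mult[of x y]
    by (cases "v x"; cases "v y") (auto simp: Ov_iff zero_extended_def)
  show "x \<oplus> y \<in> Ov" using x y v_add[of x y] by (simp add: Ov_iff) (meson min.boundedI order_trans)
qed (auto simp: Ov_iff)

lemmas Ov_simps [simp] = subringE(2,3,5-7)[OF Ov_subring]

lemma Ov_diff [simp]: "x \<in> Ov \<Longrightarrow> y \<in> Ov \<Longrightarrow> x \<ominus> y \<in> Ov"
  by (simp add: a_minus_def)

lemma Ov_pow [simp]: "x \<in> Ov \<Longrightarrow> x [^] (n::nat) \<in> Ov"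
  by (induction n) auto

lemma Ov_finsum: "finite A \<Longrightarrow> (\<And>i. i \<in> A \<Longrightarrow> f i \<in> Ov) \<Longrightarrow> (\<Oplus>i\<in>A. f i) \<in> Ov"
  by (induction A rule: finite_induct) (auto simp: Pi_def)

lemma Mv_zero [simp]: "\<zero> \<in> Mv"
  by (simp add: Mv_iff zero_extended_def)

lemma Mv_one [simp]: "\<one> \<notin> Mv"
  by (simp add: Mv_iff)

lemma Mv_minus: "x \<in> Mv \<Longrightarrow> \<ominus> x \<in> Mv"
  by (simp add: Mv_iff)

lemma Mv_add: "x \<in> Mv \<Longrightarrow> y \<in> Mv \<Longrightarrow> x \<oplus> y \<in> Mv"
  using v_add[of x y] by (auto simp: Mv_iff min_def split: if_splits)

lemma Mv_mult: "x \<in> Ov \<Longrightarrow> y \<in> Mv \<Longrightarrow> x \<otimes> y \<in> Mv"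
  using v_mult[of x y] v_not_Minf[of x] v_not_Minf[of y]
  by (cases "v x"; cases "v y") (auto simp: Mv_iff Ov_iff zero_extended_def add_nonneg_pos)

lemma Mv_mult2: "x \<in> Mv \<Longrightarrow> y \<in> Ov \<Longrightarrow> x \<otimes> y \<in> Mv"
  using Mv_mult[of y x] by (simp add: m_comm Mv_iff)

lemma Mv_diff: "x \<in> Mv \<Longrightarrow> y \<in> Mv \<Longrightarrow> x \<ominus> y \<in> Mv"
  by (simp add: a_minus_def Mv_add Mv_minus)

lemma Ov_unit_inv:
  assumes "x \<in> Ov" "x \<notin> Mv"
  shows "x \<noteq> \<zero>" "inv x \<in> Ov" "inv x \<notin> Mv"
proof -
  show x: "x \<noteq> \<zero>" using assms(2) by auto
  have "v x = 0" using v_eq_0_iff[of x] assms by simp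
  then have "v (inv x) = 0" using v_inv[of x 0] x assms by (simp add: zero_extended_def)
  then show "inv x \<in> Ov" "inv x \<notin> Mv" using v_eq_0_iff[of "inv x"] inv_facts[OF _ x] assms by auto
qed

lemma inv_in_Mv:
  assumes "x \<in> carrier L" "x \<notin> Ov"
  shows "x \<noteq> \<zero>" "inv x \<in> Mv"
proof -
  show x: "x \<noteq> \<zero>" using assms(2) by auto
  obtain a where a: "v x = Fin a" using v_finite x assms by blast
  then show "inv x \<in> Mv" using v_inv[OF assms(1) x a] inv_facts[OF assms(1) x] assms
    by (auto simp: Ov_iff Mv_iff zero_extended_def)
qed

text \<open>Otherwise x is a unit of O_L, and cancelling it repeatedly from the power would put 1
  into the maximal ideal.\<close>

lemma Mv_power_imp: "x \<in> Ov \<Longrightarrow> x [^] (n::nat) \<in> Mv \<Longrightarrow> x \<in> Mv"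
proof (rule ccontr, induction n)
  case (Suc n)
  then have "x [^] n \<otimes> x \<otimes> inv x \<in> Mv" using Ov_unit_inv[of x] by (auto intro: Mv_mult2)
  moreover have "x [^] n \<otimes> x \<otimes> inv x = x [^] n"
    using Suc Ov_unit_inv[of x] inv_facts[of x] by (simp add: m_assoc)
  ultimately show ?case using Suc by simp
qed simp

text \<open>Otherwise \<open>inv x\<close> lies in the maximal ideal, and so would the product of
  \<open>inv x [^] n\<close> with the integral \<open>x [^] n\<close>, which is 1.\<close>

lemma Ov_power_imp:
  assumes "x \<in> carrier L" "x [^] (n::nat) \<in> Ov" "n > 0"
  shows "x \<in> Ov"
proof (rule ccontr)
  assume x: "x \<notin> Ov"
  note i = inv_in_Mv[OF assms(1) x]
  have "inv x [^] n \<otimes> x [^] n \<in> Mv"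
  proof (rule Mv_mult2[OF _ assms(2)])
    obtain m where "n = Suc m" using assms(3) by (cases n) auto
    then show "inv x [^] n \<in> Mv" using i Mv_Ov[OF i(2)] by (auto intro: Mv_mult)
  qed
  moreover have "inv x [^] n \<otimes> x [^] n = \<one>"
    using inv_facts[OF assms(1) i(1)] assms(1) by (simp flip: nat_pow_distrib)
  ultimately show False by simp
qed

lemma val_cring: "cring (val_ring L v)"
  unfolding val_ring_def using subcring_iff[of Ov] subcringI'[OF Ov_subring] subringE(1)[OF Ov_subring] by auto

lemma val_domain: "domain (val_ring L v)"
  unfolding val_ring_def using subring_is_domain[OF Ov_subring] .

text \<open>An additive inverse is defined by a description over the carrier, which
  \<open>val_ring\<close> shrinks; on \<open>Ov\<close> the two descriptions agree.\<close>

lemma val_a_inv: "x \<in> Ov \<Longrightarrow> \<ominus>\<^bsub>val_ring L v\<^esub> x = \<ominus> x"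
  using add.m_inv_consistent[OF subring.axioms(1)[OF Ov_subring]]
  by (simp add: a_inv_def val_ring_def)

lemma val_minus: "x \<in> Ov \<Longrightarrow> y \<in> Ov \<Longrightarrow> x \<ominus>\<^bsub>val_ring L v\<^esub> y = x \<ominus> y"
  by (simp add: a_minus_def val_a_inv)

lemma val_pow: "x [^]\<^bsub>val_ring L v\<^esub> (n::nat) = x [^] n"
  by (simp add: nat_pow_def)

section \<open>The maximal ideal, the residue field and the residue map\<close>

lemma Mv_ideal: "ideal Mv (val_ring L v)"
proof -
  interpret O: cring "val_ring L v" by (rule val_cring)
  show ?thesis
  proof (rule idealI)
    have "Mv \<noteq> {}" using Mv_zero by blast
    then show "subgroup Mv (add_monoid (val_ring L v))"
      by (intro O.add.subgroupI)
        (use val_a_inv Mv_Ov Mv_minus Mv_add Mv_zero in \<open>auto simp flip: a_inv_def\<close>)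
  qed (auto simp: Mv_mult Mv_mult2 O.ring_axioms)
qed

text \<open>An integral element outside \<open>Mv\<close> is a unit of O_L, so a proper ideal cannot
  contain one.\<close>

lemma Mv_maximal: "maximalideal Mv (val_ring L v)"
proof (rule maximalidealI[OF Mv_ideal])
  show "carrier (val_ring L v) \<noteq> Mv" using Mv_one by fastforce
  fix J assume J: "ideal J (val_ring L v)" "Mv \<subseteq> J" "J \<subseteq> carrier (val_ring L v)"
  show "J = Mv \<or> J = carrier (val_ring L v)"
  proof (rule disjCI)
    assume "J \<noteq> carrier (val_ring L v)"
    then have one: "\<one> \<notin> J" using ideal.one_imp_carrier[OF J(1)] by auto
    have "x \<in> Mv" if x: "x \<in> J" for x
    proof (rule ccontr)
      assume xM: "x \<notin> Mv"
      have xO: "x \<in> Ov" using x J(3) by auto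
      have "x \<otimes> inv x \<in> J" using ideal.I_r_closed[OF J(1) x, of "inv x"] Ov_unit_inv[OF xO xM] by simp
      then show False using one inv_facts[of x] Ov_unit_inv[OF xO xM] xO by simp
    qed
    then show "J = Mv" using J(2) by blast
  qed
qed

lemma residue_field_field: "field (residue_field L v)"
  unfolding residue_field_def by (rule maximalideal.quotient_is_field[OF Mv_maximal val_cring])

lemma residue_hom: "ring_hom_ring (val_ring L v) (residue_field L v) (residue L v)"
  unfolding residue_field_def residue_def[abs_def] by (rule ideal.rcos_ring_hom_ring[OF Mv_ideal])

lemma residue_surj: "carrier (residue_field L v) = residue L v ` Ov"
  by (auto simp: residue_field_def FactRing_def A_RCOSETS_defs residue_def a_r_coset_def r_coset_def RCOSETS_def)

lemma residue_eq_iff: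
  assumes "x \<in> Ov" "y \<in> Ov"
  shows "residue L v x = residue L v y \<longleftrightarrow> x \<ominus> y \<in> Mv"
proof -
  interpret O: cring "val_ring L v" by (rule val_cring)
  show ?thesis
    using O.quotient_eq_iff_same_a_r_cos[OF Mv_ideal, of x y] assms
    by (simp add: residue_def val_minus)
qed

lemma residue_zero_iff: "x \<in> Ov \<Longrightarrow> residue L v x = \<zero>\<^bsub>residue_field L v\<^esub> \<longleftrightarrow> x \<in> Mv"
proof -
  assume x: "x \<in> Ov"
  interpret h: ring_hom_ring "val_ring L v" "residue_field L v" "residue L v" by (rule residue_hom)
  have "residue L v \<zero> = \<zero>\<^bsub>residue_field L v\<^esub>" using h.hom_zero by simp
  moreover have "x \<ominus> \<zero> = x" using x by (simp add: a_minus_def)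
  ultimately show ?thesis using residue_eq_iff[OF x Ov_simps(1)] by simp
qed

lemma val_set_subring:
  assumes "subring K L"
  shows "subring (val_set v K) (val_ring L v)"
proof -
  have eq: "val_set v K = K \<inter> Ov"
    using subringE(1)[OF assms] unfolding val_set_def by blast
  have "subring (K \<inter> Ov) L" by (rule subring_inter[OF assms Ov_subring])
  note S = subringE[OF this]
  show ?thesis
    unfolding eq
  proof (rule ring.subringI[OF cring.axioms(1)[OF val_cring]])
    show "\<ominus>\<^bsub>val_ring L v\<^esub> h \<in> K \<inter> Ov" if "h \<in> K \<inter> Ov" for h
      using S(5)[OF that] val_a_inv[of h] that by simp
  qed (use S in simp_all)
qed

lemma residue_subring:
  assumes "subring K L"
  shows "subring (residue_subfield L v K) (residue_field L v)"
  unfolding residue_subfield_def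
  by (rule ring_hom_ring.img_is_subring[OF residue_hom val_set_subring[OF assms]])

lemma residue_subfield:
  assumes "subfield K L"
  shows "subfield (residue_subfield L v K) (residue_field L v)"
proof (rule field.subfieldI'[OF residue_field_field residue_subring[OF subfieldE(1)[OF assms]]])
  interpret h: ring_hom_ring "val_ring L v" "residue_field L v" "residue L v" by (rule residue_hom)
  interpret k: field "residue_field L v" by (rule residue_field_field)
  fix k assume k: "k \<in> residue_subfield L v K - {\<zero>\<^bsub>residue_field L v\<^esub>}"
  then obtain x where x: "x \<in> K" "0 \<le> v x" "k = residue L v x"
    unfolding residue_subfield_def val_set_def by blast
  have xO: "x \<in> Ov" using x subfieldE(3)[OF assms] by (auto simp: Ov_iff)
  have xM: "x \<notin> Mv" using residue_zero_iff[OF xO] k x(3) by simp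
  note i = Ov_unit_inv[OF xO xM]
  have iK: "inv x \<in> K" using subfield_m_inv(1)[OF assms, of x] x(1) i(1) by blast
  have "residue L v x \<otimes>\<^bsub>residue_field L v\<^esub> residue L v (inv x) = \<one>\<^bsub>residue_field L v\<^esub>"
    using h.hom_mult[of x "inv x"] h.hom_one xO i(2) inv_facts[OF Ov_closed[OF xO] i(1)] by simp
  then have "inv\<^bsub>residue_field L v\<^esub> k = residue L v (inv x)"
    using k.comm_inv_char[of k "residue L v (inv x)"] x(3) xO i(2) h.hom_closed by simp
  then show "inv\<^bsub>residue_field L v\<^esub> k \<in> residue_subfield L v K"
    using iK i(2) unfolding residue_subfield_def val_set_def by simp
qed

lemma Mv_pow: "x \<in> Mv \<Longrightarrow> 0 < n \<Longrightarrow> x [^] (n::nat) \<in> Mv"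
proof (induction n)
  case (Suc n)
  have "x [^] n \<in> Ov" using Mv_Ov[OF Suc(2)] by simp
  then show ?case using Mv_mult[of "x [^] n" x] Suc(2) by simp
qed simp

lemma Ov_add_pow: "x \<in> Ov \<Longrightarrow> [(n::nat)] \<cdot> x \<in> Ov"
  by (induction n) simp_all

lemma Mv_add_pow: "x \<in> Mv \<Longrightarrow> [(n::nat)] \<cdot> x \<in> Mv"
  by (induction n) (simp_all add: Mv_add)

abbreviation k where "k \<equiv> residue_field L v"
abbreviation res where "res \<equiv> residue L v"

lemma residue_cring: "cring k"
  using residue_field_field by (simp add: field_def domain_def)

lemma res_closed: "x \<in> Ov \<Longrightarrow> res x \<in> carrier k"
  using residue_surj by simp

lemma res_add: "x \<in> Ov \<Longrightarrow> y \<in> Ov \<Longrightarrow> res (x \<oplus> y) = res x \<oplus>\<^bsub>k\<^esub> res y"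
  using ring_hom_add[OF ring_hom_ring.homh[OF residue_hom], of x y] by simp

lemma res_mult: "x \<in> Ov \<Longrightarrow> y \<in> Ov \<Longrightarrow> res (x \<otimes> y) = res x \<otimes>\<^bsub>k\<^esub> res y"
  using ring_hom_mult[OF ring_hom_ring.homh[OF residue_hom], of x y] by simp

lemma res_one: "res \<one> = \<one>\<^bsub>k\<^esub>"
  using ring_hom_one[OF ring_hom_ring.homh[OF residue_hom]] by simp

lemma res_zero: "res \<zero> = \<zero>\<^bsub>k\<^esub>"
  by (simp add: residue_zero_iff)

lemma res_pow: "x \<in> Ov \<Longrightarrow> res (x [^] (n::nat)) = res x [^]\<^bsub>k\<^esub> n"
proof (induction n)
  case 0
  then show ?case by (simp add: nat_pow_def res_one)
next
  case (Suc n)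
  interpret k: cring k by (rule residue_cring)
  show ?case using Suc res_mult[of "x [^] n" x] by simp
qed

lemma res_finsum:
  assumes "finite A" "\<And>i. i \<in> A \<Longrightarrow> f i \<in> Ov"
  shows "res (\<Oplus>i\<in>A. f i) = (\<Oplus>\<^bsub>k\<^esub>i\<in>A. res (f i))"
  using assms
proof (induction A rule: finite_induct)
  case empty
  interpret k: cring k by (rule residue_cring)
  show ?case by (simp add: res_zero)
next
  case (insert a A)
  interpret k: cring k by (rule residue_cring)
  have "(\<Oplus>i\<in>insert a A. f i) = f a \<oplus> (\<Oplus>i\<in>A. f i)"
    using insert by (subst finsum_insert) auto
  moreover have "(\<Oplus>\<^bsub>k\<^esub>i\<in>insert a A. res (f i)) = res (f a) \<oplus>\<^bsub>k\<^esub> (\<Oplus>\<^bsub>k\<^esub>i\<in>A. res (f i))"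
    using insert res_closed by (intro k.finsum_insert) auto
  moreover have "res (f a \<oplus> (\<Oplus>i\<in>A. f i)) = res (f a) \<oplus>\<^bsub>k\<^esub> res (\<Oplus>i\<in>A. f i)"
    using insert Ov_finsum[of A f] by (intro res_add) auto
  ultimately show ?case using insert by simp
qed

lemma res_lincomb:
  fixes n :: nat
  assumes "x \<in> Ov" "\<And>i. i < n \<Longrightarrow> a i \<in> Ov"
  shows "res (\<Oplus>i\<in>{..<n}. a i \<otimes> x [^] i) = (\<Oplus>\<^bsub>k\<^esub>i\<in>{..<n}. res (a i) \<otimes>\<^bsub>k\<^esub> res x [^]\<^bsub>k\<^esub> i)"
proof -
  interpret k: cring k by (rule residue_cring)
  have "res (\<Oplus>i\<in>{..<n}. a i \<otimes> x [^] i) = (\<Oplus>\<^bsub>k\<^esub>i\<in>{..<n}. res (a i \<otimes> x [^] i))"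
    using assms by (intro res_finsum) auto
  also have "\<dots> = (\<Oplus>\<^bsub>k\<^esub>i\<in>{..<n}. res (a i) \<otimes>\<^bsub>k\<^esub> res x [^]\<^bsub>k\<^esub> i)"
    using assms res_closed by (intro k.finsum_cong') (auto simp: res_mult res_pow)
  finally show ?thesis .
qed

text \<open>Bridges two viewpoints: the generation statement \<open>Ov_subset_subring\<close> is
  about subrings of L, the theory of differentials about subrings of
  \<open>val_ring L v\<close>.\<close>

lemma val_subring_L:
  assumes "subring S (val_ring L v)"
  shows "subring S L"
proof -
  note E = subringE[OF assms]
  have S: "S \<subseteq> Ov" using E(1) by simp
  show ?thesis
  proof (rule subringI)
    show "S \<subseteq> carrier L" using S Ov_closed by blast
    show "\<one> \<in> S" using E(3) by simp
    show "\<ominus> h \<in> S" if "h \<in> S" for h using E(5)[OF that] val_a_inv[of h] S that by auto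
    show "h \<otimes> h' \<in> S" if "h \<in> S" "h' \<in> S" for h h' using E(6)[OF that] by simp
    show "h \<oplus> h' \<in> S" if "h \<in> S" "h' \<in> S" for h h' using E(7)[OF that] by simp
  qed
qed

section \<open>Ideals of the valuation ring, written with the operations of L\<close>

lemma PIdl_iff: "x \<in> PIdl\<^bsub>val_ring L v\<^esub> e \<longleftrightarrow> (\<exists>r\<in>Ov. x = r \<otimes> e)"
  unfolding cgenideal_def by auto

lemma PIdl_I: "r \<in> Ov \<Longrightarrow> r \<otimes> e \<in> PIdl\<^bsub>val_ring L v\<^esub> e"
  unfolding PIdl_iff by blast

context
  fixes I assumes I: "ideal I (val_ring L v)"
begin

lemma ideal_Ov: "x \<in> I \<Longrightarrow> x \<in> Ov"
  using ideal.Icarr[OF I] by simp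

lemma ideal_zero: "\<zero> \<in> I"
  using additive_subgroup.zero_closed[OF ideal.axioms(1)[OF I]] by simp

lemma ideal_add: "x \<in> I \<Longrightarrow> y \<in> I \<Longrightarrow> x \<oplus> y \<in> I"
  using additive_subgroup.a_closed[OF ideal.axioms(1)[OF I], of x y] by simp

lemma ideal_minus: "x \<in> I \<Longrightarrow> \<ominus> x \<in> I"
  using additive_subgroup.a_inv_closed[OF ideal.axioms(1)[OF I], of x] val_a_inv[OF ideal_Ov] by simp

lemma ideal_diff: "x \<in> I \<Longrightarrow> y \<in> I \<Longrightarrow> x \<ominus> y \<in> I"
  by (simp add: a_minus_def ideal_add ideal_minus)

lemma ideal_mult: "r \<in> Ov \<Longrightarrow> x \<in> I \<Longrightarrow> r \<otimes> x \<in> I"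
  using ideal.I_l_closed[OF I, of x r] by simp

lemma ideal_mult2: "x \<in> I \<Longrightarrow> r \<in> Ov \<Longrightarrow> x \<otimes> r \<in> I"
  using ideal.I_r_closed[OF I, of x r] by simp

lemma ideal_finsum: "finite A \<Longrightarrow> (\<And>i. i \<in> A \<Longrightarrow> f i \<in> I) \<Longrightarrow> (\<Oplus>i\<in>A. f i) \<in> I"
proof (induction A rule: finite_induct)
  case (insert a A)
  have "(\<Oplus>i\<in>insert a A. f i) = f a \<oplus> (\<Oplus>i\<in>A. f i)"
    using insert ideal_Ov Ov_closed by (intro finsum_insert) blast+
  then show ?case using insert ideal_add by simp
qed (simp add: ideal_zero)

end

end

section \<open>Residually inseparable Artin-Schreier extensions\<close>

lemma (in field) artin_schreier_prime_degree_extension: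
  assumes "artin_schreier_extension p R K"
  shows "prime_degree_extension R K p" and "[p] \<cdot> \<one> = \<zero>"
proof -
  have K: "subfield K R" and dim: "dimension p K (carrier R)"
    using assms unfolding artin_schreier_extension_def finite_galois_extension_def by blast+
  have "p = ring_char R" "p > 0"
    using assms ring_char_subring[OF subfieldE(1)[OF K]]
    by (auto simp: artin_schreier_extension_def)
  then have p: "Factorial_Ring.prime p" "[p] \<cdot> \<one> = \<zero>" using ring_char_prime by auto
  show "prime_degree_extension R K p"
    by (rule prime_degree_extension.intro[OF field_axioms
          prime_degree_extension_axioms.intro[OF K dim p(1)]])
  show "[p] \<cdot> \<one> = \<zero>" by (rule p(2))
qed

locale residually_inseparable = krull_valuation L v
  for L (structure) and v +
  fixes K and p :: nat
  assumes artin_schreier: "artin_schreier_extension p L K"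
    and residue_dim: "ring.dimension (residue_field L v) p (residue_subfield L v K)
      (carrier (residue_field L v))"
    and residue_insep: "inseparable_extension (residue_field L v) (residue_subfield L v K)"
begin

lemma ext: "prime_degree_extension L K p" and p_one: "[p] \<cdot> \<one> = \<zero>"
  using artin_schreier_prime_degree_extension[OF artin_schreier] by blast+

lemmas K_subfield = prime_degree_extension.K[OF ext]
lemmas K_subset = prime_degree_extension.K_subset[OF ext]
lemmas K_closed [simp] = prime_degree_extension.K_closed[OF ext]
lemmas K_simps [simp] = prime_degree_extension.K_simps[OF ext]
lemmas K_intros [simp] = prime_degree_extension.K_intros[OF ext]
lemmas K_diff [simp] = prime_degree_extension.K_diff[OF ext]
lemmas K_inv = prime_degree_extension.K_inv[OF ext]
lemmas K_pow = prime_degree_extension.K_pow[OF ext]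
lemmas K_add_pow = prime_degree_extension.K_add_pow[OF ext]
lemmas prime_p = prime_degree_extension.prime_p[OF ext]
lemmas power_basis_ex = prime_degree_extension.power_basis_ex[OF ext]
lemmas power_basis_unique = prime_degree_extension.power_basis_unique[OF ext]
lemmas no_intermediate_field = prime_degree_extension.no_intermediate_field[OF ext]

abbreviation Kv where "Kv \<equiv> residue_subfield L v K"

lemma residue_extension: "prime_degree_extension k Kv p"
  by (rule prime_degree_extension.intro[OF residue_field_field
        prime_degree_extension_axioms.intro[OF residue_subfield[OF K_subfield] residue_dim prime_p]])

lemma val_set_K: "x \<in> val_set v K \<longleftrightarrow> x \<in> K \<and> x \<in> Ov"
  using K_subset unfolding val_set_def by blast

lemma val_set_K_subset: "val_set v K \<subseteq> carrier L"
  using K_subset unfolding val_set_def by blast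

section \<open>Residual generators and the valuation basis of their powers\<close>

definition residual_generator where
  "residual_generator x \<longleftrightarrow> x \<in> Ov \<and> res x \<notin> Kv"

lemma residual_generator_closed:
  assumes "residual_generator x"
  shows "x \<in> Ov" "x \<in> carrier L" "res x \<in> carrier k" "res x \<notin> Kv" "x \<notin> K"
proof -
  show x: "x \<in> Ov" and r: "res x \<notin> Kv" using assms by (auto simp: residual_generator_def)
  then show "x \<in> carrier L" by simp
  show "res x \<in> carrier k" using res_closed x by simp
  show "x \<notin> K"
  proof
    assume "x \<in> K"
    then have "res x \<in> Kv"
      unfolding residue_subfield_def using x by (intro imageI) (simp add: val_set_K)
    then show False using r by simp
  qed
qed

text \<open>As Lv|Kv has prime degree, every residue outside Kv generates it. That the p-th power of
  the residue lies in Kv is a property of a suitable choice, provided by inseparability, and is what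
  later forces automorphisms to act trivially on Lv. The relation p = 0 passes from L to the residue
  field through the residue map.\<close>

lemma ex_residual_generator: "\<exists>x. residual_generator x \<and> res (x [^] p) \<in> Kv"
proof -
  have "res ([n] \<cdot> \<one>) = [n] \<cdot>\<^bsub>k\<^esub> \<one>\<^bsub>k\<^esub> \<and> [n] \<cdot> \<one> \<in> Ov" for n :: nat
    by (induction n) (simp_all add: res_zero res_one res_add add_pow_def nat_pow_def)
  then have "[p] \<cdot>\<^bsub>k\<^esub> \<one>\<^bsub>k\<^esub> = \<zero>\<^bsub>k\<^esub>"
    using p_one res_zero by metis
  then obtain \<xi> where \<xi>: "\<xi> \<in> carrier k" "\<xi> \<notin> Kv" "\<xi> [^]\<^bsub>k\<^esub> p \<in> Kv"
    using prime_degree_extension.inseparable_ex[OF residue_extension residue_insep] by blast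
  then obtain x where "x \<in> Ov" "\<xi> = res x" unfolding residue_surj by blast
  then show ?thesis using \<xi> res_pow[of x p] by (auto simp: residual_generator_def)
qed

text \<open>Taking residues gives a linear relation over Kv between the first p powers of the
  residue of x, which are independent.\<close>

lemma combination_in_Mv:
  assumes x: "residual_generator x"
    and a: "\<And>i. i < p \<Longrightarrow> a i \<in> K" "\<And>i. i < p \<Longrightarrow> a i \<in> Ov"
    and M: "(\<Oplus>i\<in>{..<p}. a i \<otimes> x [^] i) \<in> Mv" and i: "i < p"
  shows "a i \<in> Mv"
proof -
  note xg = residual_generator_closed[OF x]
  have "(\<Oplus>\<^bsub>k\<^esub>i\<in>{..<p}. res (a i) \<otimes>\<^bsub>k\<^esub> res x [^]\<^bsub>k\<^esub> i) = \<zero>\<^bsub>k\<^esub>"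
    using residue_zero_iff[OF Mv_Ov[OF M]] M res_lincomb[OF xg(1) a(2)] by simp
  moreover have aKv: "res (a i) \<in> Kv" if "i < p" for i
    using a[OF that] by (simp add: residue_subfield_def val_set_K)
  ultimately have "res (a i) = \<zero>\<^bsub>k\<^esub>"
    by (intro prime_degree_extension.power_basis_unique[OF residue_extension xg(3,4),
          where a = "\<lambda>i. res (a i)"] aKv i)
  then show ?thesis using residue_zero_iff[OF a(2)[OF i]] by simp
qed

text \<open>The powers of a residual generator are a valuation basis: the value of a combination is
  the least value of its coefficients, attained at \<open>j\<close> below.\<close>

lemma combination_value:
  assumes x: "residual_generator x"
    and a: "\<And>i. i < p \<Longrightarrow> a i \<in> K"
    and b: "b = (\<Oplus>i\<in>{..<p}. a i \<otimes> x [^] i)" "b \<noteq> \<zero>"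
  shows "\<exists>j<p. a j \<noteq> \<zero> \<and> b \<otimes> inv (a j) \<in> Ov \<and> b \<otimes> inv (a j) \<notin> Mv \<and>
    (\<forall>i<p. a i \<otimes> inv (a j) \<in> Ov)"
proof -
  note xg = residual_generator_closed[OF x]
  have p0: "0 < p" using prime_gt_0_nat[OF prime_p] .
  have ac: "a i \<in> carrier L" if "i < p" for i using a[OF that] by simp
  let ?V = "(\<lambda>i. v (a i)) ` {..<p}"
  have "Min ?V \<in> ?V" using p0 by (intro Min_in) auto
  then obtain j where "Min ?V = v (a j)" "j \<in> {..<p}" by (rule imageE)
  then have j: "j < p" "v (a j) = Min ?V" by simp_all
  have min: "v (a j) \<le> v (a i)" if "i < p" for i
    unfolding j(2) using that by (intro Min_le) auto
  have a0: "a j \<noteq> \<zero>"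
  proof
    assume "a j = \<zero>"
    then have "v (a i) = Pinf" if "i < p" for i using min[OF that] by simp
    then have z: "a i = \<zero>" if "i < p" for i using v_eq_Pinf_iff ac that by blast
    have "(\<Oplus>i\<in>{..<p}. a i \<otimes> x [^] i) = (\<Oplus>i\<in>{..<p}. \<zero>)"
      by (rule finsum_cong') (use z xg(2) in auto)
    then show False using b by simp
  qed
  note i = inv_facts[OF ac[OF j(1)] a0]
  have iK: "inv (a j) \<in> K" using K_inv[OF a[OF j(1)] a0] .
  have O: "a i \<otimes> inv (a j) \<in> Ov" if "i < p" for i
    using v_le_iff[OF ac[OF j(1)] a0 ac[OF that]] min[OF that] by simp
  have "b \<otimes> inv (a j) = (\<Oplus>i\<in>{..<p}. a i \<otimes> x [^] i \<otimes> inv (a j))"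
    unfolding b(1) by (rule finsum_ldistr) (use ac xg(2) i(1) in auto)
  also have "\<dots> = (\<Oplus>i\<in>{..<p}. a i \<otimes> inv (a j) \<otimes> x [^] i)"
    by (rule finsum_cong') (use ac xg(2) i(1) in \<open>auto simp: m_ac\<close>)
  finally have eq: "b \<otimes> inv (a j) = (\<Oplus>i\<in>{..<p}. a i \<otimes> inv (a j) \<otimes> x [^] i)" .
  have 1: "b \<otimes> inv (a j) \<in> Ov"
    unfolding eq by (rule Ov_finsum) (use O xg(1) in auto)
  \<comment> \<open>After division by a coefficient of least value all coefficients are integral and
    the j-th one is 1, so the residue of the combination cannot vanish.\<close>
  have 2: "b \<otimes> inv (a j) \<notin> Mv"
  proof
    assume "b \<otimes> inv (a j) \<in> Mv"
    then have "a j \<otimes> inv (a j) \<in> Mv"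
      unfolding eq using O a iK j(1)
      by (intro combination_in_Mv[OF x, where a = "\<lambda>i. a i \<otimes> inv (a j)"]) auto
    then show False using i(3) by simp
  qed
  show ?thesis using j(1) a0 1 2 O by blast
qed

text \<open>If the coefficient \<open>a j\<close> of least value were not integral, its inverse
  would lie in \<open>Mv\<close>, and so would \<open>b \<otimes> inv (a j)\<close>, which is a unit
  of O_L.\<close>

lemma combination_integral:
  assumes x: "residual_generator x"
    and a: "\<And>i. i < p \<Longrightarrow> a i \<in> K"
    and b: "b = (\<Oplus>i\<in>{..<p}. a i \<otimes> x [^] i)" "b \<in> Ov"
    and i: "i < p"
  shows "a i \<in> Ov"
proof (cases "b = \<zero>")
  case True
  then have "(\<Oplus>i\<in>{..<p}. a i \<otimes> x [^] i) = \<zero>" using b(1) by simp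
  from power_basis_unique[OF residual_generator_closed(2,5)[OF x] a this i]
  show ?thesis by simp
next
  case False
  obtain j where j: "j < p" "a j \<noteq> \<zero>" "b \<otimes> inv (a j) \<in> Ov" "b \<otimes> inv (a j) \<notin> Mv"
    "\<forall>i<p. a i \<otimes> inv (a j) \<in> Ov"
    using combination_value[OF x a b(1) False] by auto
  have aj: "a j \<in> carrier L" and ai: "a i \<in> carrier L" using a j(1) i by auto
  note inv = inv_facts[OF aj j(2)]
  have "a j \<in> Ov"
  proof (rule ccontr)
    assume "a j \<notin> Ov"
    then have "b \<otimes> inv (a j) \<in> Mv" using inv_in_Mv[OF aj] b(2) by (intro Mv_mult) auto
    then show False using j(4) by simp
  qed
  then have "a i \<otimes> inv (a j) \<otimes> a j \<in> Ov" using j(5) i by simp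
  moreover have "a i \<otimes> inv (a j) \<otimes> a j = a i" using ai aj inv by (simp add: m_assoc)
  ultimately show ?thesis by simp
qed

text \<open>The equality vL = vK in multiplicative form; c is the inverse of a coefficient of least
  value.\<close>

lemma value_group:
  assumes "b \<in> carrier L" "b \<noteq> \<zero>"
  shows "\<exists>c\<in>K. c \<noteq> \<zero> \<and> b \<otimes> c \<in> Ov \<and> b \<otimes> c \<notin> Mv"
proof -
  obtain x where x: "residual_generator x" using ex_residual_generator by blast
  note xg = residual_generator_closed[OF x]
  obtain a where a: "\<forall>i. a i \<in> K" "b = (\<Oplus>i\<in>{..<p}. a i \<otimes> x [^] i)"
    using power_basis_ex[OF xg(2,5) assms(1)] by blast
  have aK: "a i \<in> K" for i using a(1) by blast
  obtain j where j: "j < p" "a j \<noteq> \<zero>" "b \<otimes> inv (a j) \<in> Ov" "b \<otimes> inv (a j) \<notin> Mv"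
    using combination_value[OF x aK a(2) assms(2)] by auto
  show ?thesis
  proof (intro bexI conjI)
    show "inv (a j) \<in> K" using K_inv[OF aK j(2)] .
    show "inv (a j) \<noteq> \<zero>" using inv_facts(2)[OF _ j(2)] aK by simp
  qed (use j in auto)
qed

text \<open>The working form of O_L = O_K[x], valid because integral elements have integral
  coefficients: a property stable under the ring operations needs to be checked only on O_K and at
  x.\<close>

lemma Ov_subset_subring:
  assumes x: "residual_generator x"
    and S: "subring S L" "x \<in> S" "val_set v K \<subseteq> S"
  shows "Ov \<subseteq> S"
proof
  fix b assume b: "b \<in> Ov"
  note xg = residual_generator_closed[OF x]
  note SR = subringE[OF S(1)]
  obtain a where a: "\<forall>i. a i \<in> K" "b = (\<Oplus>i\<in>{..<p}. a i \<otimes> x [^] i)"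
    using power_basis_ex[OF xg(2,5) Ov_closed[OF b]] by blast
  have aO: "a i \<in> Ov" if "i < p" for i
    by (rule combination_integral[OF x _ a(2) b that]) (use a(1) in blast)
  have pow: "x [^] (i::nat) \<in> S" for i
    by (induction i) (simp_all add: SR(3) SR(6)[OF _ S(2)])
  have "(\<Oplus>i\<in>{..<n}. a i \<otimes> x [^] i) \<in> S" if "n \<le> p" for n
    using that
  proof (induction n)
    case (Suc n)
    have "a n \<in> val_set v K" using a(1) aO[of n] Suc(2) by (simp add: val_set_K)
    then have 1: "a n \<otimes> x [^] n \<in> S" using SR(6)[OF _ pow] S(3) by blast
    have "a i \<otimes> x [^] i \<in> carrier L" for i using a(1) xg(2) by simp
    then have "(\<Oplus>i\<in>{..<Suc n}. a i \<otimes> x [^] i) = a n \<otimes> x [^] n \<oplus> (\<Oplus>i\<in>{..<n}. a i \<otimes> x [^] i)"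
      unfolding lessThan_Suc by (subst finsum_insert) auto
    then show ?case using SR(7)[OF 1 Suc(1)] Suc(2) by simp
  qed (simp add: SR(2))
  then show "b \<in> S" using a(2) by simp
qed

lemma Ov_generated:
  assumes "residual_generator x"
  shows "Ov = generate_ring L (insert x (val_set v K))"
proof
  note xg = residual_generator_closed[OF assms]
  have sub: "insert x (val_set v K) \<subseteq> carrier L" using xg(2) val_set_K_subset by simp
  show "Ov \<subseteq> generate_ring L (insert x (val_set v K))"
    using generate_ring_is_subring[OF sub]
    by (intro Ov_subset_subring[OF assms]) (auto intro: generate_ring.incl)
  show "generate_ring L (insert x (val_set v K)) \<subseteq> Ov"
    using xg(1) by (intro generate_ring_min_subring1[OF sub Ov_subring]) (auto simp: val_set_K)
qed

lemma residue_field_generated: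
  assumes "residual_generator x"
  shows "carrier k = generate_field k (insert (res x) Kv)"
proof -
  note k = residue_extension
  note xg = residual_generator_closed[OF assms]
  have sub: "insert (res x) Kv \<subseteq> carrier k" using xg(3) prime_degree_extension.K_subset[OF k] by simp
  have incl: "insert (res x) Kv \<subseteq> generate_field k (insert (res x) Kv)"
    by (rule subsetI) (rule generate_field.incl)
  have "generate_field k (insert (res x) Kv) = carrier k"
  proof (rule prime_degree_extension.no_intermediate_field[OF k
        field.generate_field_is_subfield[OF residue_field_field sub]])
    show "Kv \<subseteq> generate_field k (insert (res x) Kv)" using incl by blast
    show "generate_field k (insert (res x) Kv) \<noteq> Kv" using xg(4) incl by blast
  qed
  then show ?thesis by simp
qed

section \<open>Endomorphisms of L over K and their action on O_L and Lv\<close>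

definition K_endo where
  "K_endo \<tau> \<longleftrightarrow> \<tau> \<in> ring_hom L L \<and> (\<forall>a\<in>K. \<tau> a = a)"

lemma Gal_K_endo: "\<tau> \<in> Gal L K \<Longrightarrow> K_endo \<tau>"
  by (auto simp: Gal_def K_endo_def ring_iso_def)

context
  fixes \<tau> assumes \<tau>: "K_endo \<tau>"
begin

lemma endo_hom: "\<tau> \<in> ring_hom L L"
  using \<tau> by (simp add: K_endo_def)

lemma endo_K: "a \<in> K \<Longrightarrow> \<tau> a = a"
  using \<tau> by (simp add: K_endo_def)

lemma endo_closed: "x \<in> carrier L \<Longrightarrow> \<tau> x \<in> carrier L"
  using ring_hom_closed[OF endo_hom] .

lemma endo_add: "x \<in> carrier L \<Longrightarrow> y \<in> carrier L \<Longrightarrow> \<tau> (x \<oplus> y) = \<tau> x \<oplus> \<tau> y"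
  using ring_hom_add[OF endo_hom] .

lemma endo_mult: "x \<in> carrier L \<Longrightarrow> y \<in> carrier L \<Longrightarrow> \<tau> (x \<otimes> y) = \<tau> x \<otimes> \<tau> y"
  using ring_hom_mult[OF endo_hom] .

lemma endo_one: "\<tau> \<one> = \<one>"
  using ring_hom_one[OF endo_hom] .

lemma endo_zero: "\<tau> \<zero> = \<zero>"
  using endo_K by simp

lemma endo_minus: "x \<in> carrier L \<Longrightarrow> \<tau> (\<ominus> x) = \<ominus> \<tau> x"
  using endo_add[of "\<ominus> x" x] endo_closed endo_zero
  by (intro minus_equality[symmetric]) (simp_all add: l_neg)

lemma endo_diff: "x \<in> carrier L \<Longrightarrow> y \<in> carrier L \<Longrightarrow> \<tau> (x \<ominus> y) = \<tau> x \<ominus> \<tau> y"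
  by (simp add: a_minus_def endo_add endo_minus)

lemma endo_pow: "x \<in> carrier L \<Longrightarrow> \<tau> (x [^] (n::nat)) = \<tau> x [^] n"
  by (induction n) (simp_all add: endo_one endo_mult)

lemma endo_add_pow: "x \<in> carrier L \<Longrightarrow> \<tau> ([(n::nat)] \<cdot> x) = [n] \<cdot> \<tau> x"
  by (induction n) (simp_all add: endo_zero endo_add)

lemma endo_finsum:
  assumes "finite A" "\<And>i. i \<in> A \<Longrightarrow> f i \<in> carrier L"
  shows "\<tau> (\<Oplus>i\<in>A. f i) = (\<Oplus>i\<in>A. \<tau> (f i))"
  using assms
proof (induction A rule: finite_induct)
  case (insert a A)
  have "(\<Oplus>i\<in>insert a A. f i) = f a \<oplus> (\<Oplus>i\<in>A. f i)"
    using insert by (intro finsum_insert) auto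
  moreover have "(\<Oplus>i\<in>insert a A. \<tau> (f i)) = \<tau> (f a) \<oplus> (\<Oplus>i\<in>A. \<tau> (f i))"
    using insert endo_closed by (intro finsum_insert) auto
  moreover have "(\<Oplus>i\<in>A. f i) \<in> carrier L" using insert by (intro finsum_closed) auto
  ultimately show ?case using insert by (simp add: endo_add)
qed (simp add: endo_zero)

lemma endo_inv:
  assumes "x \<in> carrier L" "x \<noteq> \<zero>"
  shows "\<tau> x \<otimes> \<tau> (inv x) = \<one>"
  using endo_mult[of x "inv x"] inv_facts[OF assms] assms endo_one by simp

lemma endo_eq_zero:
  assumes "x \<in> carrier L" "\<tau> x = \<zero>"
  shows "x = \<zero>"
proof (rule ccontr)
  assume "x \<noteq> \<zero>"
  then have "\<one> = \<zero>" using endo_inv[OF assms(1)] assms endo_closed[OF inv_facts(1)] by simp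
  then show False by simp
qed

lemma endo_inj:
  assumes "x \<in> carrier L" "y \<in> carrier L" "\<tau> x = \<tau> y"
  shows "x = y"
proof -
  have "\<tau> (x \<ominus> y) = \<zero>" using assms endo_closed by (simp add: endo_diff)
  then have "x \<ominus> y = \<zero>" using endo_eq_zero assms by simp
  then show ?thesis using assms by simp
qed

text \<open>The fixed set is an intermediate field, and there are none besides K and L. So an
  endomorphism that moves some element of L fixes nothing outside K.\<close>

lemma endo_fixed_field:
  assumes y: "y \<in> carrier L" "y \<notin> K" "\<tau> y = y" and z: "z \<in> carrier L"
  shows "\<tau> z = z"
proof -
  let ?F = "{z \<in> carrier L. \<tau> z = z}"
  have sub: "subring ?F L"
    by (rule subringI) (auto simp: endo_one endo_minus endo_mult endo_add)
  have "subfield ?F L"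
  proof (rule subfieldI'[OF sub])
    fix x assume x: "x \<in> ?F - {\<zero>}"
    then have i: "inv x \<in> carrier L" "x \<otimes> inv x = \<one>" "inv x \<otimes> x = \<one>" using inv_facts[of x] by auto
    have "x \<otimes> \<tau> (inv x) = \<one>" using endo_inv[of x] x by simp
    then have "inv x = \<tau> (inv x)"
      using comm_inv_char[of x "\<tau> (inv x)"] x endo_closed[OF i(1)] by simp
    then show "inv x \<in> ?F" using i by simp
  qed
  moreover have "K \<subseteq> ?F" using endo_K K_closed by blast
  moreover have "?F \<noteq> K" using y by blast
  ultimately have "?F = carrier L" by (rule no_intermediate_field)
  then show ?thesis using z by blast
qed

end

text \<open>The monic equation of degree p that x satisfies over O_K also holds for \<tau> x.
  Divided by the p-th power of a non-integral \<tau> x, it would write 1 as a sum of elements of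
  \<open>Mv\<close>. The claim for all b follows from O_L = O_K[x], without appeal to uniqueness of
  the extension of v.\<close>

lemma endo_Ov:
  assumes \<tau>: "K_endo \<tau>" and b: "b \<in> Ov"
  shows "\<tau> b \<in> Ov"
proof -
  note endo = endo_closed[OF \<tau>] endo_add[OF \<tau>] endo_mult[OF \<tau>] endo_minus[OF \<tau>] endo_one[OF \<tau>]
  obtain x where x: "residual_generator x" using ex_residual_generator by blast
  note xg = residual_generator_closed[OF x]
  let ?y = "\<tau> x"
  have y: "?y \<in> carrier L" using endo(1)[OF xg(2)] .
  have "?y \<in> Ov"
  proof (rule ccontr)
    assume nO: "?y \<notin> Ov"
    note z = inv_in_Mv[OF y nO]
    note i = inv_facts[OF y z(1)]
    obtain a where a: "\<forall>i. a i \<in> K" "x [^] p = (\<Oplus>i\<in>{..<p}. a i \<otimes> x [^] i)"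
      using power_basis_ex[OF xg(2,5), of "x [^] p"] xg(2) by auto
    have aK: "a i \<in> K" for i using a(1) by blast
    have aO: "a i \<in> Ov" if "i < p" for i
      by (rule combination_integral[OF x aK a(2) Ov_pow[OF xg(1)] that])
    have "?y [^] p = \<tau> (x [^] p)" using endo_pow[OF \<tau> xg(2)] by simp
    also have "\<dots> = (\<Oplus>i\<in>{..<p}. \<tau> (a i \<otimes> x [^] i))"
      unfolding a(2) using aK xg(2) by (intro endo_finsum[OF \<tau>]) auto
    also have "\<dots> = (\<Oplus>i\<in>{..<p}. a i \<otimes> ?y [^] i)"
      using aK xg(2) y by (intro finsum_cong') (auto simp: endo endo_pow[OF \<tau>] endo_K[OF \<tau>])
    finally have yp: "?y [^] p = (\<Oplus>i\<in>{..<p}. a i \<otimes> ?y [^] i)" .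
    have inv_pow: "?y [^] j \<otimes> inv ?y [^] j = \<one>" for j :: nat
      using i y by (simp flip: nat_pow_distrib)
    have t: "a j \<otimes> ?y [^] j \<otimes> inv ?y [^] p = a j \<otimes> inv ?y [^] (p - j)" if "j < p" for j
    proof -
      have "inv ?y [^] p = inv ?y [^] j \<otimes> inv ?y [^] (p - j)"
        using that i(1) by (simp add: nat_pow_mult)
      then have "a j \<otimes> ?y [^] j \<otimes> inv ?y [^] p =
          a j \<otimes> ((?y [^] j \<otimes> inv ?y [^] j) \<otimes> inv ?y [^] (p - j))"
        using aK y i(1) by (simp add: m_assoc)
      then show ?thesis using aK y i(1) by (simp add: inv_pow)
    qed
    have "\<one> = (\<Oplus>i\<in>{..<p}. a i \<otimes> ?y [^] i) \<otimes> inv ?y [^] p"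
      using inv_pow[of p] yp by simp
    also have "\<dots> = (\<Oplus>i\<in>{..<p}. a i \<otimes> ?y [^] i \<otimes> inv ?y [^] p)"
      using aK y i(1) by (intro finsum_ldistr) auto
    also have "\<dots> = (\<Oplus>j\<in>{..<p}. a j \<otimes> inv ?y [^] (p - j))"
      using aK y i(1) t by (intro finsum_cong') auto
    \<comment> \<open>All exponents \<open>p - j\<close> are positive, so every summand lies in
      \<open>Mv\<close>.\<close>
    also have "\<dots> \<in> Mv"
      using aO z(2) by (intro ideal_finsum[OF Mv_ideal] Mv_mult Mv_pow) auto
    finally show False by simp
  qed
  moreover have "subring {b \<in> carrier L. \<tau> b \<in> Ov} L"
    by (rule subringI) (auto simp: endo)
  moreover have "val_set v K \<subseteq> {b \<in> carrier L. \<tau> b \<in> Ov}"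
    by (auto simp: val_set_K endo_K[OF \<tau>])
  ultimately have "Ov \<subseteq> {b \<in> carrier L. \<tau> b \<in> Ov}"
    using xg(2) by (intro Ov_subset_subring[OF x]) auto
  then show ?thesis using b by blast
qed

text \<open>Since vL = vK, b = u/c with a unit u of O_L and c in K, where 1/c lies in
  \<open>Mv\<close>. Then \<tau> b = (\<tau> u)/c, so integrality of \<tau> u suffices and no
  inverse of \<tau> is involved.\<close>

lemma endo_Mv:
  assumes \<tau>: "K_endo \<tau>" and b: "b \<in> Mv"
  shows "\<tau> b \<in> Mv"
proof (cases "b = \<zero>")
  case True
  then show ?thesis using endo_zero[OF \<tau>] by simp
next
  case False
  have bL: "b \<in> carrier L" using Mv_Ov[OF b] by simp
  obtain c where c: "c \<in> K" "c \<noteq> \<zero>" "b \<otimes> c \<in> Ov" "b \<otimes> c \<notin> Mv"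
    using value_group[OF bL False] by blast
  let ?u = "b \<otimes> c"
  have cL: "c \<in> carrier L" using c(1) by simp
  note ic = inv_facts[OF cL c(2)]
  note u = Ov_unit_inv[OF c(3,4)]
  note iu = inv_facts[OF Ov_closed[OF c(3)] u(1)]
  have "inv c = inv c \<otimes> (?u \<otimes> inv ?u)" using ic(1) iu(3) by simp
  also have "\<dots> = (inv c \<otimes> c) \<otimes> (b \<otimes> inv ?u)" using ic(1) iu(1) bL cL by (simp add: m_ac)
  also have "\<dots> = b \<otimes> inv ?u" using ic(4) iu(1) bL by simp
  finally have "inv c \<in> Mv" using Mv_mult2[OF b u(2)] by simp
  then have "\<tau> ?u \<otimes> inv c \<in> Mv" using endo_Ov[OF \<tau> c(3)] by (intro Mv_mult)
  moreover have "\<tau> ?u \<otimes> inv c = \<tau> b"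
    using endo_mult[OF \<tau> bL cL] endo_K[OF \<tau> c(1)] ic cL endo_closed[OF \<tau> bL] by (simp add: m_assoc)
  ultimately show ?thesis by simp
qed

text \<open>The integral b with \<tau> b congruent to b modulo I form a ring containing O_K, so
  testing one generator is enough. Used with I = \<open>Mv\<close> for the residues and with I = (c)
  for the ramification ideal.\<close>

lemma endo_congruence:
  assumes \<tau>: "K_endo \<tau>" and I: "ideal I (val_ring L v)"
    and x: "residual_generator x" "\<tau> x \<ominus> x \<in> I" and b: "b \<in> Ov"
  shows "\<tau> b \<ominus> b \<in> I"
proof -
  let ?S = "{b \<in> Ov. \<tau> b \<ominus> b \<in> I}"
  note endo = endo_closed[OF \<tau>] endo_add[OF \<tau>] endo_mult[OF \<tau>]
  have AS: "val_set v K \<subseteq> ?S"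
    using ideal_zero[OF I] by (auto simp: val_set_K endo_K[OF \<tau>] a_minus_def r_neg)
  have mult: "r \<otimes> s \<in> ?S" if r: "r \<in> ?S" and s: "s \<in> ?S" for r s
  proof -
    have L: "r \<in> carrier L" "\<tau> r \<in> carrier L" "s \<in> carrier L" "\<tau> s \<in> carrier L"
      using r s endo(1) by auto
    \<comment> \<open>The twisted Leibniz rule for the difference operator of \<tau>.\<close>
    have "\<tau> (r \<otimes> s) \<ominus> r \<otimes> s = \<tau> r \<otimes> (\<tau> s \<ominus> s) \<oplus> (\<tau> r \<ominus> r) \<otimes> s"
      unfolding endo(3)[OF L(1,3)] using L by algebra
    also have "\<dots> \<in> I"
      using r s endo_Ov[OF \<tau>, of r]
      by (intro ideal_add[OF I] ideal_mult[OF I] ideal_mult2[OF I]) auto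
    finally show ?thesis using r s by simp
  qed
  have "subring ?S L"
  proof (rule subringI)
    show "?S \<subseteq> carrier L" using Ov_closed by blast
    show "\<one> \<in> ?S" by (rule subsetD[OF AS]) (simp add: val_set_K)
    fix r assume r: "r \<in> ?S"
    have "\<ominus> \<one> \<in> ?S" by (rule subsetD[OF AS]) (simp add: val_set_K)
    from mult[OF this r] show "\<ominus> r \<in> ?S" using r by (simp add: l_minus)
    fix s assume s: "s \<in> ?S"
    show "r \<otimes> s \<in> ?S" by (rule mult[OF r s])
    have L: "r \<in> carrier L" "\<tau> r \<in> carrier L" "s \<in> carrier L" "\<tau> s \<in> carrier L"
      using r s endo(1) by auto
    have "\<tau> (r \<oplus> s) \<ominus> (r \<oplus> s) = (\<tau> r \<ominus> r) \<oplus> (\<tau> s \<ominus> s)"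
      unfolding endo(2)[OF L(1,3)] using L by algebra
    also have "\<dots> \<in> I" using r s by (intro ideal_add[OF I]) auto
    finally show "r \<oplus> s \<in> ?S" using r s by simp
  qed
  moreover have "x \<in> ?S" using x residual_generator_closed(1) by blast
  ultimately have "Ov \<subseteq> ?S" using AS by (intro Ov_subset_subring[OF x(1)])
  then show ?thesis using b by blast
qed

text \<open>Choose x whose residue has its p-th power in Kv; then m = x^p - a lies in
  \<open>Mv\<close> for some a in O_K. Frobenius gives (\<tau> x - x)^p = \<tau> m - m, which lies
  in \<open>Mv\<close>, and hence so does \<tau> x - x.\<close>

lemma endo_residue:
  assumes \<tau>: "K_endo \<tau>" and b: "b \<in> Ov"
  shows "\<tau> b \<ominus> b \<in> Mv"
proof -
  note endo = endo_closed[OF \<tau>] endo_diff[OF \<tau>]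
  obtain x where x: "residual_generator x" "res (x [^] p) \<in> Kv" using ex_residual_generator by blast
  note xg = residual_generator_closed[OF x(1)]
  obtain a where a': "res (x [^] p) = res a" "a \<in> val_set v K"
    using x(2) unfolding residue_subfield_def by (rule imageE)
  have a: "a \<in> K" "a \<in> Ov" using a'(2) by (auto simp: val_set_K)
  let ?m = "x [^] p \<ominus> a"
  have m: "?m \<in> Mv" using residue_eq_iff[OF Ov_pow[OF xg(1)] a(2)] a'(1) by simp
  have "(\<tau> x \<ominus> x) [^] p = \<tau> x [^] p \<ominus> x [^] p"
    using endo(1) xg(2) by (intro frobenius_diff prime_p p_one) auto
  also have "\<dots> = \<tau> ?m \<ominus> ?m"
  proof -
    have "\<tau> ?m = \<tau> x [^] p \<ominus> a"
      using endo_pow[OF \<tau> xg(2)] endo_K[OF \<tau> a(1)] xg(2) a(2) by (simp add: endo)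
    moreover have "r \<ominus> s = (r \<ominus> t) \<ominus> (s \<ominus> t)"
      if "r \<in> carrier L" "s \<in> carrier L" "t \<in> carrier L" for r s t
      using that by algebra
    from this[of "\<tau> x [^] p" "x [^] p" a]
    have "\<tau> x [^] p \<ominus> x [^] p = (\<tau> x [^] p \<ominus> a) \<ominus> (x [^] p \<ominus> a)"
      using endo(1)[OF xg(2)] xg(2) a(2) by auto
    ultimately show ?thesis by (simp only:)
  qed
  also have "\<dots> \<in> Mv" using Mv_diff[OF endo_Mv[OF \<tau> m] m] .
  finally have "(\<tau> x \<ominus> x) [^] p \<in> Mv" .
  then have "\<tau> x \<ominus> x \<in> Mv"
    by (rule Mv_power_imp[OF Ov_diff[OF endo_Ov[OF \<tau> xg(1)] xg(1)]])
  then show ?thesis by (rule endo_congruence[OF \<tau> Mv_ideal x(1) _ b])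
qed

text \<open>Iterates of an element of \<open>Gal\<close> need not be extensional (the zeroth is
  \<open>id\<close>), which is why the weaker \<open>K_endo\<close> carries the arguments.\<close>

lemma endo_funpow: "K_endo \<tau> \<Longrightarrow> K_endo (\<tau> ^^ n)"
proof (induction n)
  case 0
  have "id \<in> ring_hom L L" by (rule ring_hom_memI) auto
  then show ?case unfolding K_endo_def funpow.simps by simp
next
  case (Suc n)
  then have "\<tau> ^^ n \<in> ring_hom L L" "\<tau> \<in> ring_hom L L" by (auto simp: K_endo_def)
  then have "\<tau> \<circ> \<tau> ^^ n \<in> ring_hom L L" by (rule ring_hom_trans)
  moreover have "\<forall>a\<in>K. (\<tau> \<circ> \<tau> ^^ n) a = a" using Suc by (simp add: K_endo_def)
  ultimately show ?case unfolding K_endo_def funpow.simps by blast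
qed

section \<open>The order of an automorphism and additive Hilbert 90\<close>

lemma endo_is_root:
  assumes \<tau>: "K_endo \<tau>" and x: "x \<in> carrier L"
  shows "is_root (Irr K x) (\<tau> x)"
proof -
  have alg: "(algebraic over K) x"
    using prime_degree_extension.algebraic[OF ext x] by (simp add: over_def)
  note f = IrrE[OF K_subfield x alg]
  let ?f = "Irr K x"
  have f0: "?f \<noteq> []" using pirreducibleE(1)[OF subfieldE(1)[OF K_subfield] f(1,2)] .
  have fK: "set ?f \<subseteq> K" using f(1) polynomial_incl unfolding univ_poly_carrier[symmetric] by blast
  have h: "ring_hom_ring L L \<tau>"
    by (rule ring_hom_ringI2[OF ring_axioms ring_axioms endo_hom[OF \<tau>]])
  have fL: "set ?f \<subseteq> carrier L" using fK K_subset by blast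
  have "map \<tau> ?f = ?f" using fK endo_K[OF \<tau>] by (intro map_idI) blast
  then have "eval ?f (\<tau> x) = \<tau> (eval ?f x)"
    using ring_hom_ring.eval_hom'[OF h x fL] by simp
  also have "\<dots> = \<zero>" using f(4) endo_zero[OF \<tau>] by simp
  finally show ?thesis unfolding is_root_def using f0 endo_closed[OF \<tau> x] by blast
qed

text \<open>The orbit of x lies in the finite set of roots of its minimal polynomial, so two
  iterates agree at x, and injectivity cancels the smaller one.\<close>

lemma endo_order:
  assumes \<tau>: "K_endo \<tau>" and x: "x \<in> carrier L"
  shows "\<exists>n>0. (\<tau> ^^ n) x = x"
proof -
  have alg: "(algebraic over K) x"
    using prime_degree_extension.algebraic[OF ext x] by (simp add: over_def)
  have "Irr K x \<in> carrier (poly_ring L)"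
    using carrier_polynomial_shell[OF subfieldE(1)[OF K_subfield]] IrrE(1)[OF K_subfield x alg] .
  then have fin: "finite {y. is_root (Irr K x) y}" by (rule finite_number_of_roots)
  have "range (\<lambda>i. (\<tau> ^^ i) x) \<subseteq> {y. is_root (Irr K x) y}"
    using endo_is_root[OF endo_funpow[OF \<tau>] x] by blast
  then have "finite (range (\<lambda>i. (\<tau> ^^ i) x))" using fin finite_subset by blast
  then have "\<not> inj (\<lambda>i. (\<tau> ^^ i) x)" using finite_imageD by blast
  then obtain i' j' where ij': "i' \<noteq> j'" "(\<tau> ^^ i') x = (\<tau> ^^ j') x"
    unfolding inj_on_def by blast
  obtain i j where ij: "i < j" "(\<tau> ^^ i) x = (\<tau> ^^ j) x"
  proof (cases "i' < j'")
    case True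
    then show ?thesis using that ij'(2) by blast
  next
    case False
    then have "j' < i'" using ij'(1) by simp
    then show ?thesis using that ij'(2)[symmetric] by blast
  qed
  have "(\<tau> ^^ j) x = (\<tau> ^^ i) ((\<tau> ^^ (j - i)) x)"
    using ij(1) by (metis comp_apply funpow_add le_add_diff_inverse less_imp_le)
  then have "(\<tau> ^^ (j - i)) x = x"
    using endo_inj[OF endo_funpow[OF \<tau>], of "(\<tau> ^^ (j - i)) x" x i]
      endo_closed[OF endo_funpow[OF \<tau>] x] x ij(2) by simp
  then show ?thesis using ij(1) by (metis zero_less_diff)
qed

text \<open>An automorphism of order prime to \<open>p\<close> would make \<open>x\<close> residually a multiple of its
  trace, which lies in \<open>K\<close>.\<close>

lemma endo_order_dvd:
  assumes \<tau>: "K_endo \<tau>" and x: "residual_generator x"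
    and T: "(\<Oplus>i\<in>{..<m}. (\<tau> ^^ i) x) \<in> K" and m: "0 < m"
  shows "p dvd m"
proof (rule ccontr)
  note xg = residual_generator_closed[OF x]
  let ?T = "\<lambda>n. \<Oplus>i\<in>{..<n}. (\<tau> ^^ i) x"
  have y: "(\<tau> ^^ i) x \<in> Ov" for i using endo_Ov[OF endo_funpow[OF \<tau>] xg(1)] .
  have TO: "?T n \<in> Ov" for n using y by (intro Ov_finsum) auto
  \<comment> \<open>As all iterates act trivially on residues, the sum of n conjugates is congruent
    to n x.\<close>
  have e: "?T n \<ominus> [n] \<cdot> x \<in> Mv" for n
  proof (induction n)
    case 0
    then show ?case by (simp add: a_minus_def)
  next
    case (Suc n)
    have "?T (Suc n) = (\<tau> ^^ n) x \<oplus> ?T n"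
      unfolding lessThan_Suc using y by (intro finsum_insert) auto
    then have "?T (Suc n) \<ominus> [Suc n] \<cdot> x = ((\<tau> ^^ n) x \<oplus> ?T n) \<ominus> ([n] \<cdot> x \<oplus> x)" by simp
    also have "\<dots> = ((\<tau> ^^ n) x \<ominus> x) \<oplus> (?T n \<ominus> [n] \<cdot> x)"
    proof -
      have "(a \<oplus> b) \<ominus> (c \<oplus> d) = (a \<ominus> d) \<oplus> (b \<ominus> c)"
        if "a \<in> carrier L" "b \<in> carrier L" "c \<in> carrier L" "d \<in> carrier L" for a b c d
        using that by algebra
      from this[OF Ov_closed[OF y] Ov_closed[OF TO] Ov_closed[OF Ov_add_pow[OF xg(1)]] xg(2)]
      show ?thesis .
    qed
    also have "\<dots> \<in> Mv"
      using endo_residue[OF endo_funpow[OF \<tau>] xg(1)] Suc by (intro Mv_add)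
    finally show ?case .
  qed
  assume "\<not> p dvd m"
  then have "gcd m p = 1"
    using prime_imp_coprime[OF prime_p] by (simp add: coprime_iff_gcd_eq_1 gcd.commute)
  \<comment> \<open>\<open>u\<close> inverts m modulo p, so \<open>u\<close> times the trace is
    congruent to x; as the trace lies in K, the residue of x would lie in Kv.\<close>
  then obtain u k where uk: "m * u = p * k + 1" using bezout_nat[of m p] m by auto
  let ?e = "?T m \<ominus> [m] \<cdot> x"
  have mx: "[m] \<cdot> x \<in> carrier L" using xg(2) by simp
  have TL: "?T m \<in> carrier L" using Ov_closed[OF TO] .
  have "[(m * u)] \<cdot> x = [(p * k)] \<cdot> x \<oplus> x"
    unfolding uk using xg(2) by (simp flip: add.nat_pow_mult)
  also have "[(p * k)] \<cdot> x = \<zero>" by (rule add_pow_eq_zero_of_dvd[OF p_one _ xg(2)]) simp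
  finally have mu: "[u] \<cdot> ([m] \<cdot> x) = x" using xg(2) by (simp add: add.nat_pow_pow)
  have "[u] \<cdot> ?T m = [u] \<cdot> (?e \<oplus> [m] \<cdot> x)"
  proof -
    have "a = (a \<ominus> b) \<oplus> b" if "a \<in> carrier L" "b \<in> carrier L" for a b
      using that by algebra
    from this[OF TL mx] show ?thesis by presburger
  qed
  also have "\<dots> = [u] \<cdot> ?e \<oplus> x"
    using TL mx by (simp add: add.nat_pow_distrib mu)
  finally have "[u] \<cdot> ?T m \<ominus> x = ([u] \<cdot> ?e \<oplus> x) \<ominus> x" by simp
  also have "\<dots> = [u] \<cdot> ?e"
  proof -
    have "(a \<oplus> b) \<ominus> b = a" if "a \<in> carrier L" "b \<in> carrier L" for a b
      using that by algebra
    then show ?thesis using TL mx xg(2) by simp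
  qed
  also have "\<dots> \<in> Mv" using Mv_add_pow[OF e] .
  finally have "res ([u] \<cdot> ?T m) = res x"
    using residue_eq_iff[OF Ov_add_pow[OF TO] xg(1)] by simp
  moreover have "res ([u] \<cdot> ?T m) \<in> Kv"
    unfolding residue_subfield_def
    by (intro imageI) (simp add: val_set_K Ov_add_pow[OF TO] K_add_pow[OF T])
  ultimately show False using xg(4) by simp
qed

text \<open>Hilbert 90 made explicit: let t be the nonzero trace of b, and W the sum of
  \<open>[i] \<cdot> (\<tau> ^^ i) b\<close> over i < m. Then \<tau> W = W - t, so -W/t is the
  required element.\<close>

lemma ex_artin_schreier_root:
  "\<exists>\<tau>\<in>Gal L K. \<exists>\<theta>\<in>carrier L. \<tau> \<theta> = \<theta> \<oplus> \<one>"
proof -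
  obtain x where x: "residual_generator x" using ex_residual_generator by blast
  note xg = residual_generator_closed[OF x]
  have "{z \<in> carrier L. \<forall>\<tau>\<in>Gal L K. \<tau> z = z} = K"
    using artin_schreier unfolding artin_schreier_extension_def finite_galois_extension_def by blast
  then obtain \<tau> where \<tau>: "\<tau> \<in> Gal L K" "\<tau> x \<noteq> x" using xg(2,5) by blast
  have E: "K_endo \<tau>" using Gal_K_endo[OF \<tau>(1)] .
  note En = endo_funpow[OF E]
  have fixK: "z \<in> K" if "z \<in> carrier L" "\<tau> z = z" for z
    using endo_fixed_field[OF E that(1) _ that(2) xg(2)] \<tau>(2) by blast
  \<comment> \<open>The order of \<tau> at x alone; as x lies outside K,
    \<open>endo_fixed_field\<close> makes \<open>\<tau> ^^ m\<close> the identity on all of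
    L.\<close>
  define m where "m = (LEAST n. 0 < n \<and> (\<tau> ^^ n) x = x)"
  have ex: "\<exists>n. 0 < n \<and> (\<tau> ^^ n) x = x" using endo_order[OF E xg(2)] .
  have m: "0 < m" "(\<tau> ^^ m) x = x" unfolding m_def using LeastI_ex[OF ex] by auto
  have least: "(\<tau> ^^ n) x \<noteq> x" if "0 < n" "n < m" for n
    using not_less_Least[of n "\<lambda>n. 0 < n \<and> (\<tau> ^^ n) x = x"] that unfolding m_def by blast
  have id: "(\<tau> ^^ m) z = z" if "z \<in> carrier L" for z
    using endo_fixed_field[OF En xg(2,5) m(2) that] .
  let ?y = "\<lambda>i. (\<tau> ^^ i) x"
  have neq: "?y i \<noteq> ?y j" if "i < j" "j < m" for i j
  proof
    assume eq: "?y i = ?y j"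
    have "?y j = (\<tau> ^^ i) (?y (j - i))"
      using that by (metis comp_apply funpow_add le_add_diff_inverse less_imp_le)
    then have "?y (j - i) = x"
      using endo_inj[OF En, of "?y (j - i)" x i] endo_closed[OF En xg(2)] xg(2) eq by simp
    then show False using least[of "j - i"] that by simp
  qed
  have inj: "inj_on ?y {..<m}"
    by (rule inj_onI) (metis neq lessThan_iff nat_neq_iff)
  let ?T = "\<lambda>b. \<Oplus>i\<in>{..<m}. (\<tau> ^^ i) b"
  have cl: "(\<tau> ^^ i) b \<in> carrier L" if "b \<in> carrier L" for i b using endo_closed[OF En that] .
  have TL: "?T b \<in> carrier L" if "b \<in> carrier L" for b using cl[OF that] by (intro finsum_closed) auto
  have shift: "(\<Oplus>i\<in>{..<m}. (\<tau> ^^ Suc i) b) = ?T b" if b: "b \<in> carrier L" for b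
    by (rule finsum_cyclic_shift[OF cl[OF b] _ abelian_group_axioms]) (simp add: id[OF b])
  have TK: "?T b \<in> K" if b: "b \<in> carrier L" for b
  proof (rule fixK[OF TL[OF b]])
    have "\<tau> (?T b) = (\<Oplus>i\<in>{..<m}. (\<tau> ^^ Suc i) b)"
      using cl[OF b] by (subst endo_finsum[OF E]) auto
    then show "\<tau> (?T b) = ?T b" using shift[OF b] by simp
  qed
  \<comment> \<open>This is what makes the boundary term \<open>[m] \<cdot> (\<tau> ^^ m) b\<close>
    of the summation by parts vanish.\<close>
  have pm: "p dvd m" using endo_order_dvd[OF E x TK[OF xg(2)] m(1)] .
  obtain k :: nat where k: "(\<Oplus>i\<in>{..<m}. ?y i [^] k) \<noteq> \<zero>"
    using exists_power_sum_ne_zero[OF cl[OF xg(2)] inj m(1)] by blast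
  \<comment> \<open>The trace of x^k is the k-th power sum of the conjugates of x.\<close>
  define b where "b = x [^] k"
  have b: "b \<in> carrier L" unfolding b_def using xg(2) by simp
  define t where "t = ?T b"
  have "t = (\<Oplus>i\<in>{..<m}. ?y i [^] k)"
    unfolding t_def b_def using endo_pow[OF En xg(2)] by simp
  then have t0: "t \<noteq> \<zero>" using k by simp
  have tK: "t \<in> K" unfolding t_def using TK[OF b] .
  then have tL: "t \<in> carrier L" by simp
  note it = inv_facts[OF tL t0]
  define W where "W = (\<Oplus>i\<in>{..<m}. [i] \<cdot> (\<tau> ^^ i) b)"
  have W: "W \<in> carrier L" unfolding W_def using cl[OF b] by (intro finsum_closed) auto
  have \<tau>W: "\<tau> W = (\<Oplus>i\<in>{..<m}. [i] \<cdot> (\<tau> ^^ Suc i) b)"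
    unfolding W_def using cl[OF b] by (subst endo_finsum[OF E]) (auto simp: endo_add_pow[OF E])
  have "(\<Oplus>i\<in>{..<m}. [i] \<cdot> (\<tau> ^^ Suc i) b) \<oplus> t = W \<oplus> [m] \<cdot> (\<tau> ^^ m) b"
    using finsum_weighted_shift[of "\<lambda>i. (\<tau> ^^ i) b" m, OF cl[OF b]]
    unfolding shift[OF b] W_def t_def .
  then have "\<tau> W \<oplus> t = W \<oplus> [m] \<cdot> (\<tau> ^^ m) b" unfolding \<tau>W .
  also have "[m] \<cdot> (\<tau> ^^ m) b = \<zero>" by (rule add_pow_eq_zero_of_dvd[OF p_one pm cl[OF b]])
  finally have Wt: "\<tau> W \<oplus> t = W" using W by simp
  let ?\<theta> = "\<ominus> (inv t \<otimes> W)"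
  have \<tau>\<theta>: "\<tau> ?\<theta> = \<ominus> (inv t \<otimes> \<tau> W)"
    using W it(1) by (simp add: endo_minus[OF E] endo_mult[OF E] endo_K[OF E K_inv[OF tK t0]])
  have \<tau>W': "\<tau> W \<in> carrier L" using endo_closed[OF E W] .
  have "?\<theta> \<oplus> \<one> = \<ominus> (inv t \<otimes> (\<tau> W \<oplus> t)) \<oplus> inv t \<otimes> t" using Wt it(4) by simp
  also have "\<dots> = \<ominus> (inv t \<otimes> \<tau> W)"
    using \<tau>W' it(1) tL by algebra
  finally have "\<tau> ?\<theta> = ?\<theta> \<oplus> \<one>" using \<tau>\<theta> by simp
  then show ?thesis using \<tau>(1) W it(1) by (meson a_inv_closed m_closed)
qed

section \<open>Construction of the Artin-Schreier generator and of the scaling constant\<close>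

lemma sum_split_first:
  assumes "\<And>i. f i \<in> carrier L"
  shows "(\<Oplus>i\<in>{..<p}. f i) = f 0 \<oplus> (\<Oplus>i\<in>{0<..<p}. f i)"
proof -
  have "{..<p} = insert 0 {0<..<p}" using prime_gt_0_nat[OF prime_p] by auto
  then show ?thesis using assms by (simp add: Pi_def)
qed

lemma ex_artin_schreier_generator:
  "\<exists>\<tau> \<theta> c. \<tau> \<in> Gal L K \<and> artin_schreier_generator p L K \<theta> \<and> \<tau> \<theta> = \<theta> \<oplus> \<one> \<and> \<theta> \<notin> Ov \<and>
    c \<in> K \<and> c \<in> Mv \<and> c \<noteq> \<zero> \<and> residual_generator (c \<otimes> \<theta>)"
proof -
  obtain \<tau> \<theta>0 where \<tau>: "\<tau> \<in> Gal L K" and \<theta>0: "\<theta>0 \<in> carrier L" "\<tau> \<theta>0 = \<theta>0 \<oplus> \<one>"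
    using ex_artin_schreier_root by blast
  have E: "K_endo \<tau>" using Gal_K_endo[OF \<tau>] .
  obtain x where x: "residual_generator x" using ex_residual_generator by blast
  note xg = residual_generator_closed[OF x]
  obtain a where a: "\<forall>i. a i \<in> K" "\<theta>0 = (\<Oplus>i\<in>{..<p}. a i \<otimes> x [^] i)"
    using power_basis_ex[OF xg(2,5) \<theta>0(1)] by blast
  have aK: "a i \<in> K" and aL: "a i \<in> carrier L" for i using a(1) by auto
  define \<theta> where "\<theta> = (\<Oplus>i\<in>{0<..<p}. a i \<otimes> x [^] i)"
  have \<theta>L: "\<theta> \<in> carrier L" unfolding \<theta>_def using aL xg(2) by (intro finsum_closed) auto
  \<comment> \<open>Used twice: with d = 0, e = 1 for \<theta> itself, and with e = c for c \<theta>
    minus an element of O_K.\<close>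
  have sum_upd: "(\<Oplus>i\<in>{..<p}. (if i = 0 then d else e \<otimes> a i) \<otimes> x [^] i) = d \<oplus> e \<otimes> \<theta>"
    if d: "d \<in> carrier L" and e: "e \<in> carrier L" for d e
  proof -
    have "(\<Oplus>i\<in>{..<p}. (if i = 0 then d else e \<otimes> a i) \<otimes> x [^] i) =
        d \<oplus> (\<Oplus>i\<in>{0<..<p}. (if i = 0 then d else e \<otimes> a i) \<otimes> x [^] i)"
      using d e aL xg(2) by (subst sum_split_first) auto
    also have "(\<Oplus>i\<in>{0<..<p}. (if i = 0 then d else e \<otimes> a i) \<otimes> x [^] i) =
        (\<Oplus>i\<in>{0<..<p}. e \<otimes> (a i \<otimes> x [^] i))"
      using d e aL xg(2) by (intro finsum_cong') (auto simp: m_assoc)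
    also have "\<dots> = e \<otimes> \<theta>"
      unfolding \<theta>_def using e aL xg(2) by (intro finsum_rdistr[symmetric]) auto
    finally show ?thesis .
  qed
  have \<theta>0': "\<theta>0 = a 0 \<oplus> \<theta>"
    unfolding a(2) \<theta>_def using aL xg(2) by (subst sum_split_first) auto
  have \<tau>\<theta>L: "\<tau> \<theta> \<in> carrier L" using endo_closed[OF E \<theta>L] .
  have "a 0 \<oplus> \<tau> \<theta> = a 0 \<oplus> (\<theta> \<oplus> \<one>)"
    using \<theta>0(2) endo_add[OF E aL \<theta>L] endo_K[OF E aK] aL \<theta>L unfolding \<theta>0' by (simp add: a_assoc)
  then have \<tau>\<theta>: "\<tau> \<theta> = \<theta> \<oplus> \<one>" using aL \<theta>L \<tau>\<theta>L by simp
  have \<tau>\<theta>_ne: "\<theta> \<oplus> \<one> \<noteq> \<theta>"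
  proof
    assume "\<theta> \<oplus> \<one> = \<theta>"
    then have "\<theta> \<oplus> \<one> = \<theta> \<oplus> \<zero>" using \<theta>L by simp
    then show False using \<theta>L add.l_cancel[of \<theta> \<one> \<zero>] by simp
  qed
  have \<theta>_K: "\<theta> \<notin> K" using endo_K[OF E, of \<theta>] \<tau>\<theta> \<tau>\<theta>_ne by auto
  have \<theta>_Ov: "\<theta> \<notin> Ov"
  proof
    assume "\<theta> \<in> Ov"
    then have "\<tau> \<theta> \<ominus> \<theta> \<in> Mv" using endo_residue[OF E] by simp
    moreover have "\<tau> \<theta> \<ominus> \<theta> = \<one>" unfolding \<tau>\<theta> using \<theta>L by algebra
    ultimately show False by simp
  qed
  have gen: "artin_schreier_generator p L K \<theta>"
    unfolding artin_schreier_generator_def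
  proof (intro conjI)
    have sub: "insert \<theta> K \<subseteq> carrier L" using \<theta>L K_subset by simp
    have incl: "insert \<theta> K \<subseteq> generate_field L (insert \<theta> K)"
      by (rule subsetI) (rule generate_field.incl)
    show "generate_field L (insert \<theta> K) = carrier L"
    proof (rule no_intermediate_field[OF generate_field_is_subfield[OF sub]])
      show "K \<subseteq> generate_field L (insert \<theta> K)" using incl by blast
      show "generate_field L (insert \<theta> K) \<noteq> K" using incl \<theta>_K by blast
    qed
    let ?d = "\<theta> [^] p \<ominus> \<theta>"
    have dL: "?d \<in> carrier L" using \<theta>L by simp
    have "(\<theta> \<oplus> \<one>) [^] p = \<theta> [^] p \<oplus> \<one>"
      using frobenius_add[OF prime_p p_one \<theta>L one_closed] by simp
    then have "\<tau> ?d = (\<theta> [^] p \<oplus> \<one>) \<ominus> (\<theta> \<oplus> \<one>)"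
      using endo_diff[OF E, of "\<theta> [^] p" \<theta>] endo_pow[OF E \<theta>L] \<theta>L \<tau>\<theta> by simp
    also have "\<dots> = ?d"
    proof -
      have "(r \<oplus> \<one>) \<ominus> (s \<oplus> \<one>) = r \<ominus> s" if "r \<in> carrier L" "s \<in> carrier L" for r s
        using that by algebra
      then show ?thesis using \<theta>L by simp
    qed
    finally have "\<tau> ?d = ?d" .
    \<comment> \<open>\<tau> fixes \<theta>^p - \<theta> but moves \<theta>, so it fixes nothing
      outside K.\<close>
    then show "?d \<in> K" using endo_fixed_field[OF E dL _ _ \<theta>L] \<tau>\<theta> \<tau>\<theta>_ne by auto
  qed (rule \<theta>L)
  \<comment> \<open>The zero at i = 0 makes the index \<open>j\<close> chosen below positive; the
    factor 1 matches the shape of \<open>sum_upd\<close>.\<close>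
  let ?a = "\<lambda>i. if i = 0 then \<zero> else \<one> \<otimes> a i"
  have sum_a: "\<theta> = (\<Oplus>i\<in>{..<p}. ?a i \<otimes> x [^] i)"
    using sum_upd[of \<zero> \<one>] \<theta>L by simp
  have "?a i \<in> K" for i using aK by simp
  moreover have "\<theta> \<noteq> \<zero>" using \<theta>_Ov by auto
  ultimately obtain j where j: "j < p" "?a j \<noteq> \<zero>" "\<theta> \<otimes> inv (?a j) \<in> Ov" "\<theta> \<otimes> inv (?a j) \<notin> Mv"
    "\<forall>i<p. ?a i \<otimes> inv (?a j) \<in> Ov"
    using combination_value[OF x _ sum_a] by blast
  have j0: "j \<noteq> 0" using j(2) by (cases "j = 0") simp_all
  define c where "c = inv (a j)"
  have aj: "a j \<noteq> \<zero>" "?a j = a j" using j(2) j0 aL by auto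
  note ij = inv_facts[OF aL aj(1), folded c_def]
  have cK: "c \<in> K" unfolding c_def using K_inv[OF aK aj(1)] .
  have cO: "c \<otimes> \<theta> \<in> Ov" "c \<otimes> \<theta> \<notin> Mv"
    using j(3,4) unfolding aj(2) c_def[symmetric] m_comm[OF \<theta>L ij(1)] by auto
  have gen': "residual_generator (c \<otimes> \<theta>)"
    unfolding residual_generator_def
  proof (intro conjI notI)
    assume "res (c \<otimes> \<theta>) \<in> Kv"
    then obtain d where d': "res (c \<otimes> \<theta>) = res d" "d \<in> val_set v K"
      unfolding residue_subfield_def by (rule imageE)
    have d: "d \<in> K" "d \<in> Ov" using d'(2) by (auto simp: val_set_K)
    have dL: "d \<in> carrier L" using d(2) by simp
    \<comment> \<open>The coefficients of c \<theta> - d. If this element lay in \<open>Mv\<close>,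
      so would the j-th coefficient, which is 1; only the coefficient at 0 involves d, and j >
      0.\<close>
    let ?b = "\<lambda>i. if i = 0 then \<ominus> d else c \<otimes> a i"
    have "c \<otimes> \<theta> \<ominus> d \<in> Mv" using residue_eq_iff[OF cO(1) d(2)] d'(1) by simp
    moreover have "c \<otimes> \<theta> \<ominus> d = \<ominus> d \<oplus> c \<otimes> \<theta>" using dL ij(1) \<theta>L by algebra
    ultimately have M: "(\<Oplus>i\<in>{..<p}. ?b i \<otimes> x [^] i) \<in> Mv"
      using sum_upd[of "\<ominus> d" c] dL ij(1) by simp
    have bO: "?b i \<in> Ov" if "i < p" for i
    proof (cases "i = 0")
      case False
      then have "a i \<otimes> c \<in> Ov" using j(5) that aL unfolding aj(2) c_def[symmetric] by auto
      then show ?thesis using False m_comm[OF aL ij(1)] by simp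
    qed (use d in simp)
    have bK: "?b i \<in> K" for i using d(1) cK aK by simp
    have "?b j \<in> Mv" by (rule combination_in_Mv[OF x bK bO M j(1)])
    then show False using j0 ij(4) by simp
  qed (rule cO(1))
  have cM: "c \<in> Mv"
  proof -
    note i\<theta> = inv_in_Mv[OF \<theta>L \<theta>_Ov]
    note i\<theta>' = inv_facts[OF \<theta>L i\<theta>(1)]
    have "c \<otimes> \<theta> \<otimes> inv \<theta> \<in> Mv" using cO(1) i\<theta>(2) by (rule Mv_mult)
    moreover have "c \<otimes> \<theta> \<otimes> inv \<theta> = c" using ij(1) \<theta>L i\<theta>' by (simp add: m_assoc)
    ultimately show ?thesis by simp
  qed
  show ?thesis using \<tau> gen \<tau>\<theta> \<theta>_Ov cK cM ij(2) gen' by blast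
qed

section \<open>The ramification ideal\<close>

lemma p_Suc: "\<exists>q. p = Suc q \<and> 0 < q"
  using prime_ge_2_nat[OF prime_p] by (intro exI[of _ "p - 1"]) auto

text \<open>Since \<tau> fixes \<theta>^p - \<theta>, the difference t = \<tau> \<theta> - \<theta>
  satisfies t^p = t. So t is 0 or t^(p-1) = 1, and it is integral in both cases.\<close>

lemma Gal_difference:
  assumes \<tau>: "K_endo \<tau>" and \<theta>: "\<theta> \<in> carrier L" "\<theta> [^] p \<ominus> \<theta> \<in> K"
  shows "\<tau> \<theta> \<ominus> \<theta> \<in> Ov"
proof -
  let ?d = "\<theta> [^] p \<ominus> \<theta>" and ?t = "\<tau> \<theta> \<ominus> \<theta>"
  have \<tau>\<theta>: "\<tau> \<theta> \<in> carrier L" using endo_closed[OF \<tau> \<theta>(1)] .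
  have d: "\<tau> \<theta> [^] p \<ominus> \<tau> \<theta> = ?d"
    using endo_K[OF \<tau> \<theta>(2)] endo_diff[OF \<tau>, of "\<theta> [^] p" \<theta>] endo_pow[OF \<tau> \<theta>(1)] \<theta>(1) by simp
  have "?t [^] p = \<tau> \<theta> [^] p \<ominus> \<theta> [^] p"
    by (rule frobenius_diff[OF prime_p p_one \<tau>\<theta> \<theta>(1)])
  also have "\<dots> = ((\<tau> \<theta> [^] p \<ominus> \<tau> \<theta>) \<ominus> (\<theta> [^] p \<ominus> \<theta>)) \<oplus> ?t"
  proof -
    have "a \<ominus> b = ((a \<ominus> a') \<ominus> (b \<ominus> b')) \<oplus> (a' \<ominus> b')"
      if "a \<in> carrier L" "b \<in> carrier L" "a' \<in> carrier L" "b' \<in> carrier L" for a b a' b'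
      using that by algebra
    from this[of "\<tau> \<theta> [^] p" "\<theta> [^] p" "\<tau> \<theta>" \<theta>] show ?thesis using \<tau>\<theta> \<theta>(1) by auto
  qed
  also have "\<dots> = ?t" unfolding d using \<theta>(1) \<tau>\<theta> by (simp add: a_minus_def r_neg)
  finally have tp: "?t [^] p = ?t" .
  have tL: "?t \<in> carrier L" using \<theta>(1) \<tau>\<theta> by simp
  show ?thesis
  proof (cases "?t = \<zero>")
    case False
    obtain q where q: "p = Suc q" "0 < q" using p_Suc by blast
    have "?t [^] q \<otimes> ?t = \<one> \<otimes> ?t" using tp tL unfolding q(1) by simp
    then have "?t [^] q = \<one>" using m_rcancel[OF False tL, of "?t [^] q" \<one>] tL by simp
    then show ?thesis using Ov_power_imp[OF tL _ q(2)] by simp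
  qed simp
qed

text \<open>The quotient (\<sigma> b - b)/b does not change when b is scaled by an element of K, so
  b may be assumed a unit of O_L. Then \<open>endo_congruence\<close> for the ideal (c) leaves only
  \<sigma>(c \<theta>) - c \<theta>, a multiple of c. Conversely b = \<theta> contributes
  \<open>inv \<theta>\<close>, and c is its product with the integral element c \<theta>.\<close>

lemma ramification_ideal_eq:
  assumes \<theta>: "\<theta> \<in> carrier L" "\<theta> \<notin> Ov" "\<theta> [^] p \<ominus> \<theta> \<in> K"
    and \<tau>: "\<tau> \<in> Gal L K" "\<tau> \<theta> = \<theta> \<oplus> \<one>"
    and c: "c \<in> K" "c \<in> Ov" "residual_generator (c \<otimes> \<theta>)"
  shows "ramification_ideal L K v = PIdl\<^bsub>val_ring L v\<^esub> c"
proof -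
  let ?B = "val_ring L v"
  note ring = cring.axioms(1)[OF val_cring]
  have cL: "c \<in> carrier L" using c(2) by simp
  have cB: "c \<in> carrier ?B" using c(2) by simp
  have idc: "ideal (PIdl\<^bsub>?B\<^esub> c) ?B" by (rule cring.cgenideal_ideal[OF val_cring cB])
  have diff: "\<sigma>' b \<ominus> b \<in> PIdl\<^bsub>?B\<^esub> c" if \<sigma>: "K_endo \<sigma>'" and b: "b \<in> Ov" for \<sigma>' b
  proof (rule endo_congruence[OF \<sigma> idc c(3) _ b])
    have "\<sigma>' (c \<otimes> \<theta>) \<ominus> c \<otimes> \<theta> = (\<sigma>' \<theta> \<ominus> \<theta>) \<otimes> c"
      unfolding endo_mult[OF \<sigma> cL \<theta>(1)] endo_K[OF \<sigma> c(1)]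
      using cL \<theta>(1) endo_closed[OF \<sigma> \<theta>(1)] by algebra
    then show "\<sigma>' (c \<otimes> \<theta>) \<ominus> c \<otimes> \<theta> \<in> PIdl\<^bsub>?B\<^esub> c"
      using PIdl_I[OF Gal_difference[OF \<sigma> \<theta>(1,3)], of c] by simp
  qed
  let ?G = "{(\<sigma> b \<ominus> b) \<otimes> inv b | \<sigma> b. \<sigma> \<in> Gal L K \<and> b \<in> carrier L - {\<zero>}}"
  have G: "?G \<subseteq> PIdl\<^bsub>?B\<^esub> c"
  proof
    fix g assume "g \<in> ?G"
    then obtain \<sigma>' b where g: "g = (\<sigma>' b \<ominus> b) \<otimes> inv b" and \<sigma>': "\<sigma>' \<in> Gal L K"
      and b: "b \<in> carrier L" "b \<noteq> \<zero>" by blast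
    have \<sigma>: "K_endo \<sigma>'" using Gal_K_endo[OF \<sigma>'] .
    obtain a where a: "a \<in> K" "a \<noteq> \<zero>" "b \<otimes> a \<in> Ov" "b \<otimes> a \<notin> Mv"
      using value_group[OF b] by blast
    let ?u = "b \<otimes> a"
    have aL: "a \<in> carrier L" using a(1) by simp
    note u = Ov_unit_inv[OF a(3,4)]
    note iu = inv_facts[OF Ov_closed[OF a(3)] u(1)]
    note ib = inv_facts[OF b]
    have \<sigma>b: "\<sigma>' b \<in> carrier L" using endo_closed[OF \<sigma> b(1)] .
    have "inv b = a \<otimes> inv ?u"
    proof -
      have "inv b = inv b \<otimes> (?u \<otimes> inv ?u)" using ib(1) iu(3) by simp
      also have "\<dots> = (inv b \<otimes> b) \<otimes> (a \<otimes> inv ?u)" using ib(1) b(1) aL iu(1) by (simp add: m_ac)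
      finally show ?thesis using ib(4) aL iu(1) by simp
    qed
    then have "g = (\<sigma>' b \<ominus> b) \<otimes> (a \<otimes> inv ?u)" using g by simp
    also have "\<dots> = (\<sigma>' b \<otimes> a \<ominus> ?u) \<otimes> inv ?u" using \<sigma>b b(1) aL iu(1) by algebra
    also have "\<sigma>' b \<otimes> a = \<sigma>' ?u" using endo_mult[OF \<sigma> b(1) aL] endo_K[OF \<sigma> a(1)] by simp
    finally have g': "g = (\<sigma>' ?u \<ominus> ?u) \<otimes> inv ?u" .
    obtain r where r: "r \<in> Ov" "\<sigma>' ?u \<ominus> ?u = r \<otimes> c" using diff[OF \<sigma> a(3)] unfolding PIdl_iff by blast
    have "g = (r \<otimes> inv ?u) \<otimes> c" unfolding g' r(2) using r(1) cL iu(1) by (simp add: m_ac)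
    also have "\<dots> \<in> PIdl\<^bsub>?B\<^esub> c" by (rule PIdl_I) (use r(1) u(2) in simp)
    finally show "g \<in> PIdl\<^bsub>?B\<^esub> c" .
  qed
  have sub1: "Idl\<^bsub>?B\<^esub> ?G \<subseteq> PIdl\<^bsub>?B\<^esub> c" by (rule ring.genideal_minimal[OF ring idc G])
  have GB: "?G \<subseteq> carrier ?B"
    using G additive_subgroup.a_subset[OF ideal.axioms(1)[OF idc]] by blast
  note i\<theta> = inv_in_Mv[OF \<theta>(1,2)]
  note i\<theta>' = inv_facts[OF \<theta>(1) i\<theta>(1)]
  have "(\<tau> \<theta> \<ominus> \<theta>) \<otimes> inv \<theta> = inv \<theta>"
  proof -
    have "(\<theta> \<oplus> \<one>) \<ominus> \<theta> = \<one>" using \<theta>(1) by algebra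
    then show ?thesis unfolding \<tau>(2) using i\<theta>'(1) by simp
  qed
  then have "inv \<theta> \<in> ?G" using \<tau>(1) \<theta>(1) i\<theta>(1) by (intro CollectI exI[of _ \<tau>] exI[of _ \<theta>]) simp
  then have i\<theta>I: "inv \<theta> \<in> Idl\<^bsub>?B\<^esub> ?G" using ring.genideal_self[OF ring GB] by blast
  have idG: "ideal (Idl\<^bsub>?B\<^esub> ?G) ?B" by (rule ring.genideal_ideal[OF ring GB])
  have "c \<otimes> \<theta> \<otimes>\<^bsub>?B\<^esub> inv \<theta> \<in> Idl\<^bsub>?B\<^esub> ?G"
    using ideal.I_l_closed[OF idG i\<theta>I, of "c \<otimes> \<theta>"] residual_generator_closed(1)[OF c(3)] by simp
  moreover have "c \<otimes> \<theta> \<otimes> inv \<theta> = c" using cL \<theta>(1) i\<theta>' by (simp add: m_assoc)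
  ultimately have "c \<in> Idl\<^bsub>?B\<^esub> ?G" by simp
  then have "PIdl\<^bsub>?B\<^esub> c \<subseteq> Idl\<^bsub>?B\<^esub> ?G" by (rule ring.cgenideal_minimal[OF ring idG])
  then show ?thesis unfolding ramification_ideal_def using sub1 by (rule subset_antisym[rotated])
qed

section \<open>The formal derivative and the differentials of O_L over O_K\<close>

text \<open>The formal derivative with respect to the basis of powers of \<open>\<eta>\<close> satisfies
  \<open>D (\<eta> b) = \<eta> D b + b\<close> up to the coefficient \<open>e\<close> of the minimal polynomial, hence the
  Leibniz rule modulo \<open>e\<close>.\<close>

lemma derivation_ex:
  assumes \<eta>: "residual_generator \<eta>"
    and e: "e \<in> K" "e \<in> Ov" and u: "u \<in> K" and min_poly: "\<eta> [^] p = e \<otimes> \<eta> \<oplus> u"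
  shows "\<exists>D. (\<forall>b\<in>Ov. D b \<in> Ov) \<and>
    (\<forall>b\<in>carrier L. \<forall>c\<in>carrier L. D (b \<oplus> c) = D b \<oplus> D c) \<and> (\<forall>a\<in>K. D a = \<zero>) \<and> D \<eta> = \<one> \<and>
    (\<forall>b\<in>Ov. \<forall>c\<in>Ov. D (b \<otimes> c) \<ominus> (b \<otimes> D c \<oplus> c \<otimes> D b) \<in> PIdl\<^bsub>val_ring L v\<^esub> e)"
proof -
  note g = residual_generator_closed[OF \<eta>]
  have eL: "e \<in> carrier L" and uL: "u \<in> carrier L" using e u by simp_all
  let ?J = "PIdl\<^bsub>val_ring L v\<^esub> e"
  have idJ: "ideal ?J (val_ring L v)"
    by (rule cring.cgenideal_ideal[OF val_cring]) (use e(2) in simp)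
  note J = ideal_zero[OF idJ] ideal_add[OF idJ] ideal_mult[OF idJ] ideal_diff[OF idJ]
    ideal_finsum[OF idJ]
  obtain q where q: "p = Suc q" "0 < q" using p_Suc by blast
  \<comment> \<open>The truncated exponent \<open>i - 1\<close> at i = 0 is harmless, as the
    multiple there is 0.\<close>
  have "\<exists>D. (\<forall>b\<in>carrier L. D b \<in> carrier L) \<and>
      (\<forall>b\<in>carrier L. \<forall>c\<in>carrier L. D (b \<oplus> c) = D b \<oplus> D c) \<and>
      (\<forall>a\<in>K. \<forall>b\<in>carrier L. D (a \<otimes> b) = a \<otimes> D b) \<and>
      (\<forall>i<p. D (\<eta> [^] i) = [i] \<cdot> (\<eta> [^] (i - 1)))"
    by (rule prime_degree_extension.linear_map_ex[OF ext g(2,5)]) (use g(2) in simp)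
  then obtain D where "(\<forall>b\<in>carrier L. D b \<in> carrier L) \<and>
      (\<forall>b\<in>carrier L. \<forall>c\<in>carrier L. D (b \<oplus> c) = D b \<oplus> D c) \<and>
      (\<forall>a\<in>K. \<forall>b\<in>carrier L. D (a \<otimes> b) = a \<otimes> D b) \<and>
      (\<forall>i<p. D (\<eta> [^] i) = [i] \<cdot> (\<eta> [^] (i - 1)))" by blast
  then have D_closed: "\<And>b. b \<in> carrier L \<Longrightarrow> D b \<in> carrier L"
    and D_add: "\<And>b c. b \<in> carrier L \<Longrightarrow> c \<in> carrier L \<Longrightarrow> D (b \<oplus> c) = D b \<oplus> D c"
    and D_smult: "\<And>a b. a \<in> K \<Longrightarrow> b \<in> carrier L \<Longrightarrow> D (a \<otimes> b) = a \<otimes> D b"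
    and D_pow: "\<And>i. i < p \<Longrightarrow> D (\<eta> [^] i) = [i] \<cdot> (\<eta> [^] (i - 1))" by simp_all
  \<comment> \<open>Stated for arbitrary K-linear f because it serves both D and the error term
    \<open>?E\<close>.\<close>
  have linear_sum: "f (\<Oplus>i\<in>{..<n}. a i \<otimes> \<eta> [^] i) = (\<Oplus>i\<in>{..<n}. a i \<otimes> f (\<eta> [^] i))"
    if f: "\<And>b. b \<in> carrier L \<Longrightarrow> f b \<in> carrier L"
      "\<And>b c. b \<in> carrier L \<Longrightarrow> c \<in> carrier L \<Longrightarrow> f (b \<oplus> c) = f b \<oplus> f c"
      "\<And>a b. a \<in> K \<Longrightarrow> b \<in> carrier L \<Longrightarrow> f (a \<otimes> b) = a \<otimes> f b"
      and a: "\<And>i. a i \<in> K" for f a and n :: nat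
  proof (induction n)
    case 0
    have "f (\<zero> \<otimes> \<zero>) = \<zero> \<otimes> f \<zero>" by (rule f(3)) simp_all
    then show ?case using f(1)[OF zero_closed] by simp
  next
    case (Suc n)
    let ?s = "\<Oplus>i\<in>{..<n}. a i \<otimes> \<eta> [^] i"
    have c: "a i \<in> carrier L" "\<eta> [^] i \<in> carrier L" for i :: nat using a g(2) by simp_all
    have s: "?s \<in> carrier L" using c by (intro finsum_closed) auto
    have "f (\<Oplus>i\<in>{..<Suc n}. a i \<otimes> \<eta> [^] i) = f (a n \<otimes> \<eta> [^] n \<oplus> ?s)"
      unfolding lessThan_Suc using c by (subst finsum_insert) auto
    also have "\<dots> = a n \<otimes> f (\<eta> [^] n) \<oplus> (\<Oplus>i\<in>{..<n}. a i \<otimes> f (\<eta> [^] i))"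
      using c s Suc by (simp add: f(2) f(3)[OF a])
    also have "\<dots> = (\<Oplus>i\<in>{..<Suc n}. a i \<otimes> f (\<eta> [^] i))"
      unfolding lessThan_Suc using c f(1) by (subst finsum_insert) auto
    finally show ?case .
  qed
  have coords: "\<exists>a. (\<forall>i. a i \<in> K) \<and> b = (\<Oplus>i\<in>{..<p}. a i \<otimes> \<eta> [^] i) \<and> (\<forall>i<p. a i \<in> Ov)"
    if b: "b \<in> Ov" for b
  proof -
    obtain a where a: "\<forall>i. a i \<in> K" "b = (\<Oplus>i\<in>{..<p}. a i \<otimes> \<eta> [^] i)"
      using power_basis_ex[OF g(2,5) Ov_closed[OF b]] by blast
    have aK: "a i \<in> K" for i using a(1) by blast
    have "a i \<in> Ov" if "i < p" for i by (rule combination_integral[OF \<eta> aK a(2) b that])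
    then show ?thesis using a by blast
  qed
  have D_Ov: "D b \<in> Ov" if b: "b \<in> Ov" for b
  proof -
    obtain a where a: "\<forall>i. a i \<in> K" "b = (\<Oplus>i\<in>{..<p}. a i \<otimes> \<eta> [^] i)" "\<forall>i<p. a i \<in> Ov"
      using coords[OF b] by blast
    have "D b = (\<Oplus>i\<in>{..<p}. a i \<otimes> D (\<eta> [^] i))"
      unfolding a(2) by (rule linear_sum[OF D_closed D_add D_smult]) (use a(1) in auto)
    also have "\<dots> \<in> Ov"
      using a(3) g(1) D_pow by (intro Ov_finsum) (auto intro!: Ov_simps(4) Ov_add_pow)
    finally show ?thesis .
  qed
  have D_one: "D \<one> = \<zero>" using D_pow[of 0] q by simp
  have D_\<eta>: "D \<eta> = \<one>" using D_pow[of 1] q g(2) by simp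
  have D_K: "D a = \<zero>" if a: "a \<in> K" for a
    using D_smult[OF a one_closed] D_one a by simp
  \<comment> \<open>The defect of the Leibniz rule for products with \<eta>. It is K-linear, hence
    determined by the first p powers of \<eta>, and it vanishes on all of them but the last.\<close>
  let ?E = "\<lambda>b. D (\<eta> \<otimes> b) \<ominus> (\<eta> \<otimes> D b \<oplus> b)"
  have E_closed: "?E b \<in> carrier L" if "b \<in> carrier L" for b using that D_closed g(2) by simp
  have E_add: "?E (b \<oplus> c) = ?E b \<oplus> ?E c" if b: "b \<in> carrier L" and c: "c \<in> carrier L" for b c
  proof -
    have 1: "D (\<eta> \<otimes> (b \<oplus> c)) = D (\<eta> \<otimes> b) \<oplus> D (\<eta> \<otimes> c)" using b c g(2) by (simp add: r_distr D_add)
    have cl: "D (\<eta> \<otimes> b) \<in> carrier L" "D (\<eta> \<otimes> c) \<in> carrier L" "D b \<in> carrier L" "D c \<in> carrier L"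
      using b c g(2) D_closed by simp_all
    show ?thesis unfolding 1 D_add[OF b c] using cl b c g(2) by algebra
  qed
  have E_smult: "?E (a \<otimes> b) = a \<otimes> ?E b" if a: "a \<in> K" and b: "b \<in> carrier L" for a b
  proof -
    have aL: "a \<in> carrier L" using a by simp
    have "\<eta> \<otimes> (a \<otimes> b) = a \<otimes> (\<eta> \<otimes> b)" using aL b g(2) by (simp add: m_ac)
    then have 1: "D (\<eta> \<otimes> (a \<otimes> b)) = a \<otimes> D (\<eta> \<otimes> b)" using D_smult[OF a, of "\<eta> \<otimes> b"] b g(2) by simp
    have cl: "D (\<eta> \<otimes> b) \<in> carrier L" "D b \<in> carrier L" using b g(2) D_closed by simp_all
    show ?thesis unfolding 1 D_smult[OF a b] using cl aL b g(2) by algebra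
  qed
  have E_pow: "?E (\<eta> [^] i) \<in> ?J" if i: "i < p" for i
  proof -
    have pc: "\<eta> [^] j \<in> carrier L" "[j] \<cdot> (\<eta> [^] j) \<in> carrier L" for j :: nat using g(2) by simp_all
    have "\<eta> \<otimes> ([i] \<cdot> (\<eta> [^] (i - 1))) = [i] \<cdot> (\<eta> \<otimes> \<eta> [^] (i - 1))"
      by (rule add_pow_rdistr) (use g(2) in simp_all)
    also have "\<dots> = [i] \<cdot> (\<eta> [^] i)" using g(2) by (cases i) (simp_all add: m_comm)
    finally have 1: "\<eta> \<otimes> D (\<eta> [^] i) \<oplus> \<eta> [^] i = [Suc i] \<cdot> (\<eta> [^] i)" using D_pow[OF i] by simp
    have 2: "\<eta> \<otimes> \<eta> [^] i = \<eta> [^] Suc i" using g(2) by (simp add: m_comm)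
    show ?thesis
    proof (cases "i = q")
      \<comment> \<open>Here \<eta>^p is rewritten by the minimal polynomial: D gives e, while the
        Leibniz side is p \<eta>^(p-1) = 0.\<close>
      case True
      have "[Suc i] \<cdot> (\<eta> [^] i) = \<zero>"
        unfolding True q(1)[symmetric] by (rule add_pow_eq_zero_of_dvd[OF p_one]) (use g(2) in simp_all)
      moreover have "D (\<eta> [^] Suc i) = e"
        unfolding True q(1)[symmetric] min_poly
        using D_add[of "e \<otimes> \<eta>" u] D_smult[OF e(1) g(2)] D_K[OF u] D_\<eta> eL uL g(2) by simp
      ultimately have "?E (\<eta> [^] i) = \<one> \<otimes> e" unfolding 1 2 using eL by (simp add: a_minus_def)
      also have "\<dots> \<in> ?J" by (rule PIdl_I) simp
      finally show ?thesis .
    next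
      case False
      then have "D (\<eta> [^] Suc i) = [Suc i] \<cdot> (\<eta> [^] i)" using D_pow[of "Suc i"] i q(1) by simp
      then have "?E (\<eta> [^] i) = \<zero>" unfolding 1 2 using pc(1)[of i] by (simp add: a_minus_def r_neg)
      then show ?thesis using J(1) by simp
    qed
  qed
  have E_J: "?E b \<in> ?J" if b: "b \<in> Ov" for b
  proof -
    obtain a where a: "\<forall>i. a i \<in> K" "b = (\<Oplus>i\<in>{..<p}. a i \<otimes> \<eta> [^] i)" "\<forall>i<p. a i \<in> Ov"
      using coords[OF b] by blast
    have "?E b = (\<Oplus>i\<in>{..<p}. a i \<otimes> ?E (\<eta> [^] i))"
      unfolding a(2) by (rule linear_sum[OF E_closed E_add E_smult]) (use a(1) in auto)
    also have "\<dots> \<in> ?J" using a(3) E_pow by (intro J(5) J(3)) auto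
    finally show ?thesis .
  qed
  let ?\<Delta> = "\<lambda>b c. D (b \<otimes> c) \<ominus> (b \<otimes> D c \<oplus> c \<otimes> D b)"
  let ?S = "{b \<in> Ov. \<forall>c\<in>Ov. ?\<Delta> b c \<in> ?J}"
  have AS: "val_set v K \<subseteq> ?S"
  proof
    fix a assume "a \<in> val_set v K"
    then have a: "a \<in> K" "a \<in> Ov" by (simp_all add: val_set_K)
    have "?\<Delta> a c = \<zero>" if c: "c \<in> Ov" for c
      unfolding D_smult[OF a(1) Ov_closed[OF c]] D_K[OF a(1)]
      using D_closed[OF Ov_closed[OF c]] a(2) c by (simp add: a_minus_def r_neg)
    then show "a \<in> ?S" using a(2) J(1) by simp
  qed
  have S_mult: "x \<otimes> y \<in> ?S" if x: "x \<in> ?S" and y: "y \<in> ?S" for x y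
  proof -
    have xO: "x \<in> Ov" and yO: "y \<in> Ov" using x y by blast+
    have "?\<Delta> (x \<otimes> y) c \<in> ?J" if c: "c \<in> Ov" for c
    proof -
      have cl: "x \<in> carrier L" "y \<in> carrier L" "c \<in> carrier L" using xO yO c by simp_all
      then have Dcl: "D x \<in> carrier L" "D y \<in> carrier L" "D c \<in> carrier L" "D (x \<otimes> y) \<in> carrier L"
        "D (y \<otimes> c) \<in> carrier L" "D (x \<otimes> (y \<otimes> c)) \<in> carrier L" by (simp_all add: D_closed)
      have "D (x \<otimes> y \<otimes> c) = D (x \<otimes> (y \<otimes> c))" using cl by (simp add: m_assoc)
      \<comment> \<open>The cocycle identity of the defect: it makes the elements that obey the
        Leibniz rule against every c closed under products.\<close>
      then have "?\<Delta> (x \<otimes> y) c = (?\<Delta> x (y \<otimes> c) \<oplus> x \<otimes> ?\<Delta> y c) \<ominus> c \<otimes> ?\<Delta> x y"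
        using cl Dcl by algebra
      also have "\<dots> \<in> ?J"
      proof (rule J(4)[OF J(2)[OF _ J(3)[OF xO]] J(3)[OF c]])
        show "?\<Delta> x (y \<otimes> c) \<in> ?J" using x Ov_simps(4)[OF yO c] by blast
        show "?\<Delta> y c \<in> ?J" using y c by blast
        show "?\<Delta> x y \<in> ?J" using x yO by blast
      qed
      finally show ?thesis .
    qed
    then show ?thesis using xO yO by simp
  qed
  have "subring ?S L"
  proof (rule subringI)
    show "?S \<subseteq> carrier L" using Ov_closed by blast
    show "\<one> \<in> ?S" by (rule subsetD[OF AS]) (simp add: val_set_K)
    fix x assume x: "x \<in> ?S"
    have "\<ominus> \<one> \<in> ?S" by (rule subsetD[OF AS]) (simp add: val_set_K)
    from S_mult[OF this x] show "\<ominus> x \<in> ?S" using x by (simp add: l_minus)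
    fix y assume y: "y \<in> ?S"
    show "x \<otimes> y \<in> ?S" by (rule S_mult[OF x y])
    have xO: "x \<in> Ov" and yO: "y \<in> Ov" using x y by blast+
    have "?\<Delta> (x \<oplus> y) c \<in> ?J" if c: "c \<in> Ov" for c
    proof -
      have cl: "x \<in> carrier L" "y \<in> carrier L" "c \<in> carrier L" using xO yO c by simp_all
      then have Dcl: "D x \<in> carrier L" "D y \<in> carrier L" "D c \<in> carrier L"
        "D (x \<otimes> c) \<in> carrier L" "D (y \<otimes> c) \<in> carrier L" by (simp_all add: D_closed)
      have 1: "D ((x \<oplus> y) \<otimes> c) = D (x \<otimes> c) \<oplus> D (y \<otimes> c)" using cl by (simp add: l_distr D_add)
      have "?\<Delta> (x \<oplus> y) c = ?\<Delta> x c \<oplus> ?\<Delta> y c"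
        unfolding 1 D_add[OF cl(1,2)] using cl Dcl by algebra
      also have "\<dots> \<in> ?J" using x y c by (intro J(2)) auto
      finally show ?thesis .
    qed
    then show "x \<oplus> y \<in> ?S" using xO yO by simp
  qed
  moreover have "\<eta> \<in> ?S"
  proof -
    have "?\<Delta> \<eta> c \<in> ?J" if c: "c \<in> Ov" for c using E_J[OF c] c unfolding D_\<eta> by simp
    then show ?thesis using g(1) by simp
  qed
  ultimately have "Ov \<subseteq> ?S" using AS by (intro Ov_subset_subring[OF \<eta>])
  then have "\<forall>b\<in>Ov. \<forall>c\<in>Ov. ?\<Delta> b c \<in> ?J" by blast
  then show ?thesis using D_Ov D_add D_K D_\<eta> by blast
qed

text \<open>Two bounds meet at e = c^(p-1): the equation of \<eta> = c \<theta> shows that e d\<eta>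
  vanishes, and the formal derivative is a derivation modulo e, so \<open>monogenic\<close> applies.
  The ideal (e) is proper because c lies in \<open>Mv\<close> and p - 1 > 0.\<close>

lemma kaehler_isomorphic:
  assumes \<theta>: "\<theta> \<in> carrier L" "\<theta> [^] p \<ominus> \<theta> \<in> K"
    and c: "c \<in> K" "c \<in> Mv" and \<eta>: "residual_generator (c \<otimes> \<theta>)"
  shows "module_isomorphic (val_ring L v) (kaehler_differentials (val_ring L v) (val_set v K))
      (quotient_module (ring_as_module (val_ring L v)) (PIdl\<^bsub>val_ring L v\<^esub> (c [^] (p - 1))))"
    and "carrier (kaehler_differentials (val_ring L v) (val_set v K)) \<noteq>
      {\<zero>\<^bsub>kaehler_differentials (val_ring L v) (val_set v K)\<^esub>}"
proof -
  let ?B = "val_ring L v" and ?A = "val_set v K" and ?\<eta> = "c \<otimes> \<theta>"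
  note g = residual_generator_closed[OF \<eta>]
  obtain q where q: "p = Suc q" "0 < q" using p_Suc by blast
  have cO: "c \<in> Ov" using Mv_Ov[OF c(2)] .
  have cL: "c \<in> carrier L" using cO by simp
  define e where "e = c [^] q"
  define u where "u = c [^] p \<otimes> (\<theta> [^] p \<ominus> \<theta>)"
  have e: "e \<in> K" "e \<in> Ov" "e \<in> Mv" unfolding e_def using K_pow[OF c(1)] cO Mv_pow[OF c(2) q(2)] by simp_all
  have eL: "e \<in> carrier L" using e(2) by simp
  have uK: "u \<in> K" unfolding u_def using K_pow[OF c(1)] \<theta>(2) K_intros(2) by blast
  have min_poly: "?\<eta> [^] p = e \<otimes> ?\<eta> \<oplus> u"
  proof -
    have ec: "e \<otimes> c = c [^] p" unfolding e_def q(1) by simp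
    have "e \<otimes> ?\<eta> \<oplus> u = (e \<otimes> c) \<otimes> \<theta> \<oplus> u" using eL cL \<theta>(1) by (simp add: m_assoc)
    also have "\<dots> = c [^] p \<otimes> \<theta> \<oplus> c [^] p \<otimes> (\<theta> [^] p \<ominus> \<theta>)" unfolding ec u_def ..
    also have "\<dots> = c [^] p \<otimes> \<theta> [^] p"
    proof -
      have "r \<otimes> s \<oplus> r \<otimes> (t \<ominus> s) = r \<otimes> t"
        if "r \<in> carrier L" "s \<in> carrier L" "t \<in> carrier L" for r s t using that by algebra
      then show ?thesis using cL \<theta>(1) by simp
    qed
    also have "\<dots> = ?\<eta> [^] p" using nat_pow_distrib[OF cL \<theta>(1)] by simp
    finally show ?thesis by simp
  qed
  \<comment> \<open>\<theta>^p - \<theta> need not be integral; u is, being \<eta>^p - e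
    \<eta>.\<close>
  have u: "u \<in> Ov"
  proof -
    have uL: "u \<in> carrier L" using uK by simp
    have "u = (e \<otimes> ?\<eta> \<oplus> u) \<ominus> e \<otimes> ?\<eta>" using uL eL g(2) by algebra
    also have "\<dots> \<in> Ov" unfolding min_poly[symmetric] using g(1) e(2) by simp
    finally show ?thesis .
  qed
  obtain D where D: "\<forall>b\<in>Ov. D b \<in> Ov"
    "\<forall>b\<in>carrier L. \<forall>c\<in>carrier L. D (b \<oplus> c) = D b \<oplus> D c" "\<forall>a\<in>K. D a = \<zero>" "D ?\<eta> = \<one>"
    "\<forall>b\<in>Ov. \<forall>c\<in>Ov. D (b \<otimes> c) \<ominus> (b \<otimes> D c \<oplus> c \<otimes> D b) \<in> PIdl\<^bsub>val_ring L v\<^esub> e"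
    using derivation_ex[OF \<eta> e(1,2) uK min_poly] by blast
  have kaehler: "kaehler ?B ?A"
    by (rule kaehler.intro[OF val_cring kaehler_axioms.intro[OF val_set_subring[OF subfieldE(1)[OF K_subfield]]]])
  let ?F = "free_module ?B (carrier ?B)" and ?N = "kaehler.N ?B ?A"
  have \<eta>B: "?\<eta> \<in> carrier ?B" using g(1) by simp
  have eA: "e \<in> ?A" and uA: "u \<in> ?A" using e uK u by (simp_all add: val_set_K)
  have "e \<odot>\<^bsub>?F\<^esub> free_gen ?B ?\<eta> \<in> ?N"
  proof (rule kaehler.min_poly_derivative_in_N[OF kaehler _ _ \<eta>B eA uA])
    show "[p] \<cdot>\<^bsub>?B\<^esub> \<one>\<^bsub>?B\<^esub> = \<zero>\<^bsub>?B\<^esub>" using p_one by (simp add: add_pow_def nat_pow_def)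
    show "0 < p" using q by simp
    show "?\<eta> [^]\<^bsub>?B\<^esub> p = e \<otimes>\<^bsub>?B\<^esub> ?\<eta> \<oplus>\<^bsub>?B\<^esub> u" using min_poly by (simp add: val_pow)
  qed
  then have JN: "j \<odot>\<^bsub>?F\<^esub> free_gen ?B ?\<eta> \<in> ?N" if j: "j \<in> PIdl\<^bsub>?B\<^esub> e" for j
  proof -
    obtain r where r: "r \<in> Ov" "j = r \<otimes> e" using j unfolding PIdl_iff by blast
    have "r \<odot>\<^bsub>?F\<^esub> (e \<odot>\<^bsub>?F\<^esub> free_gen ?B ?\<eta>) \<in> ?N"
      using module.submoduleE(4)[OF kaehler.F_module[OF kaehler] kaehler.N_submodule[OF kaehler]]
        r(1) \<open>e \<odot>\<^bsub>?F\<^esub> free_gen ?B ?\<eta> \<in> ?N\<close> by simp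
    moreover have "r \<odot>\<^bsub>?F\<^esub> (e \<odot>\<^bsub>?F\<^esub> free_gen ?B ?\<eta>) = j \<odot>\<^bsub>?F\<^esub> free_gen ?B ?\<eta>"
      using module.smult_assoc1[OF kaehler.F_module[OF kaehler], of r e "free_gen ?B ?\<eta>"]
        kaehler.d_closed[OF kaehler \<eta>B] r e(2) by simp
    ultimately show ?thesis by simp
  qed
  have gen: "carrier ?B \<subseteq> S" if "subring S ?B" "?A \<subseteq> S" "?\<eta> \<in> S" for S
    using Ov_subset_subring[OF \<eta> val_subring_L[OF that(1)] that(3,2)] by simp
  have idJ: "ideal (PIdl\<^bsub>?B\<^esub> e) ?B"
    by (rule cring.cgenideal_ideal[OF val_cring]) (use e(2) in simp)
  note J = ideal_zero[OF idJ]
  have zero_diff: "x \<ominus>\<^bsub>?B\<^esub> x \<in> PIdl\<^bsub>?B\<^esub> e" if "x \<in> Ov" for x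
    unfolding val_minus[OF that that] using that J by (simp add: a_minus_def r_neg)
  have D_closed: "D x \<in> carrier ?B" if "x \<in> carrier ?B" for x using D(1) that by simp
  have D_add: "D (x \<oplus>\<^bsub>?B\<^esub> y) \<ominus>\<^bsub>?B\<^esub> (D x \<oplus>\<^bsub>?B\<^esub> D y) \<in> PIdl\<^bsub>?B\<^esub> e"
    if "x \<in> carrier ?B" "y \<in> carrier ?B" for x y
    using D(1,2) that zero_diff[of "D x \<oplus> D y"] by simp
  have D_mult: "D (x \<otimes>\<^bsub>?B\<^esub> y) \<ominus>\<^bsub>?B\<^esub> (x \<otimes>\<^bsub>?B\<^esub> D y \<oplus>\<^bsub>?B\<^esub> y \<otimes>\<^bsub>?B\<^esub> D x) \<in> PIdl\<^bsub>?B\<^esub> e"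
    if "x \<in> carrier ?B" "y \<in> carrier ?B" for x y
    using D(1,5) that by (simp add: val_minus)
  have D_A: "D a \<in> PIdl\<^bsub>?B\<^esub> e" if "a \<in> ?A" for a using D(3) that J by (simp add: val_set_K)
  have D_\<eta>: "D ?\<eta> \<ominus>\<^bsub>?B\<^esub> \<one>\<^bsub>?B\<^esub> \<in> PIdl\<^bsub>?B\<^esub> e" using D(4) zero_diff[of \<one>] by simp
  note main = kaehler.monogenic[OF kaehler \<eta>B gen idJ JN D_closed D_add D_mult D_A D_\<eta>]
  have p1: "p - 1 = q" using q by simp
  show "module_isomorphic ?B (kaehler_differentials ?B ?A)
      (quotient_module (ring_as_module ?B) (PIdl\<^bsub>?B\<^esub> (c [^] (p - 1))))"
    unfolding p1 e_def[symmetric] by (rule main(1))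
  have "\<one> \<notin> PIdl\<^bsub>?B\<^esub> e"
  proof
    assume "\<one> \<in> PIdl\<^bsub>?B\<^esub> e"
    then obtain r where r: "r \<in> Ov" "\<one> = r \<otimes> e" unfolding PIdl_iff by blast
    then have "\<one> \<in> Mv" using Mv_mult[OF r(1) e(3)] by simp
    then show False by simp
  qed
  then have "\<one>\<^bsub>?B\<^esub> \<notin> PIdl\<^bsub>?B\<^esub> e" by simp
  then show "carrier (kaehler_differentials ?B ?A) \<noteq> {\<zero>\<^bsub>kaehler_differentials ?B ?A\<^esub>}"
    by (rule main(2)[rotated -1])
qed

end

theorem theorem4p5:
  fixes L :: "('a, 'b) ring_scheme" and K :: "'a set"
    and v :: "'a \<Rightarrow> 'g::linordered_ab_group_add extended" and p :: nat
  assumes "krull_valuation L v"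
    and "artin_schreier_extension p L K"
    and "ring.dimension (residue_field L v) p (residue_subfield L v K) (carrier (residue_field L v))"
    and "inseparable_extension (residue_field L v) (residue_subfield L v K)"
  shows "(\<exists>\<theta> c.
            artin_schreier_generator p L K \<theta> \<and> v \<theta> < 0 \<and> c \<in> K \<and>
            v (c \<otimes>\<^bsub>L\<^esub> \<theta>) = 0 \<and>
            carrier (residue_field L v) =
              generate_field (residue_field L v)
                (insert (residue L v (c \<otimes>\<^bsub>L\<^esub> \<theta>)) (residue_subfield L v K)) \<and>
            carrier (val_ring L v) = generate_ring L (insert (c \<otimes>\<^bsub>L\<^esub> \<theta>) (val_set v K)) \<and>
            module_isomorphic (val_ring L v)
              (kaehler_differentials (val_ring L v) (val_set v K))
              (quotient_module (ring_as_module (val_ring L v))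
                (PIdl\<^bsub>val_ring L v\<^esub> (c [^]\<^bsub>L\<^esub> (p - 1)))) \<and>
            module_isomorphic (val_ring L v)
              (quotient_module (ring_as_module (val_ring L v))
                (PIdl\<^bsub>val_ring L v\<^esub> (c [^]\<^bsub>L\<^esub> (p - 1))))
              (quotient_module
                ((ring_as_module (val_ring L v))\<lparr>carrier := ramification_ideal L K v\<rparr>)
                (ramification_ideal L K v [^]\<^bsub>ideals_set (val_ring L v)\<^esub> p))) \<and>
         carrier (kaehler_differentials (val_ring L v) (val_set v K))
           \<noteq> {\<zero>\<^bsub>kaehler_differentials (val_ring L v) (val_set v K)\<^esub>}"
proof -
  interpret residually_inseparable L v K p
    by (rule residually_inseparable.intro[OF assms(1) residually_inseparable_axioms.intro[OF assms(2-4)]])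
  obtain \<tau> \<theta> c where \<tau>: "\<tau> \<in> Gal L K" "\<tau> \<theta> = \<theta> \<oplus>\<^bsub>L\<^esub> \<one>\<^bsub>L\<^esub>"
    and \<theta>: "artin_schreier_generator p L K \<theta>" "\<theta> \<notin> Ov"
    and c: "c \<in> K" "c \<in> Mv" "c \<noteq> \<zero>\<^bsub>L\<^esub>" and \<eta>: "residual_generator (c \<otimes>\<^bsub>L\<^esub> \<theta>)"
    using ex_artin_schreier_generator by blast
  have \<theta>L: "\<theta> \<in> carrier L" and \<theta>K: "\<theta> [^]\<^bsub>L\<^esub> p \<ominus>\<^bsub>L\<^esub> \<theta> \<in> K"
    using \<theta>(1) unfolding artin_schreier_generator_def by blast+
  note g = residual_generator_closed[OF \<eta>]
  have cO: "c \<in> Ov" using Mv_Ov[OF c(2)] .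
  \<comment> \<open>The residue lies outside Kv, which contains 0; this gives the value 0
    exactly.\<close>
  have "res (c \<otimes>\<^bsub>L\<^esub> \<theta>) \<noteq> \<zero>\<^bsub>k\<^esub>"
    using g(4) subringE(2)[OF subfieldE(1)[OF residue_subfield[OF K_subfield]]] by metis
  then have "c \<otimes>\<^bsub>L\<^esub> \<theta> \<notin> Mv" using residue_zero_iff[OF g(1)] by simp
  then have v0: "v (c \<otimes>\<^bsub>L\<^esub> \<theta>) = 0" using v_eq_0_iff[OF g(2)] g(1) by simp
  have ram: "ramification_ideal L K v = PIdl\<^bsub>val_ring L v\<^esub> c"
    by (rule ramification_ideal_eq[OF \<theta>L \<theta>(2) \<theta>K \<tau> c(1) cO \<eta>])
  obtain q where q: "p = Suc q" using p_Suc by blast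
  \<comment> \<open>Turns the quotient of (c) by the ideal of c^(p-1) c into I/I^p.\<close>
  have "c [^]\<^bsub>L\<^esub> (p - 1) \<otimes>\<^bsub>L\<^esub> c = c [^]\<^bsub>L\<^esub> p" using q by simp
  then have iso: "module_isomorphic (val_ring L v)
      (quotient_module (ring_as_module (val_ring L v)) (PIdl\<^bsub>val_ring L v\<^esub> (c [^]\<^bsub>L\<^esub> (p - 1))))
      (quotient_module ((ring_as_module (val_ring L v))\<lparr>carrier := ramification_ideal L K v\<rparr>)
        (ramification_ideal L K v [^]\<^bsub>ideals_set (val_ring L v)\<^esub> p))"
    using domain.cgenideal_quotient_isomorphic[OF val_domain, of "c [^]\<^bsub>L\<^esub> (p - 1)" c] cO c(3)
      cring.cgenideal_power[OF val_cring, of c p]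
    unfolding ram by (simp add: val_pow)
  have "v \<theta> < 0" using v_neg_iff[OF \<theta>L] \<theta>(2) by simp
  moreover have "carrier (val_ring L v) = generate_ring L (insert (c \<otimes>\<^bsub>L\<^esub> \<theta>) (val_set v K))"
    using Ov_generated[OF \<eta>] by simp
  ultimately show ?thesis
    using \<theta>(1) c(1) v0 residue_field_generated[OF \<eta>] iso
      kaehler_isomorphic[OF \<theta>L \<theta>K c(1,2) \<eta>] by blast
qed

end
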